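(* Let $F$ be a field with $\operatorname{char}(F)\neq 2,3$, let $E/F$ be a field extension of degree $\leq 2$, and let $\mathcal{A}$ be a structurable algebra over $F$ such that $\mathcal{A}_E:=\mathcal{A}\otimes_F E$ is isomorphic to a matrix structurable algebra (over $E$). Then there is a hermitian cubic norm structure $\mathcal{K}=(J,N,\sharp,T)$ (over some quadratic étale extension $K/F$) such that $\mathcal{A}\cong\mathcal{A}(\mathcal{K})$.
   Context: **Conventions.** A quadratic étale extension $K/F$ is either a separable quadratic field extension or the split algebra $F\oplus F$; $\sigma$ is its non-trivial Galois automorphism (the exchange map in the split case), $t^\sigma=\sigma(t)$, $t^{2\sigma}=(t^\sigma)^2$. **Structurable algebra.** A structurable algebra over a field $F$ with $\operatorname{char}(F)\ne2,3$ is a unital, not necessarily commutative or associative, $F$-algebra $\mathcal{A}$ with an $F$-linear involution $x\mapsto\overline{x}$ (so $\overline{\overline{x}}=x$, $\overline{xy}=\overline{y}\,\overline{x}$) such that, with $V_{x,y}(z):=(x\overline{y})z+(z\overline{y})x-(z\overline{x})y$, one has $[V_{x,y},V_{z,w}]=V_{V_{x,y}(z),w}-V_{z,V_{y,x}(w)}$ for all $x,y,z,w$, where $[A,B]=AB-BA$. Isomorphisms are algebra isomorphisms compatible with the involutions; the involution is extended $E$-linearly to $\mathcal{A}_E$. **Matrix structurable algebra over a field $E$.** A cubic norm structure over $E$ is a quintuple $(J,N,\sharp,T,1)$, where $J$ is an $E$-vector space, $N\colon J\to E$, $\sharp\colon J\to J$ are maps, $T\colon J\times J\to E$ is a symmetric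 bilinear form and $1\in J\setminus\{0\}$, such that with $a\times b:=(a+b)^\sharp-a^\sharp-b^\sharp$, for all $t\in E$, $a,b\in J$: $(ta)^\sharp=t^2a^\sharp$; $N(ta)=t^3N(a)$; $N(a+b)=N(a)+T(b,a^\sharp)+T(a,b^\sharp)+N(b)$; $a^{\sharp\sharp}=N(a)a$; $1^\sharp=1$; $b=T(b,1)1-1\times b$. Given such a structure and $\eta\in E^\times$, the associated matrix structurable algebra is the space of matrices $\begin{pmatrix}s_1&j_1\\ j_2&s_2\end{pmatrix}$ with $s_1,s_2\in E$, $j_1,j_2\in J$, with involution $\overline{\begin{pmatrix}s_1&j_1\\ j_2&s_2\end{pmatrix}}=\begin{pmatrix}s_2&j_1\\ j_2&s_1\end{pmatrix}$ and multiplication $$\begin{pmatrix}s_1&j_1\\ j_2&s_2\end{pmatrix}\begin{pmatrix}s_1'&j_1'\\ j_2'&s_2'\end{pmatrix}=\begin{pmatrix}s_1s_1'+\eta T(j_1,j_2')&s_1j_1'+s_2'j_1+\eta\, (j_2\times j_2')\\ s_2j_2'+s_1'j_2+j_1\times j_1'&s_2s_2'+\eta T(j_2,j_1')\end{pmatrix}.$$ **Hermitian cubic norm structure.** A hermitian (non-unital) cubic norm structure over $K/F$ is a quadruple $\mathcal{K}=(J,N,\sharp,T)$, where $J$ is a left $K$-module, $N\colon J\to K$ is a non-zero map, $\sharp\colon J\to J$ is a map, and $T\colon J\times J\to K$ is a hermitian form (biadditive, $T(sa,tb)=st^\sigma T(a,b)$, $T(a,b)^\sigma=T(b,a)$), such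 that with $a\times b:=(a+b)^\sharp-a^\sharp-b^\sharp$, for all $t\in K$, $a,b\in J$: (i) $(ta)^\sharp=t^{2\sigma}a^\sharp$; (ii) $N(ta)=t^3N(a)$; (iii) $N(a+b)=N(a)+T(b,a^\sharp)+T(a,b^\sharp)+N(b)$; (iv) $a^{\sharp\sharp}=N(a)a$. **The algebra $\mathcal{A}(\mathcal{K})$.** $\mathcal{A}(\mathcal{K})=K\oplus J$ as an $F$-vector space, with involution $\overline{(s,b)}=(s^\sigma,b)$ and multiplication $(s,b)(t,c)=\bigl(st+T(b,c),\,sc+t^\sigma b+b\times c\bigr)$ for $s,t\in K$, $b,c\in J$. *)

theory Defs
  imports "HOL-Algebra.Algebra"
begin

section \<open>Structurable algebras\<close>

record ('a, 'b) inv_algebra = "('a, 'b) module" +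
  invol :: "'b \<Rightarrow> 'b"

text \<open>
  The locale \<^locale>\<open>algebra\<close> of the library is for commutative associative algebras, and
  \<^locale>\<open>ring\<close> requires associativity, so unital algebras without these laws are introduced here.
\<close>

locale unital_algebra = module F A for F (structure) and A (structure) +
  assumes mult_closed:
      "\<lbrakk>x \<in> carrier A; y \<in> carrier A\<rbrakk> \<Longrightarrow> x \<otimes>\<^bsub>A\<^esub> y \<in> carrier A"
    and unit_closed: "\<one>\<^bsub>A\<^esub> \<in> carrier A"
    and unit_left: "x \<in> carrier A \<Longrightarrow> \<one>\<^bsub>A\<^esub> \<otimes>\<^bsub>A\<^esub> x = x"
    and unit_right: "x \<in> carrier A \<Longrightarrow> x \<otimes>\<^bsub>A\<^esub> \<one>\<^bsub>A\<^esub> = x"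
    and mult_add_left:
      "\<lbrakk>x \<in> carrier A; y \<in> carrier A; z \<in> carrier A\<rbrakk> \<Longrightarrow>
        (x \<oplus>\<^bsub>A\<^esub> y) \<otimes>\<^bsub>A\<^esub> z = x \<otimes>\<^bsub>A\<^esub> z \<oplus>\<^bsub>A\<^esub> y \<otimes>\<^bsub>A\<^esub> z"
    and mult_add_right:
      "\<lbrakk>x \<in> carrier A; y \<in> carrier A; z \<in> carrier A\<rbrakk> \<Longrightarrow>
        x \<otimes>\<^bsub>A\<^esub> (y \<oplus>\<^bsub>A\<^esub> z) = x \<otimes>\<^bsub>A\<^esub> y \<oplus>\<^bsub>A\<^esub> x \<otimes>\<^bsub>A\<^esub> z"
    and mult_smult_left:
      "\<lbrakk>c \<in> carrier F; x \<in> carrier A; y \<in> carrier A\<rbrakk> \<Longrightarrow>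
        (c \<odot>\<^bsub>A\<^esub> x) \<otimes>\<^bsub>A\<^esub> y = c \<odot>\<^bsub>A\<^esub> (x \<otimes>\<^bsub>A\<^esub> y)"
    and mult_smult_right:
      "\<lbrakk>c \<in> carrier F; x \<in> carrier A; y \<in> carrier A\<rbrakk> \<Longrightarrow>
        x \<otimes>\<^bsub>A\<^esub> (c \<odot>\<^bsub>A\<^esub> y) = c \<odot>\<^bsub>A\<^esub> (x \<otimes>\<^bsub>A\<^esub> y)"

definition V_op :: "('f, 'a, 'm) inv_algebra_scheme \<Rightarrow> 'a \<Rightarrow> 'a \<Rightarrow> 'a \<Rightarrow> 'a" where
  "V_op A x y z =
     ((x \<otimes>\<^bsub>A\<^esub> invol A y) \<otimes>\<^bsub>A\<^esub> z \<oplus>\<^bsub>A\<^esub> (z \<otimes>\<^bsub>A\<^esub> invol A y) \<otimes>\<^bsub>A\<^esub> x)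
       \<ominus>\<^bsub>A\<^esub> (z \<otimes>\<^bsub>A\<^esub> invol A x) \<otimes>\<^bsub>A\<^esub> y"

locale structurable_algebra = field F + unital_algebra F A
  for F :: "('f, 'r) ring_scheme" (structure)
    and A :: "('f, 'a, 'm) inv_algebra_scheme" (structure) +
  assumes char_not_2: "[(2::nat)] \<cdot>\<^bsub>F\<^esub> \<one>\<^bsub>F\<^esub> \<noteq> \<zero>\<^bsub>F\<^esub>"
    and char_not_3: "[(3::nat)] \<cdot>\<^bsub>F\<^esub> \<one>\<^bsub>F\<^esub> \<noteq> \<zero>\<^bsub>F\<^esub>"
    and invol_closed: "x \<in> carrier A \<Longrightarrow> invol A x \<in> carrier A"
    and invol_add:
      "\<lbrakk>x \<in> carrier A; y \<in> carrier A\<rbrakk> \<Longrightarrow>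
        invol A (x \<oplus>\<^bsub>A\<^esub> y) = invol A x \<oplus>\<^bsub>A\<^esub> invol A y"
    and invol_smult:
      "\<lbrakk>c \<in> carrier F; x \<in> carrier A\<rbrakk> \<Longrightarrow> invol A (c \<odot>\<^bsub>A\<^esub> x) = c \<odot>\<^bsub>A\<^esub> invol A x"
    and invol_invol: "x \<in> carrier A \<Longrightarrow> invol A (invol A x) = x"
    and invol_mult:
      "\<lbrakk>x \<in> carrier A; y \<in> carrier A\<rbrakk> \<Longrightarrow>
        invol A (x \<otimes>\<^bsub>A\<^esub> y) = invol A y \<otimes>\<^bsub>A\<^esub> invol A x"
    and V_commutator:
      "\<lbrakk>x \<in> carrier A; y \<in> carrier A; z \<in> carrier A; w \<in> carrier A; u \<in> carrier A\<rbrakk> \<Longrightarrow>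
        V_op A x y (V_op A z w u) \<ominus>\<^bsub>A\<^esub> V_op A z w (V_op A x y u) =
        V_op A (V_op A x y z) w u \<ominus>\<^bsub>A\<^esub> V_op A z (V_op A y x w) u"

text \<open>
  Isomorphisms of unital algebras with involution over \<open>R\<close>. The library's \<^const>\<open>ring_iso\<close>
  presupposes no ring axioms: it is the set of bijections of the carriers respecting
  sum, product and unit.
\<close>

definition inv_algebra_iso ::
  "('r, 's) ring_scheme \<Rightarrow> ('r, 'a, 'm) inv_algebra_scheme \<Rightarrow>
    ('r, 'b, 'n) inv_algebra_scheme \<Rightarrow> ('a \<Rightarrow> 'b) set" where
  "inv_algebra_iso R A B =
     {\<phi> \<in> ring_iso A B.
        (\<forall>c \<in> carrier R. \<forall>x \<in> carrier A. \<phi> (c \<odot>\<^bsub>A\<^esub> x) = c \<odot>\<^bsub>B\<^esub> \<phi> x) \<and>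
        (\<forall>x \<in> carrier A. \<phi> (invol A x) = invol B (\<phi> x))}"

section \<open>Scalar extension\<close>

text \<open>
  As an abelian group, \<open>A \<otimes>\<^sub>F E\<close> is the free abelian group on \<open>A \<times> E\<close> modulo the subgroup
  generated by the relations of biadditivity and \<open>F\<close>-balancedness; the coset of
  \<open>frag_of (a, e)\<close> is the pure tensor of \<open>a\<close> and \<open>e\<close>.
\<close>

definition tensor_free ::
  "('f, 'a, 'm) module_scheme \<Rightarrow> ('f, 'e, 'n) module_scheme \<Rightarrow> ('a \<times> 'e \<Rightarrow>\<^sub>0 int) monoid" where
  "tensor_free A E = free_Abelian_group (carrier A \<times> carrier E)"

definition tensor_relators ::
  "('f, 'r) ring_scheme \<Rightarrow> ('f, 'a, 'm) module_scheme \<Rightarrow> ('f, 'e, 'n) module_scheme \<Rightarrow>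
    ('a \<times> 'e \<Rightarrow>\<^sub>0 int) set" where
  "tensor_relators F A E =
     {frag_of (a \<oplus>\<^bsub>A\<^esub> b, e) - frag_of (a, e) - frag_of (b, e) | a b e.
        a \<in> carrier A \<and> b \<in> carrier A \<and> e \<in> carrier E} \<union>
     {frag_of (a, d \<oplus>\<^bsub>E\<^esub> e) - frag_of (a, d) - frag_of (a, e) | a d e.
        a \<in> carrier A \<and> d \<in> carrier E \<and> e \<in> carrier E} \<union>
     {frag_of (c \<odot>\<^bsub>A\<^esub> a, e) - frag_of (a, c \<odot>\<^bsub>E\<^esub> e) | c a e.
        c \<in> carrier F \<and> a \<in> carrier A \<and> e \<in> carrier E}"

definition tensor_subgroup ::
  "('f, 'r) ring_scheme \<Rightarrow> ('f, 'a, 'm) module_scheme \<Rightarrow> ('f, 'e, 'n) module_scheme \<Rightarrow>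
    ('a \<times> 'e \<Rightarrow>\<^sub>0 int) set" where
  "tensor_subgroup F A E = generate (tensor_free A E) (tensor_relators F A E)"

definition tensor_class ::
  "('f, 'r) ring_scheme \<Rightarrow> ('f, 'a, 'm) module_scheme \<Rightarrow> ('f, 'e, 'n) module_scheme \<Rightarrow>
    ('a \<times> 'e \<Rightarrow>\<^sub>0 int) \<Rightarrow> ('a \<times> 'e \<Rightarrow>\<^sub>0 int) set" where
  "tensor_class F A E x = tensor_subgroup F A E #>\<^bsub>tensor_free A E\<^esub> x"

text \<open>
  Product, scalar action of \<open>E\<close> and involution are the (bi)additive extensions of
  \<open>(a \<otimes> d)(b \<otimes> e) = ab \<otimes> de\<close>, \<open>c(a \<otimes> e) = a \<otimes> ce\<close> and conjugation of the first factor.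
  They are given on cosets as unions over representatives; all representatives yield the same coset.
\<close>

definition scalar_extension ::
  "('f, 'r) ring_scheme \<Rightarrow> ('f, 'a, 'm) inv_algebra_scheme \<Rightarrow> ('f, 'e, 'n) module_scheme \<Rightarrow>
    ('e, ('a \<times> 'e \<Rightarrow>\<^sub>0 int) set) inv_algebra" where
  "scalar_extension F A E =
     (let Q = tensor_free A E Mod tensor_subgroup F A E; cls = tensor_class F A E in
      \<lparr>carrier = carrier Q,
       monoid.mult = (\<lambda>P R. \<Union>x\<in>P. \<Union>y\<in>R. cls (frag_extend (\<lambda>(a, d).
                 frag_extend (\<lambda>(b, e). frag_of (a \<otimes>\<^bsub>A\<^esub> b, d \<otimes>\<^bsub>E\<^esub> e)) y) x)),
       one = cls (frag_of (\<one>\<^bsub>A\<^esub>, \<one>\<^bsub>E\<^esub>)),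
       ring.zero = \<one>\<^bsub>Q\<^esub>,
       add = (\<lambda>P R. P \<otimes>\<^bsub>Q\<^esub> R),
       smult = (\<lambda>c P. \<Union>x\<in>P. cls (frag_extend (\<lambda>(a, e). frag_of (a, c \<otimes>\<^bsub>E\<^esub> e)) x)),
       invol = (\<lambda>P. \<Union>x\<in>P. cls (frag_extend (\<lambda>(a, e). frag_of (invol A a, e)) x))\<rparr>)"

section \<open>Field extensions\<close>

text \<open>
  An extension \<open>E/F\<close> is a commutative \<open>F\<close>-algebra that is a field. The library
  measures dimensions over subfields, so degrees are taken over the image of \<open>F\<close> in \<open>E\<close>.
\<close>

definition base_image :: "('f, 'r) ring_scheme \<Rightarrow> ('f, 'e, 'n) module_scheme \<Rightarrow> 'e set" where
  "base_image F E = (\<lambda>c. c \<odot>\<^bsub>E\<^esub> \<one>\<^bsub>E\<^esub>) ` carrier F"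

definition field_extension :: "('f, 'r) ring_scheme \<Rightarrow> ('f, 'e, 'n) module_scheme \<Rightarrow> bool" where
  "field_extension F E \<longleftrightarrow> field F \<and> field E \<and> algebra F E"

definition extension_degree ::
  "('f, 'r) ring_scheme \<Rightarrow> ('f, 'e, 'n) module_scheme \<Rightarrow> nat \<Rightarrow> bool" where
  "extension_degree F E n \<longleftrightarrow> ring.dimension E n (base_image F E) (carrier E)"

text \<open>
  In a quadratic extension the minimal polynomial of an element \<open>x\<close> outside \<open>F\<close> has the form
  \<open>X\<^sup>2 + bX + c\<close>; \<open>x\<close> is separable iff the derivative \<open>2X + b\<close> does not vanish at \<open>x\<close>.
\<close>

definition separable_quadratic ::
  "('f, 'r) ring_scheme \<Rightarrow> ('f, 'k, 'n) module_scheme \<Rightarrow> bool" where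
  "separable_quadratic F K \<longleftrightarrow>
     field_extension F K \<and> extension_degree F K 2 \<and>
     (\<forall>x \<in> carrier K - base_image F K.
        \<exists>b \<in> base_image F K. \<exists>c \<in> base_image F K.
          x \<otimes>\<^bsub>K\<^esub> x \<oplus>\<^bsub>K\<^esub> b \<otimes>\<^bsub>K\<^esub> x \<oplus>\<^bsub>K\<^esub> c = \<zero>\<^bsub>K\<^esub> \<and> x \<oplus>\<^bsub>K\<^esub> x \<oplus>\<^bsub>K\<^esub> b \<noteq> \<zero>\<^bsub>K\<^esub>)"

definition nontrivial_galois_aut ::
  "('f, 'r) ring_scheme \<Rightarrow> ('f, 'k, 'n) module_scheme \<Rightarrow> ('k \<Rightarrow> 'k) \<Rightarrow> bool" where
  "nontrivial_galois_aut F K \<sigma> \<longleftrightarrow>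
     \<sigma> \<in> ring_iso K K \<and> (\<forall>x \<in> base_image F K. \<sigma> x = x) \<and> (\<exists>x \<in> carrier K. \<sigma> x \<noteq> x)"

text \<open>\<open>K\<close> is isomorphic to \<open>F \<oplus> F\<close> in such a way that \<open>\<sigma>\<close> becomes the exchange map.\<close>

definition split_quadratic ::
  "('f, 'r) ring_scheme \<Rightarrow> ('f, 'k, 'n) module_scheme \<Rightarrow> ('k \<Rightarrow> 'k) \<Rightarrow> bool" where
  "split_quadratic F K \<sigma> \<longleftrightarrow>
     field F \<and> algebra F K \<and>
     (\<exists>\<phi> \<in> ring_iso K (RDirProd F F).
        (\<forall>c \<in> carrier F. \<forall>x \<in> carrier K.
           \<phi> (c \<odot>\<^bsub>K\<^esub> x) = (c \<otimes>\<^bsub>F\<^esub> fst (\<phi> x), c \<otimes>\<^bsub>F\<^esub> snd (\<phi> x))) \<and>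
        (\<forall>x \<in> carrier K. \<sigma> x \<in> carrier K \<and> \<phi> (\<sigma> x) = (snd (\<phi> x), fst (\<phi> x))))"

definition quadratic_etale ::
  "('f, 'r) ring_scheme \<Rightarrow> ('f, 'k, 'n) module_scheme \<Rightarrow> ('k \<Rightarrow> 'k) \<Rightarrow> bool" where
  "quadratic_etale F K \<sigma> \<longleftrightarrow>
     (separable_quadratic F K \<and> nontrivial_galois_aut F K \<sigma>) \<or> split_quadratic F K \<sigma>"

section \<open>Cubic norm structures and their algebras\<close>

text \<open>
  Vector spaces and modules \<open>J\<close> are module records; the ring operations \<^const>\<open>monoid.mult\<close> and
  \<^const>\<open>one\<close> that such records also carry are never used for \<open>J\<close>.
\<close>

definition sharp_cross :: "('k, 'j, 'n) module_scheme \<Rightarrow> ('j \<Rightarrow> 'j) \<Rightarrow> 'j \<Rightarrow> 'j \<Rightarrow> 'j" where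
  "sharp_cross J sharp a b = sharp (a \<oplus>\<^bsub>J\<^esub> b) \<ominus>\<^bsub>J\<^esub> sharp a \<ominus>\<^bsub>J\<^esub> sharp b"

locale cubic_norm_structure = field E + module E J
  for E :: "('e, 'r) ring_scheme" (structure) and J :: "('e, 'j, 'n) module_scheme" (structure)
    and N :: "'j \<Rightarrow> 'e" and sharp :: "'j \<Rightarrow> 'j" and T :: "'j \<Rightarrow> 'j \<Rightarrow> 'e" and u :: 'j +
  assumes N_closed: "a \<in> carrier J \<Longrightarrow> N a \<in> carrier E"
    and sharp_closed: "a \<in> carrier J \<Longrightarrow> sharp a \<in> carrier J"
    and T_closed: "\<lbrakk>a \<in> carrier J; b \<in> carrier J\<rbrakk> \<Longrightarrow> T a b \<in> carrier E"
    and T_add: "\<lbrakk>a \<in> carrier J; b \<in> carrier J; c \<in> carrier J\<rbrakk> \<Longrightarrow>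
        T (a \<oplus>\<^bsub>J\<^esub> b) c = T a c \<oplus>\<^bsub>E\<^esub> T b c"
    and T_smult: "\<lbrakk>t \<in> carrier E; a \<in> carrier J; b \<in> carrier J\<rbrakk> \<Longrightarrow>
        T (t \<odot>\<^bsub>J\<^esub> a) b = t \<otimes>\<^bsub>E\<^esub> T a b"
    and T_sym: "\<lbrakk>a \<in> carrier J; b \<in> carrier J\<rbrakk> \<Longrightarrow> T a b = T b a"
    and base_point: "u \<in> carrier J - {\<zero>\<^bsub>J\<^esub>}"
    and sharp_smult: "\<lbrakk>t \<in> carrier E; a \<in> carrier J\<rbrakk> \<Longrightarrow>
        sharp (t \<odot>\<^bsub>J\<^esub> a) = (t [^]\<^bsub>E\<^esub> (2::nat)) \<odot>\<^bsub>J\<^esub> sharp a"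
    and N_smult: "\<lbrakk>t \<in> carrier E; a \<in> carrier J\<rbrakk> \<Longrightarrow>
        N (t \<odot>\<^bsub>J\<^esub> a) = t [^]\<^bsub>E\<^esub> (3::nat) \<otimes>\<^bsub>E\<^esub> N a"
    and N_add: "\<lbrakk>a \<in> carrier J; b \<in> carrier J\<rbrakk> \<Longrightarrow>
        N (a \<oplus>\<^bsub>J\<^esub> b) = N a \<oplus>\<^bsub>E\<^esub> T b (sharp a) \<oplus>\<^bsub>E\<^esub> T a (sharp b) \<oplus>\<^bsub>E\<^esub> N b"
    and sharp_sharp: "a \<in> carrier J \<Longrightarrow> sharp (sharp a) = N a \<odot>\<^bsub>J\<^esub> a"
    and sharp_base_point: "sharp u = u"
    and cross_base_point: "b \<in> carrier J \<Longrightarrow>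
        b = T b u \<odot>\<^bsub>J\<^esub> u \<ominus>\<^bsub>J\<^esub> sharp_cross J sharp u b"

text \<open>The tuple \<open>(s1, j1, j2, s2)\<close> stands for the matrix with rows \<open>(s1, j1)\<close> and \<open>(j2, s2)\<close>.\<close>

definition matrix_algebra ::
  "('e, 'r) ring_scheme \<Rightarrow> ('e, 'j, 'n) module_scheme \<Rightarrow> ('j \<Rightarrow> 'j) \<Rightarrow> ('j \<Rightarrow> 'j \<Rightarrow> 'e) \<Rightarrow> 'e \<Rightarrow>
    ('e, 'e \<times> 'j \<times> 'j \<times> 'e) inv_algebra" where
  "matrix_algebra E J sharp T \<eta> =
     \<lparr>carrier = carrier E \<times> carrier J \<times> carrier J \<times> carrier E,
      monoid.mult = (\<lambda>(s1, j1, j2, s2) (t1, k1, k2, t2).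
        (s1 \<otimes>\<^bsub>E\<^esub> t1 \<oplus>\<^bsub>E\<^esub> \<eta> \<otimes>\<^bsub>E\<^esub> T j1 k2,
         s1 \<odot>\<^bsub>J\<^esub> k1 \<oplus>\<^bsub>J\<^esub> t2 \<odot>\<^bsub>J\<^esub> j1 \<oplus>\<^bsub>J\<^esub> \<eta> \<odot>\<^bsub>J\<^esub> sharp_cross J sharp j2 k2,
         s2 \<odot>\<^bsub>J\<^esub> k2 \<oplus>\<^bsub>J\<^esub> t1 \<odot>\<^bsub>J\<^esub> j2 \<oplus>\<^bsub>J\<^esub> sharp_cross J sharp j1 k1,
         s2 \<otimes>\<^bsub>E\<^esub> t2 \<oplus>\<^bsub>E\<^esub> \<eta> \<otimes>\<^bsub>E\<^esub> T j2 k1)),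
      one = (\<one>\<^bsub>E\<^esub>, \<zero>\<^bsub>J\<^esub>, \<zero>\<^bsub>J\<^esub>, \<one>\<^bsub>E\<^esub>),
      ring.zero = (\<zero>\<^bsub>E\<^esub>, \<zero>\<^bsub>J\<^esub>, \<zero>\<^bsub>J\<^esub>, \<zero>\<^bsub>E\<^esub>),
      add = (\<lambda>(s1, j1, j2, s2) (t1, k1, k2, t2).
        (s1 \<oplus>\<^bsub>E\<^esub> t1, j1 \<oplus>\<^bsub>J\<^esub> k1, j2 \<oplus>\<^bsub>J\<^esub> k2, s2 \<oplus>\<^bsub>E\<^esub> t2)),
      smult = (\<lambda>c (s1, j1, j2, s2). (c \<otimes>\<^bsub>E\<^esub> s1, c \<odot>\<^bsub>J\<^esub> j1, c \<odot>\<^bsub>J\<^esub> j2, c \<otimes>\<^bsub>E\<^esub> s2)),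
      invol = (\<lambda>(s1, j1, j2, s2). (s2, j1, j2, s1))\<rparr>"

locale hermitian_cubic_norm_structure = module K J
  for F :: "('f, 'r) ring_scheme" and K :: "('f, 'k, 'm) module_scheme" (structure)
    and \<sigma> :: "'k \<Rightarrow> 'k" and J :: "('k, 'j, 'n) module_scheme" (structure)
    and N :: "'j \<Rightarrow> 'k" and sharp :: "'j \<Rightarrow> 'j" and T :: "'j \<Rightarrow> 'j \<Rightarrow> 'k" +
  assumes quadratic_etale: "quadratic_etale F K \<sigma>"
    and N_closed: "a \<in> carrier J \<Longrightarrow> N a \<in> carrier K"
    and N_nonzero: "\<exists>a \<in> carrier J. N a \<noteq> \<zero>\<^bsub>K\<^esub>"
    and sharp_closed: "a \<in> carrier J \<Longrightarrow> sharp a \<in> carrier J"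
    and T_closed: "\<lbrakk>a \<in> carrier J; b \<in> carrier J\<rbrakk> \<Longrightarrow> T a b \<in> carrier K"
    and T_add_left: "\<lbrakk>a \<in> carrier J; b \<in> carrier J; c \<in> carrier J\<rbrakk> \<Longrightarrow>
        T (a \<oplus>\<^bsub>J\<^esub> b) c = T a c \<oplus>\<^bsub>K\<^esub> T b c"
    and T_add_right: "\<lbrakk>a \<in> carrier J; b \<in> carrier J; c \<in> carrier J\<rbrakk> \<Longrightarrow>
        T a (b \<oplus>\<^bsub>J\<^esub> c) = T a b \<oplus>\<^bsub>K\<^esub> T a c"
    and T_smult: "\<lbrakk>s \<in> carrier K; t \<in> carrier K; a \<in> carrier J; b \<in> carrier J\<rbrakk> \<Longrightarrow>
        T (s \<odot>\<^bsub>J\<^esub> a) (t \<odot>\<^bsub>J\<^esub> b) = s \<otimes>\<^bsub>K\<^esub> \<sigma> t \<otimes>\<^bsub>K\<^esub> T a b"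
    and T_hermitian: "\<lbrakk>a \<in> carrier J; b \<in> carrier J\<rbrakk> \<Longrightarrow> \<sigma> (T a b) = T b a"
    and sharp_smult: "\<lbrakk>t \<in> carrier K; a \<in> carrier J\<rbrakk> \<Longrightarrow>
        sharp (t \<odot>\<^bsub>J\<^esub> a) = (\<sigma> t [^]\<^bsub>K\<^esub> (2::nat)) \<odot>\<^bsub>J\<^esub> sharp a"
    and N_smult: "\<lbrakk>t \<in> carrier K; a \<in> carrier J\<rbrakk> \<Longrightarrow>
        N (t \<odot>\<^bsub>J\<^esub> a) = t [^]\<^bsub>K\<^esub> (3::nat) \<otimes>\<^bsub>K\<^esub> N a"
    and N_add: "\<lbrakk>a \<in> carrier J; b \<in> carrier J\<rbrakk> \<Longrightarrow>
        N (a \<oplus>\<^bsub>J\<^esub> b) = N a \<oplus>\<^bsub>K\<^esub> T b (sharp a) \<oplus>\<^bsub>K\<^esub> T a (sharp b) \<oplus>\<^bsub>K\<^esub> N b"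
    and sharp_sharp: "a \<in> carrier J \<Longrightarrow> sharp (sharp a) = N a \<odot>\<^bsub>J\<^esub> a"

text \<open>The action of \<open>F\<close> on \<open>J\<close> is by restriction of scalars along \<open>c \<mapsto> c \<cdot> 1\<^sub>K\<close>.\<close>

definition hermitian_algebra ::
  "('f, 'k, 'm) module_scheme \<Rightarrow> ('k \<Rightarrow> 'k) \<Rightarrow> ('k, 'j, 'n) module_scheme \<Rightarrow>
    ('j \<Rightarrow> 'j) \<Rightarrow> ('j \<Rightarrow> 'j \<Rightarrow> 'k) \<Rightarrow> ('f, 'k \<times> 'j) inv_algebra" where
  "hermitian_algebra K \<sigma> J sharp T =
     \<lparr>carrier = carrier K \<times> carrier J,
      monoid.mult = (\<lambda>(s, b) (t, c).
        (s \<otimes>\<^bsub>K\<^esub> t \<oplus>\<^bsub>K\<^esub> T b c,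
         s \<odot>\<^bsub>J\<^esub> c \<oplus>\<^bsub>J\<^esub> \<sigma> t \<odot>\<^bsub>J\<^esub> b \<oplus>\<^bsub>J\<^esub> sharp_cross J sharp b c)),
      one = (\<one>\<^bsub>K\<^esub>, \<zero>\<^bsub>J\<^esub>),
      ring.zero = (\<zero>\<^bsub>K\<^esub>, \<zero>\<^bsub>J\<^esub>),
      add = (\<lambda>(s, b) (t, c). (s \<oplus>\<^bsub>K\<^esub> t, b \<oplus>\<^bsub>J\<^esub> c)),
      smult = (\<lambda>c (s, b). (c \<odot>\<^bsub>K\<^esub> s, (c \<odot>\<^bsub>K\<^esub> \<one>\<^bsub>K\<^esub>) \<odot>\<^bsub>J\<^esub> b)),
      invol = (\<lambda>(s, b). (\<sigma> s, b))\<rparr>"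

text \<open>
  Types cannot be quantified over inside a formula, so a statement asserting the existence of
  \<open>K\<close> and \<open>J\<close> with \<open>A \<cong> A(K)\<close> has to name the types of their elements. Taking \<open>'f \<times> 'f\<close> for \<open>K\<close>
  and the element type of \<open>A\<close> for \<open>J\<close> loses no generality: a quadratic etale \<open>K\<close> is a
  two-dimensional \<open>F\<close>-vector space, and \<open>J\<close> embeds into \<open>K \<oplus> J \<cong> A\<close>.
\<close>

end

theory Submission
  imports Defs
begin

text \<open>
  Let \<open>M\<close> be the matrix structurable algebra over \<open>E\<close>. Write off-diagonal matrices as pairs
  \<open>b = (b\<^sub>1, b\<^sub>2)\<close> and diagonal ones as pairs \<open>(s\<^sub>1, s\<^sub>2)\<close>. The product of two off-diagonal matrices has
  diagonal part \<open>(\<eta> T(b\<^sub>1, c\<^sub>2), \<eta> T(b\<^sub>2, c\<^sub>1))\<close> and off-diagonal part \<open>(\<eta> (b\<^sub>2 \<times> c\<^sub>2), b\<^sub>1 \<times> c\<^sub>1)\<close>. So \<open>M\<close> is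
  itself the algebra of a hermitian cubic norm structure, over the split algebra \<open>E \<oplus> E\<close>: its
  adjoint is \<open>(\<eta> b\<^sub>2\<^sup>#, b\<^sub>1\<^sup>#)\<close> and its norm is \<open>(\<eta> N(b\<^sub>1), \<eta>\<^sup>2 N(b\<^sub>2))\<close>.

  The point is that this structure is intrinsic enough to descend to \<open>A\<close>. The skew elements of
  \<open>M\<close> are the multiples of the diagonal matrix \<open>(1, -1)\<close>. An \<open>F\<close>-linear retraction of \<open>E\<close> onto \<open>F\<close>
  shows that an \<open>E\<close>-multiple of an element of \<open>A\<close> which lies in \<open>A\<close> is an \<open>F\<close>-multiple
  (\<open>\<psi>_descends\<close>); hence the skew elements of \<open>A\<close> form a line \<open>F s\<close>, \<open>s\<^sup>2 = \<mu> 1\<close> with \<open>\<mu> \<in> F\<^sup>\<times>\<close>, and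
  \<open>K = F 1 \<oplus> F s\<close> is a quadratic etale algebra. For \<open>x \<in> A\<close> the difference of \<open>x\<close> and its conjugate
  is skew, and so is the anticommutator of \<open>s\<close> with their sum; together these elements determine
  the diagonal entries of \<open>x\<close>, and it follows that the diagonal part of \<open>x\<close> lies in \<open>K\<close>
  (\<open>diagonal_descends\<close>). Therefore \<open>A = K \<oplus> \<J>\<close>, where \<open>\<J>\<close> consists of the elements with
  off-diagonal image. The hermitian form is the \<open>K\<close>-part of \<open>b c\<close>, the adjoint is half the
  \<open>\<J>\<close>-part of \<open>b b\<close>, and the norm is a third of the hermitian form of \<open>b\<close> and its adjoint. All
  identities are then read off in the two coordinates of \<open>M\<close>.

  Only the non-vanishing of the norm on \<open>\<J>\<close> needs a further idea: a cubic form that vanishes on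
  an \<open>F\<close>-subspace has a polarisation that vanishes there, and the latter is \<open>E\<close>-linear in each
  variable, so it would vanish on the \<open>E\<close>-span, which contains the base point
  (\<open>N_nonzero_on_\<J>\<close>).
\<close>

section \<open>Retractions of a field extension onto its base field\<close>

lemma base_image_subfield:
  assumes "field_extension F E"
  shows "subfield (base_image F E) E" "inj_on (\<lambda>c. c \<odot>\<^bsub>E\<^esub> \<one>\<^bsub>E\<^esub>) (carrier F)"
proof -
  interpret F: field F using assms by (simp add: field_extension_def)
  interpret E: field E using assms by (simp add: field_extension_def)
  interpret A: algebra F E using assms by (simp add: field_extension_def)
  have hom: "(\<lambda>c. c \<odot>\<^bsub>E\<^esub> \<one>\<^bsub>E\<^esub>) \<in> ring_hom F E"
    by (rule ring_hom_memI) (simp_all add: A.smult_l_distr A.smult_assoc1 A.smult_assoc2)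
  interpret h: ring_hom_ring F E "\<lambda>c. c \<odot>\<^bsub>E\<^esub> \<one>\<^bsub>E\<^esub>"
    by (rule ring_hom_ringI2) (use hom in \<open>simp_all add: F.is_ring E.is_ring\<close>)
  show "subfield (base_image F E) E" "inj_on (\<lambda>c. c \<odot>\<^bsub>E\<^esub> \<one>\<^bsub>E\<^esub>) (carrier F)"
    using h.img_is_subfield[OF F.carrier_is_subfield] by (simp_all add: base_image_def)
qed

text \<open>
  Complete \<open>1\<close> to a basis of \<open>E\<close> over \<open>F\<close> and let \<open>l\<close> be the coordinate of \<open>1\<close>: the span \<open>W\<close> of the
  remaining basis vectors is a complement of \<open>F 1\<close>, and \<open>l\<close> is the projection along \<open>W\<close>.
\<close>

lemma retraction_exists:
  assumes ext: "field_extension F E" and deg: "extension_degree F E n"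
  obtains l where "\<And>e. e \<in> carrier E \<Longrightarrow> l e \<in> carrier F"
    and "\<And>d e. \<lbrakk>d \<in> carrier E; e \<in> carrier E\<rbrakk> \<Longrightarrow> l (d \<oplus>\<^bsub>E\<^esub> e) = l d \<oplus>\<^bsub>F\<^esub> l e"
    and "\<And>c e. \<lbrakk>c \<in> carrier F; e \<in> carrier E\<rbrakk> \<Longrightarrow> l (c \<odot>\<^bsub>E\<^esub> e) = c \<otimes>\<^bsub>F\<^esub> l e"
    and "l \<one>\<^bsub>E\<^esub> = \<one>\<^bsub>F\<^esub>"
proof -
  interpret F: field F using ext by (simp add: field_extension_def)
  interpret E: field E using ext by (simp add: field_extension_def)
  interpret A: algebra F E using ext by (simp add: field_extension_def)
  let ?B = "base_image F E"
  let ?i = "\<lambda>c. c \<odot>\<^bsub>E\<^esub> \<one>\<^bsub>E\<^esub>"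
  note sub = base_image_subfield(1)[OF ext]
  have smult: "c \<odot>\<^bsub>E\<^esub> e = ?i c \<otimes>\<^bsub>E\<^esub> e" if "c \<in> carrier F" "e \<in> carrier E" for c e
    using that by (simp add: A.smult_assoc2)
  have "E.independent ?B [\<one>\<^bsub>E\<^esub>]" by (rule E.li_Cons) auto
  then obtain Vs where Vs: "E.independent ?B (Vs @ [\<one>\<^bsub>E\<^esub>])" "E.Span ?B (Vs @ [\<one>\<^bsub>E\<^esub>]) = carrier E"
    using E.complete_base[OF sub deg[unfolded extension_degree_def], of "[\<one>\<^bsub>E\<^esub>]"]
    by (auto simp del: E.Span.simps)
  define W where "W = E.Span ?B Vs"
  have VsE: "set Vs \<subseteq> carrier E" using E.independent_in_carrier[OF Vs(1)] by simp
  have line: "E.Span ?B [\<one>\<^bsub>E\<^esub>] = ?B"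
    using subfieldE(3)[OF sub] by (force simp: E.line_extension_mem_iff)
  have decomp: "\<exists>c\<in>carrier F. \<exists>w\<in>W. e = w \<oplus>\<^bsub>E\<^esub> ?i c" if "e \<in> carrier E" for e
  proof -
    have "carrier E = W <+>\<^bsub>E\<^esub> ?B"
      using E.Span_append_eq_set_add[OF sub VsE, of "[\<one>\<^bsub>E\<^esub>]"] Vs(2) unfolding W_def line by simp
    then have "e \<in> W <+>\<^bsub>E\<^esub> ?B" using that by simp
    then show ?thesis unfolding set_add_def' by (auto simp: base_image_def)
  qed
  have W: "W \<subseteq> carrier E" "\<And>v w. v \<in> W \<Longrightarrow> w \<in> W \<Longrightarrow> v \<oplus>\<^bsub>E\<^esub> w \<in> W"
    "\<And>w. w \<in> W \<Longrightarrow> \<ominus>\<^bsub>E\<^esub> w \<in> W" "\<And>k w. k \<in> ?B \<Longrightarrow> w \<in> W \<Longrightarrow> k \<otimes>\<^bsub>E\<^esub> w \<in> W" "\<zero>\<^bsub>E\<^esub> \<in> W"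
    using E.Span_subgroup_props[OF sub VsE] E.Span_smult_closed[OF sub VsE] unfolding W_def by auto
  have inter: "W \<inter> ?B = {\<zero>\<^bsub>E\<^esub>}"
    using E.independent_split(3)[OF sub Vs(1)] unfolding W_def line by simp
  have unique: "c = d" if "w \<oplus>\<^bsub>E\<^esub> ?i c = v \<oplus>\<^bsub>E\<^esub> ?i d" "c \<in> carrier F" "d \<in> carrier F" "w \<in> W" "v \<in> W"
    for c d v w
  proof -
    have [simp]: "w \<in> carrier E" "v \<in> carrier E" "c \<in> carrier F" "d \<in> carrier F" using that W by auto
    have "w \<ominus>\<^bsub>E\<^esub> v = (w \<oplus>\<^bsub>E\<^esub> ?i c) \<ominus>\<^bsub>E\<^esub> ?i c \<ominus>\<^bsub>E\<^esub> v"
      by (simp add: E.minus_eq E.a_assoc E.r_neg)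
    also have "\<dots> = ?i d \<ominus>\<^bsub>E\<^esub> ?i c"
      unfolding that(1) by (simp add: E.minus_eq E.a_ac E.r_neg1 E.r_neg2)
    also have "\<dots> = ?i (d \<ominus>\<^bsub>F\<^esub> c)"
      by (simp add: F.minus_eq E.minus_eq A.smult_l_distr A.smult_l_minus)
    finally have eq: "w \<ominus>\<^bsub>E\<^esub> v = ?i (d \<ominus>\<^bsub>F\<^esub> c)" .
    have "w \<ominus>\<^bsub>E\<^esub> v \<in> W" using W that by (simp add: E.minus_eq)
    then have "?i (d \<ominus>\<^bsub>F\<^esub> c) \<in> W \<inter> ?B" unfolding eq by (simp add: base_image_def)
    then have "?i (d \<ominus>\<^bsub>F\<^esub> c) = ?i \<zero>\<^bsub>F\<^esub>" using inter by simp
    then have "d \<ominus>\<^bsub>F\<^esub> c = \<zero>\<^bsub>F\<^esub>"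
      using inj_onD[OF base_image_subfield(2)[OF ext]] by simp
    then show "c = d" by simp
  qed
  define l where "l e = (SOME c. c \<in> carrier F \<and> (\<exists>w\<in>W. e = w \<oplus>\<^bsub>E\<^esub> ?i c))" for e
  have l: "l e \<in> carrier F" "\<exists>w\<in>W. e = w \<oplus>\<^bsub>E\<^esub> ?i (l e)" if "e \<in> carrier E" for e
    using someI_ex[of "\<lambda>c. c \<in> carrier F \<and> (\<exists>w\<in>W. e = w \<oplus>\<^bsub>E\<^esub> ?i c)"] decomp[OF that]
    unfolding l_def by blast+
  have l_eqI: "l (w \<oplus>\<^bsub>E\<^esub> ?i c) = c" if "c \<in> carrier F" "w \<in> W" for c w
  proof -
    have "w \<oplus>\<^bsub>E\<^esub> ?i c \<in> carrier E" using that W(1) by auto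
    from l[OF this] show ?thesis using unique that by metis
  qed
  show ?thesis
  proof (rule that[of l])
    fix d e assume *: "d \<in> carrier E" "e \<in> carrier E"
    from l[OF *(1)] l[OF *(2)] obtain v w
      where vw: "v \<in> W" "w \<in> W" "d = v \<oplus>\<^bsub>E\<^esub> ?i (l d)" "e = w \<oplus>\<^bsub>E\<^esub> ?i (l e)" by blast
    have [simp]: "v \<in> carrier E" "w \<in> carrier E" "l d \<in> carrier F" "l e \<in> carrier F"
      using vw W(1) l * by auto
    have "d \<oplus>\<^bsub>E\<^esub> e = (v \<oplus>\<^bsub>E\<^esub> ?i (l d)) \<oplus>\<^bsub>E\<^esub> (w \<oplus>\<^bsub>E\<^esub> ?i (l e))" using vw by simp
    also have "\<dots> = (v \<oplus>\<^bsub>E\<^esub> w) \<oplus>\<^bsub>E\<^esub> ?i (l d \<oplus>\<^bsub>F\<^esub> l e)"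
      by (simp add: A.smult_l_distr E.a_ac)
    finally show "l (d \<oplus>\<^bsub>E\<^esub> e) = l d \<oplus>\<^bsub>F\<^esub> l e" using l_eqI vw W(2) by simp
  next
    fix c e assume *: "c \<in> carrier F" "e \<in> carrier E"
    from l[OF *(2)] obtain w where w: "w \<in> W" "e = w \<oplus>\<^bsub>E\<^esub> ?i (l e)" by blast
    have [simp]: "w \<in> carrier E" "l e \<in> carrier F" "c \<in> carrier F" using w W(1) l * by auto
    have "c \<odot>\<^bsub>E\<^esub> e = c \<odot>\<^bsub>E\<^esub> (w \<oplus>\<^bsub>E\<^esub> ?i (l e))" using w by simp
    also have "\<dots> = ?i c \<otimes>\<^bsub>E\<^esub> w \<oplus>\<^bsub>E\<^esub> ?i (c \<otimes>\<^bsub>F\<^esub> l e)"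
      by (simp add: A.smult_r_distr A.smult_assoc1 smult[of c w])
    finally show "l (c \<odot>\<^bsub>E\<^esub> e) = c \<otimes>\<^bsub>F\<^esub> l e"
      using l_eqI w W(4)[of "?i c" w] by (simp add: base_image_def)
  next
    show "l \<one>\<^bsub>E\<^esub> = \<one>\<^bsub>F\<^esub>" using l_eqI[of "\<one>\<^bsub>F\<^esub>" "\<zero>\<^bsub>E\<^esub>"] W(5) by simp
  qed (use l in auto)
qed

section \<open>Quadratic algebras \<open>F[X]/(X\<^sup>2 - \<mu>)\<close>\<close>

definition quadratic_algebra :: "('f, 'r) ring_scheme \<Rightarrow> 'f \<Rightarrow> ('f, 'f \<times> 'f) module" where
  "quadratic_algebra F \<mu> =
     \<lparr>carrier = carrier F \<times> carrier F,
      monoid.mult = (\<lambda>(a, b) (c, d).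
        (a \<otimes>\<^bsub>F\<^esub> c \<oplus>\<^bsub>F\<^esub> \<mu> \<otimes>\<^bsub>F\<^esub> (b \<otimes>\<^bsub>F\<^esub> d), a \<otimes>\<^bsub>F\<^esub> d \<oplus>\<^bsub>F\<^esub> b \<otimes>\<^bsub>F\<^esub> c)),
      one = (\<one>\<^bsub>F\<^esub>, \<zero>\<^bsub>F\<^esub>),
      ring.zero = (\<zero>\<^bsub>F\<^esub>, \<zero>\<^bsub>F\<^esub>),
      add = (\<lambda>(a, b) (c, d). (a \<oplus>\<^bsub>F\<^esub> c, b \<oplus>\<^bsub>F\<^esub> d)),
      smult = (\<lambda>c (a, b). (c \<otimes>\<^bsub>F\<^esub> a, c \<otimes>\<^bsub>F\<^esub> b))\<rparr>"

text \<open>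
  The pair \<open>(a, b)\<close> stands for \<open>a + b X\<close>, so conjugation is the exchange of the two square roots
  \<open>X\<close> and \<open>-X\<close> of \<open>\<mu>\<close>.
\<close>

definition conjugation :: "('f, 'r) ring_scheme \<Rightarrow> 'f \<times> 'f \<Rightarrow> 'f \<times> 'f" where
  "conjugation F = (\<lambda>(a, b). (a, \<ominus>\<^bsub>F\<^esub> b))"

lemma quadratic_algebra_sel [simp]:
  "carrier (quadratic_algebra F \<mu>) = carrier F \<times> carrier F"
  "x \<otimes>\<^bsub>quadratic_algebra F \<mu>\<^esub> y =
     (fst x \<otimes>\<^bsub>F\<^esub> fst y \<oplus>\<^bsub>F\<^esub> \<mu> \<otimes>\<^bsub>F\<^esub> (snd x \<otimes>\<^bsub>F\<^esub> snd y), fst x \<otimes>\<^bsub>F\<^esub> snd y \<oplus>\<^bsub>F\<^esub> snd x \<otimes>\<^bsub>F\<^esub> fst y)"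
  "\<one>\<^bsub>quadratic_algebra F \<mu>\<^esub> = (\<one>\<^bsub>F\<^esub>, \<zero>\<^bsub>F\<^esub>)"
  "\<zero>\<^bsub>quadratic_algebra F \<mu>\<^esub> = (\<zero>\<^bsub>F\<^esub>, \<zero>\<^bsub>F\<^esub>)"
  "x \<oplus>\<^bsub>quadratic_algebra F \<mu>\<^esub> y = (fst x \<oplus>\<^bsub>F\<^esub> fst y, snd x \<oplus>\<^bsub>F\<^esub> snd y)"
  "c \<odot>\<^bsub>quadratic_algebra F \<mu>\<^esub> x = (c \<otimes>\<^bsub>F\<^esub> fst x, c \<otimes>\<^bsub>F\<^esub> snd x)"
  by (simp_all add: quadratic_algebra_def split_beta)

lemma conjugation_sel [simp]: "conjugation F x = (fst x, \<ominus>\<^bsub>F\<^esub> snd x)"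
  by (simp add: conjugation_def split_beta)

lemma (in cring) quadratic_algebra_cring:
  assumes "\<mu> \<in> carrier R"
  shows "cring (quadratic_algebra R \<mu>)"
proof (rule cringI)
  show "abelian_group (quadratic_algebra R \<mu>)"
  proof (rule abelian_groupI)
    fix x assume "x \<in> carrier (quadratic_algebra R \<mu>)"
    then show "\<exists>y\<in>carrier (quadratic_algebra R \<mu>).
        y \<oplus>\<^bsub>quadratic_algebra R \<mu>\<^esub> x = \<zero>\<^bsub>quadratic_algebra R \<mu>\<^esub>"
      by (intro bexI[of _ "(\<ominus> fst x, \<ominus> snd x)"]) (auto simp: l_neg)
  qed (auto simp: a_ac)
  show "comm_monoid (quadratic_algebra R \<mu>)"
  proof (rule comm_monoidI)
    fix x y z
    assume *: "x \<in> carrier (quadratic_algebra R \<mu>)" "y \<in> carrier (quadratic_algebra R \<mu>)"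
      "z \<in> carrier (quadratic_algebra R \<mu>)"
    obtain a b c d e f where [simp]: "x = (a, b)" "y = (c, d)" "z = (e, f)"
      by (metis surj_pair)
    note [simp] = assms
    have cl [simp]: "a \<in> carrier R" "b \<in> carrier R" "c \<in> carrier R" "d \<in> carrier R"
      "e \<in> carrier R" "f \<in> carrier R"
      using * by auto
    show "x \<otimes>\<^bsub>quadratic_algebra R \<mu>\<^esub> y \<otimes>\<^bsub>quadratic_algebra R \<mu>\<^esub> z =
          x \<otimes>\<^bsub>quadratic_algebra R \<mu>\<^esub> (y \<otimes>\<^bsub>quadratic_algebra R \<mu>\<^esub> z)"
      by (simp add: cring_simprules)
    show "x \<otimes>\<^bsub>quadratic_algebra R \<mu>\<^esub> y = y \<otimes>\<^bsub>quadratic_algebra R \<mu>\<^esub> x"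
      by (simp add: cring_simprules)
  qed (use assms in auto)
  fix x y z
  assume *: "x \<in> carrier (quadratic_algebra R \<mu>)" "y \<in> carrier (quadratic_algebra R \<mu>)"
    "z \<in> carrier (quadratic_algebra R \<mu>)"
  obtain a b c d e f where [simp]: "x = (a, b)" "y = (c, d)" "z = (e, f)"
    by (metis surj_pair)
  note [simp] = assms
  have cl [simp]: "a \<in> carrier R" "b \<in> carrier R" "c \<in> carrier R" "d \<in> carrier R"
    "e \<in> carrier R" "f \<in> carrier R"
    using * by auto
  show "(x \<oplus>\<^bsub>quadratic_algebra R \<mu>\<^esub> y) \<otimes>\<^bsub>quadratic_algebra R \<mu>\<^esub> z =
      x \<otimes>\<^bsub>quadratic_algebra R \<mu>\<^esub> z \<oplus>\<^bsub>quadratic_algebra R \<mu>\<^esub> y \<otimes>\<^bsub>quadratic_algebra R \<mu>\<^esub> z"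
    by (simp add: cring_simprules)
qed

lemma (in cring) quadratic_algebra_algebra:
  assumes "\<mu> \<in> carrier R"
  shows "algebra R (quadratic_algebra R \<mu>)"
proof (rule algebraI)
  show "cring (quadratic_algebra R \<mu>)" using assms by (rule quadratic_algebra_cring)
  fix a x y
  assume *: "a \<in> carrier R" "x \<in> carrier (quadratic_algebra R \<mu>)" "y \<in> carrier (quadratic_algebra R \<mu>)"
  note [simp] = assms
  have cl [simp]: "a \<in> carrier R" "fst x \<in> carrier R" "snd x \<in> carrier R" "fst y \<in> carrier R" "snd y \<in> carrier R"
    using * by auto
  show "a \<odot>\<^bsub>quadratic_algebra R \<mu>\<^esub> x \<otimes>\<^bsub>quadratic_algebra R \<mu>\<^esub> y =
        a \<odot>\<^bsub>quadratic_algebra R \<mu>\<^esub> (x \<otimes>\<^bsub>quadratic_algebra R \<mu>\<^esub> y)"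
    by (simp add: cring_simprules)
qed (use is_cring in \<open>auto simp: l_distr r_distr m_assoc\<close>)

text \<open>
  A non-zero \<open>a + b X\<close> is inverted through its norm \<open>a\<^sup>2 - \<mu> b\<^sup>2\<close>; a zero of the norm with \<open>b \<noteq> 0\<close> would
  make \<open>\<mu>\<close> the square of \<open>a/b\<close>.
\<close>

lemma (in field) quadratic_algebra_field:
  assumes \<mu>: "\<mu> \<in> carrier R" and nonsquare: "\<And>r. r \<in> carrier R \<Longrightarrow> r \<otimes> r \<noteq> \<mu>"
  shows "field (quadratic_algebra R \<mu>)"
proof -
  interpret K: cring "quadratic_algebra R \<mu>" using \<mu> by (rule quadratic_algebra_cring)
  note [simp] = \<mu>
  show ?thesis
  proof (rule K.cring_fieldI2)
    fix x assume x: "x \<in> carrier (quadratic_algebra R \<mu>)" "x \<noteq> \<zero>\<^bsub>quadratic_algebra R \<mu>\<^esub>"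
    obtain a b where [simp]: "x = (a, b)" by force
    have cl [simp]: "a \<in> carrier R" "b \<in> carrier R" using x by auto
    define n where "n = a \<otimes> a \<ominus> \<mu> \<otimes> (b \<otimes> b)"
    have [simp]: "n \<in> carrier R" by (simp add: n_def)
    have "n \<noteq> \<zero>"
    proof
      assume "n = \<zero>"
      then have eq: "a \<otimes> a = \<mu> \<otimes> (b \<otimes> b)" by (simp add: n_def)
      show False
      proof (cases "b = \<zero>")
        case True
        with eq have "a = \<zero>" by (simp add: integral_iff)
        with True x show False by simp
      next
        case False
        then have [simp]: "inv b \<in> carrier R" and b: "b \<otimes> inv b = \<one>"
          by (auto simp: field_Units)
        have "(a \<otimes> inv b) \<otimes> (a \<otimes> inv b) = (a \<otimes> a) \<otimes> (inv b \<otimes> inv b)" by (simp add: cring_simprules)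
        also have "\<dots> = \<mu> \<otimes> ((b \<otimes> inv b) \<otimes> (b \<otimes> inv b))" unfolding eq by (simp add: cring_simprules)
        also have "\<dots> = \<mu>" by (simp add: b)
        finally show False using nonsquare[of "a \<otimes> inv b"] by simp
      qed
    qed
    then obtain m where [simp]: "m \<in> carrier R" and n: "n \<otimes> m = \<one>"
      by (metis \<open>n \<in> carrier R\<close> Units_r_inv_ex field_Units DiffI singletonD)
    have "a \<otimes> (a \<otimes> m) \<oplus> \<mu> \<otimes> (b \<otimes> (\<ominus> b \<otimes> m)) = n \<otimes> m"
      unfolding n_def by (simp add: cring_simprules)
    moreover have "a \<otimes> (\<ominus> b \<otimes> m) \<oplus> b \<otimes> (a \<otimes> m) = \<zero>" by (simp add: cring_simprules)
    ultimately show "\<exists>y\<in>carrier (quadratic_algebra R \<mu>).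
        x \<otimes>\<^bsub>quadratic_algebra R \<mu>\<^esub> y = \<one>\<^bsub>quadratic_algebra R \<mu>\<^esub>"
      by (intro bexI[of _ "(a \<otimes> m, \<ominus> b \<otimes> m)"]) (auto simp: n)
  qed simp
qed

text \<open>
  If \<open>\<mu>\<close> is not a square, this is a field, and every \<open>x = a + b X\<close> with \<open>b \<noteq> 0\<close> is separable: it is a
  root of \<open>Y\<^sup>2 - 2 a Y + (a\<^sup>2 - \<mu> b\<^sup>2)\<close>, whose derivative takes the value \<open>2 b X\<close> at \<open>x\<close>. If \<open>\<mu> = r\<^sup>2\<close>,
  evaluation at \<open>r\<close> and \<open>-r\<close> splits the algebra; this is invertible since \<open>2 r \<noteq> 0\<close>.
\<close>

lemma (in field) quadratic_algebra_etale:
  assumes two: "\<one> \<oplus> \<one> \<noteq> \<zero>" and \<mu>: "\<mu> \<in> carrier R" "\<mu> \<noteq> \<zero>"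
  shows "quadratic_etale R (quadratic_algebra R \<mu>) (conjugation R)"
proof (cases "\<exists>r\<in>carrier R. r \<otimes> r = \<mu>")
  case False
  define K where "K = quadratic_algebra R \<mu>"
  interpret K: field K unfolding K_def using False \<mu> by (intro quadratic_algebra_field) auto
  have alg: "algebra R K" using \<mu> unfolding K_def by (intro quadratic_algebra_algebra)
  then interpret A: algebra R K .
  have base: "base_image R K = carrier R \<times> {\<zero>}"
    by (force simp: base_image_def K_def)
  note [simp] = \<mu>(1)
  have dim: "extension_degree R K 2"
  proof -
    have "K.line_extension (base_image R K) (\<one>, \<zero>) {\<zero>\<^bsub>K\<^esub>} = base_image R K"
      unfolding base by (auto simp: K.line_extension_mem_iff) (auto simp: K_def)
    moreover have "K.dimension 1 (base_image R K)
        (K.line_extension (base_image R K) (\<one>, \<zero>) {\<zero>\<^bsub>K\<^esub>})"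
      unfolding One_nat_def by (rule K.Suc_dim[OF _ _ K.zero_dim]) (auto simp: K_def)
    ultimately have "K.dimension 1 (base_image R K) (base_image R K)" by simp
    then have "K.dimension (Suc 1) (base_image R K)
        (K.line_extension (base_image R K) (\<zero>, \<one>) (base_image R K))"
      by (intro K.Suc_dim) (auto simp: K_def base[unfolded K_def])
    moreover have "K.line_extension (base_image R K) (\<zero>, \<one>) (base_image R K) = carrier K"
      unfolding base by (auto simp: K.line_extension_mem_iff) (auto simp: K_def)
    ultimately show ?thesis unfolding extension_degree_def by (simp add: numeral_2_eq_2)
  qed
  have "\<exists>b \<in> base_image R K. \<exists>c \<in> base_image R K.
          x \<otimes>\<^bsub>K\<^esub> x \<oplus>\<^bsub>K\<^esub> b \<otimes>\<^bsub>K\<^esub> x \<oplus>\<^bsub>K\<^esub> c = \<zero>\<^bsub>K\<^esub> \<and> x \<oplus>\<^bsub>K\<^esub> x \<oplus>\<^bsub>K\<^esub> b \<noteq> \<zero>\<^bsub>K\<^esub>"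
    if x: "x \<in> carrier K - base_image R K" for x
  proof -
    obtain a b where [simp]: "x = (a, b)" by force
    have [simp]: "a \<in> carrier R" "b \<in> carrier R" and b: "b \<noteq> \<zero>"
      using x by (auto simp: K_def base[unfolded K_def])
    have "b \<oplus> b = (\<one> \<oplus> \<one>) \<otimes> b" by (simp add: l_distr)
    then have "b \<oplus> b \<noteq> \<zero>" using two b by (simp add: integral_iff)
    moreover have "a \<otimes> a \<oplus> \<mu> \<otimes> (b \<otimes> b) \<oplus> \<ominus> (a \<oplus> a) \<otimes> a \<oplus> (a \<otimes> a \<ominus> \<mu> \<otimes> (b \<otimes> b)) = \<zero>"
      by (simp add: cring_simprules)
    moreover have "a \<otimes> b \<oplus> b \<otimes> a \<oplus> \<ominus> (a \<oplus> a) \<otimes> b = \<zero>" by (simp add: cring_simprules)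
    ultimately show ?thesis
      by (intro bexI[of _ "(\<ominus> (a \<oplus> a), \<zero>)"] bexI[of _ "(a \<otimes> a \<ominus> \<mu> \<otimes> (b \<otimes> b), \<zero>)"])
        (auto simp: K_def base[unfolded K_def])
  qed
  then have "separable_quadratic R K"
    unfolding separable_quadratic_def field_extension_def
    using dim alg K.field_axioms field_axioms by blast
  moreover have "nontrivial_galois_aut R K (conjugation R)"
    unfolding nontrivial_galois_aut_def
  proof (intro conjI)
    show "conjugation R \<in> ring_iso K K"
    proof (rule ring_iso_memI)
      show "bij_betw (conjugation R) (carrier K) (carrier K)"
        by (rule bij_betw_byWitness[of _ "conjugation R"]) (auto simp: K_def)
    next
      fix x y assume "x \<in> carrier K" "y \<in> carrier K"
      then have [simp]: "fst x \<in> carrier R" "snd x \<in> carrier R" "fst y \<in> carrier R" "snd y \<in> carrier R"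
        by (auto simp: K_def)
      show "conjugation R (x \<otimes>\<^bsub>K\<^esub> y) = conjugation R x \<otimes>\<^bsub>K\<^esub> conjugation R y"
        by (simp add: K_def cring_simprules)
      show "conjugation R (x \<oplus>\<^bsub>K\<^esub> y) = conjugation R x \<oplus>\<^bsub>K\<^esub> conjugation R y"
        by (simp add: K_def minus_add)
    qed (auto simp: K_def)
    have "\<ominus> \<one> \<noteq> \<one>" using two by (metis r_neg one_closed)
    then show "\<exists>x\<in>carrier K. conjugation R x \<noteq> x"
      by (intro bexI[of _ "(\<zero>, \<one>)"]) (auto simp: K_def)
  qed (auto simp: base)
  ultimately show ?thesis unfolding quadratic_etale_def K_def by blast
next
  case True
  then obtain r where [simp]: "r \<in> carrier R" and r: "\<mu> = r \<otimes> r" by auto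
  note [simp] = \<mu>(1)
  have r0: "r \<noteq> \<zero>" using \<mu>(2) r by auto
  define h where "h = inv (\<one> \<oplus> \<one>)"
  have [simp]: "h \<in> carrier R" "inv r \<in> carrier R" and h: "(\<one> \<oplus> \<one>) \<otimes> h = \<one>" and ir: "r \<otimes> inv r = \<one>"
    using two r0 by (auto simp: h_def field_Units)
  let ?K = "quadratic_algebra R \<mu>"
  \<comment> \<open>evaluation at the two roots \<open>r\<close> and \<open>-r\<close>, and its inverse by interpolation\<close>
  define \<phi> where "\<phi> x = (fst x \<oplus> r \<otimes> snd x, fst x \<ominus> r \<otimes> snd x)" for x
  define \<psi> where "\<psi> x = ((fst x \<oplus> snd x) \<otimes> h, (fst x \<ominus> snd x) \<otimes> h \<otimes> inv r)" for x
  have \<phi>\<psi>: "\<phi> (\<psi> x) = x" "\<psi> (\<phi> x) = x" if "fst x \<in> carrier R" "snd x \<in> carrier R" for x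
  proof -
    obtain a b where [simp]: "x = (a, b)" by force
    have [simp]: "a \<in> carrier R" "b \<in> carrier R" using that by auto
    have half: "a \<otimes> ((\<one> \<oplus> \<one>) \<otimes> h) = a" "b \<otimes> ((\<one> \<oplus> \<one>) \<otimes> h) = b" by (simp_all add: h)
    have "(a \<oplus> b) \<otimes> h \<oplus> r \<otimes> ((a \<ominus> b) \<otimes> h \<otimes> inv r) = (a \<oplus> b) \<otimes> h \<oplus> (r \<otimes> inv r) \<otimes> ((a \<ominus> b) \<otimes> h)"
      by (simp add: cring_simprules)
    also have "\<dots> = a \<otimes> ((\<one> \<oplus> \<one>) \<otimes> h)" unfolding ir by (simp add: cring_simprules)
    finally have 1: "(a \<oplus> b) \<otimes> h \<oplus> r \<otimes> ((a \<ominus> b) \<otimes> h \<otimes> inv r) = a" using half by simp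
    have "(a \<oplus> b) \<otimes> h \<ominus> r \<otimes> ((a \<ominus> b) \<otimes> h \<otimes> inv r) = (a \<oplus> b) \<otimes> h \<ominus> (r \<otimes> inv r) \<otimes> ((a \<ominus> b) \<otimes> h)"
      by (simp add: cring_simprules)
    also have "\<dots> = b \<otimes> ((\<one> \<oplus> \<one>) \<otimes> h)"
      unfolding ir using \<open>a \<in> carrier R\<close> \<open>b \<in> carrier R\<close> \<open>h \<in> carrier R\<close> by algebra
    finally have 2: "(a \<oplus> b) \<otimes> h \<ominus> r \<otimes> ((a \<ominus> b) \<otimes> h \<otimes> inv r) = b" using half by simp
    show "\<phi> (\<psi> x) = x" using 1 2 by (simp add: \<phi>_def \<psi>_def)
    have "(a \<oplus> r \<otimes> b \<oplus> (a \<ominus> r \<otimes> b)) \<otimes> h = a \<otimes> ((\<one> \<oplus> \<one>) \<otimes> h)" by (simp add: cring_simprules)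
    moreover have "(a \<oplus> r \<otimes> b \<ominus> (a \<ominus> r \<otimes> b)) \<otimes> h \<otimes> inv r = (r \<otimes> inv r) \<otimes> (b \<otimes> ((\<one> \<oplus> \<one>) \<otimes> h))"
      by (simp add: cring_simprules)
    ultimately show "\<psi> (\<phi> x) = x" using half by (simp add: \<phi>_def \<psi>_def ir)
  qed
  have rdir: "x \<otimes>\<^bsub>RDirProd R R\<^esub> y = (fst x \<otimes> fst y, snd x \<otimes> snd y)"
      "x \<oplus>\<^bsub>RDirProd R R\<^esub> y = (fst x \<oplus> fst y, snd x \<oplus> snd y)"
      "\<one>\<^bsub>RDirProd R R\<^esub> = (\<one>, \<one>)" for x y
    by (auto simp: RDirProd_def DirProd_def monoid.defs split_beta)
  have "\<phi> \<in> ring_iso ?K (RDirProd R R)"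
  proof (rule ring_iso_memI)
    show "bij_betw \<phi> (carrier ?K) (carrier (RDirProd R R))"
      by (rule bij_betw_byWitness[of _ \<psi>])
        (auto simp: RDirProd_carrier \<phi>\<psi>, auto simp: \<phi>_def \<psi>_def)
  next
    fix x assume "x \<in> carrier ?K"
    then show "\<phi> x \<in> carrier (RDirProd R R)" by (auto simp: RDirProd_carrier \<phi>_def)
  next
    fix x y assume "x \<in> carrier ?K" "y \<in> carrier ?K"
    then have [simp]: "fst x \<in> carrier R" "snd x \<in> carrier R" "fst y \<in> carrier R" "snd y \<in> carrier R"
      by auto
    show "\<phi> (x \<otimes>\<^bsub>?K\<^esub> y) = \<phi> x \<otimes>\<^bsub>RDirProd R R\<^esub> \<phi> y"
      unfolding \<phi>_def r by (simp add: rdir cring_simprules)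
    show "\<phi> (x \<oplus>\<^bsub>?K\<^esub> y) = \<phi> x \<oplus>\<^bsub>RDirProd R R\<^esub> \<phi> y"
      unfolding \<phi>_def r by (simp add: rdir cring_simprules)
  next
    show "\<phi> \<one>\<^bsub>?K\<^esub> = \<one>\<^bsub>RDirProd R R\<^esub>" by (simp add: rdir \<phi>_def a_minus_def)
  qed
  moreover have "\<phi> (c \<odot>\<^bsub>?K\<^esub> x) = (c \<otimes> fst (\<phi> x), c \<otimes> snd (\<phi> x))"
    if "c \<in> carrier R" "x \<in> carrier ?K" for c x
  proof -
    have [simp]: "c \<in> carrier R" "fst x \<in> carrier R" "snd x \<in> carrier R" using that by auto
    show ?thesis by (simp add: \<phi>_def cring_simprules)
  qed
  moreover have "conjugation R x \<in> carrier ?K \<and> \<phi> (conjugation R x) = (snd (\<phi> x), fst (\<phi> x))"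
    if "x \<in> carrier ?K" for x
  proof -
    have [simp]: "fst x \<in> carrier R" "snd x \<in> carrier R" using that by auto
    show ?thesis by (simp add: \<phi>_def cring_simprules)
  qed
  ultimately have "split_quadratic R ?K (conjugation R)"
    unfolding split_quadratic_def using field_axioms quadratic_algebra_algebra[OF \<mu>(1)] by blast
  then show ?thesis unfolding quadratic_etale_def by blast
qed

section \<open>Cubic norm structures\<close>

context cubic_norm_structure
begin

abbreviation cross (infixl "\<times>\<^sub>#" 72) where "a \<times>\<^sub># b \<equiv> sharp_cross J sharp a b"

lemma T_add_right:
  "\<lbrakk>a \<in> carrier J; b \<in> carrier J; c \<in> carrier J\<rbrakk> \<Longrightarrow> T a (b \<oplus>\<^bsub>J\<^esub> c) = T a b \<oplus>\<^bsub>E\<^esub> T a c"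
  using T_add[of b c a] by (simp add: T_sym)

lemma T_smult_right:
  "\<lbrakk>t \<in> carrier E; a \<in> carrier J; b \<in> carrier J\<rbrakk> \<Longrightarrow> T a (t \<odot>\<^bsub>J\<^esub> b) = t \<otimes>\<^bsub>E\<^esub> T a b"
  using T_smult[of t b a] by (simp add: T_sym)

lemma T_zero_left [simp]: "a \<in> carrier J \<Longrightarrow> T \<zero>\<^bsub>J\<^esub> a = \<zero>\<^bsub>E\<^esub>"
  using T_smult[of "\<zero>\<^bsub>E\<^esub>" "\<zero>\<^bsub>J\<^esub>" a] by (simp add: T_closed)

lemma T_zero_right [simp]: "a \<in> carrier J \<Longrightarrow> T a \<zero>\<^bsub>J\<^esub> = \<zero>\<^bsub>E\<^esub>"
  using T_zero_left[of a] by (simp add: T_sym)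

lemma sharp_zero [simp]: "sharp \<zero>\<^bsub>J\<^esub> = \<zero>\<^bsub>J\<^esub>"
  using sharp_smult[of "\<zero>\<^bsub>E\<^esub>" "\<zero>\<^bsub>J\<^esub>"] by (simp add: sharp_closed numeral_2_eq_2)

lemma cross_closed [simp]: "\<lbrakk>a \<in> carrier J; b \<in> carrier J\<rbrakk> \<Longrightarrow> a \<times>\<^sub># b \<in> carrier J"
  by (simp add: sharp_cross_def sharp_closed)

lemma minus_zero_J [simp]: "\<ominus>\<^bsub>J\<^esub> \<zero>\<^bsub>J\<^esub> = \<zero>\<^bsub>J\<^esub>"
  by (rule M.minus_equality) simp_all

lemma cross_zero_left [simp]: "a \<in> carrier J \<Longrightarrow> \<zero>\<^bsub>J\<^esub> \<times>\<^sub># a = \<zero>\<^bsub>J\<^esub>"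
  and cross_zero_right [simp]: "a \<in> carrier J \<Longrightarrow> a \<times>\<^sub># \<zero>\<^bsub>J\<^esub> = \<zero>\<^bsub>J\<^esub>"
  by (simp_all add: sharp_cross_def sharp_closed M.minus_eq M.r_neg)

lemma sharp_add:
  assumes "a \<in> carrier J" "b \<in> carrier J"
  shows "sharp (a \<oplus>\<^bsub>J\<^esub> b) = a \<times>\<^sub># b \<oplus>\<^bsub>J\<^esub> sharp a \<oplus>\<^bsub>J\<^esub> sharp b"
  using assms by (simp add: sharp_cross_def sharp_closed M.minus_eq M.a_assoc M.r_neg1 M.r_neg2
      M.l_neg M.a_lcomm[of "\<ominus>\<^bsub>J\<^esub> sharp b"])

lemma cross_self:
  assumes "a \<in> carrier J"
  shows "a \<times>\<^sub># a = (\<one>\<^bsub>E\<^esub> \<oplus>\<^bsub>E\<^esub> \<one>\<^bsub>E\<^esub>) \<odot>\<^bsub>J\<^esub> sharp a"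
proof -
  have "a \<oplus>\<^bsub>J\<^esub> a = (\<one>\<^bsub>E\<^esub> \<oplus>\<^bsub>E\<^esub> \<one>\<^bsub>E\<^esub>) \<odot>\<^bsub>J\<^esub> a" using assms by (simp add: smult_l_distr)
  then have "sharp (a \<oplus>\<^bsub>J\<^esub> a) = ((\<one>\<^bsub>E\<^esub> \<oplus>\<^bsub>E\<^esub> \<one>\<^bsub>E\<^esub>) \<otimes>\<^bsub>E\<^esub> (\<one>\<^bsub>E\<^esub> \<oplus>\<^bsub>E\<^esub> \<one>\<^bsub>E\<^esub>)) \<odot>\<^bsub>J\<^esub> sharp a"
    using assms sharp_smult[of "\<one>\<^bsub>E\<^esub> \<oplus>\<^bsub>E\<^esub> \<one>\<^bsub>E\<^esub>" a] by (simp add: numeral_2_eq_2)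
  then show ?thesis
    using assms by (simp add: sharp_cross_def sharp_closed smult_l_distr l_distr M.minus_eq
        M.a_assoc M.r_neg M.a_lcomm[of _ "\<ominus>\<^bsub>J\<^esub> sharp a"])
qed

text \<open>
  Expanding \<open>N(a + b + c)\<close> along both bracketings gives expressions that differ only in these two
  terms. The trilinear form \<open>T(a, b \<times> c)\<close> is thus linear in every variable, although \<open>\<times>\<close> is not known
  to be bilinear when \<open>T\<close> is degenerate.
\<close>

lemma T_cross_rotate:
  assumes "a \<in> carrier J" "b \<in> carrier J" "c \<in> carrier J"
  shows "T c (a \<times>\<^sub># b) = T a (b \<times>\<^sub># c)"
proof -
  note [simp] = assms sharp_closed N_closed T_closed
  have "N (a \<oplus>\<^bsub>J\<^esub> b \<oplus>\<^bsub>J\<^esub> c) = N (a \<oplus>\<^bsub>J\<^esub> (b \<oplus>\<^bsub>J\<^esub> c))" by (simp add: M.a_assoc)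
  define S where "S = N a \<oplus>\<^bsub>E\<^esub> N b \<oplus>\<^bsub>E\<^esub> N c \<oplus>\<^bsub>E\<^esub> T a (sharp b) \<oplus>\<^bsub>E\<^esub> T a (sharp c) \<oplus>\<^bsub>E\<^esub> T b (sharp a)
    \<oplus>\<^bsub>E\<^esub> T b (sharp c) \<oplus>\<^bsub>E\<^esub> T c (sharp a) \<oplus>\<^bsub>E\<^esub> T c (sharp b)"
  have S [simp]: "S \<in> carrier E" by (simp add: S_def)
  have "N (a \<oplus>\<^bsub>J\<^esub> b \<oplus>\<^bsub>J\<^esub> c) = S \<oplus>\<^bsub>E\<^esub> T c (a \<times>\<^sub># b)"
    by (simp add: N_add sharp_add T_add T_add_right S_def cring_simprules)
  moreover have "N (a \<oplus>\<^bsub>J\<^esub> (b \<oplus>\<^bsub>J\<^esub> c)) = S \<oplus>\<^bsub>E\<^esub> T a (b \<times>\<^sub># c)"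
    by (simp add: N_add sharp_add T_add T_add_right S_def cring_simprules)
  ultimately have "S \<oplus>\<^bsub>E\<^esub> T c (a \<times>\<^sub># b) = S \<oplus>\<^bsub>E\<^esub> T a (b \<times>\<^sub># c)"
    by (simp add: M.a_assoc)
  then show ?thesis by simp
qed

text \<open>
  \<open>1 = 1\<^sup># = 1\<^sup>#\<^sup># = N(1) 1\<close>, and the base point is not zero.
\<close>

lemma N_base_point: "N u = \<one>\<^bsub>E\<^esub>"
proof (rule ccontr)
  assume neq: "N u \<noteq> \<one>\<^bsub>E\<^esub>"
  note [simp] = N_closed
  have u: "u \<in> carrier J" "u \<noteq> \<zero>\<^bsub>J\<^esub>" using base_point by auto
  have "N u \<odot>\<^bsub>J\<^esub> u = u" using sharp_sharp[OF u(1)] by (simp add: sharp_base_point)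
  then have *: "(N u \<ominus>\<^bsub>E\<^esub> \<one>\<^bsub>E\<^esub>) \<odot>\<^bsub>J\<^esub> u = \<zero>\<^bsub>J\<^esub>"
    using u by (simp add: cring_simprules(15) smult_l_distr smult_l_minus M.r_neg)
  have "N u \<ominus>\<^bsub>E\<^esub> \<one>\<^bsub>E\<^esub> \<in> Units E" using u neq by (simp add: field_Units)
  then obtain v where v: "v \<in> carrier E" "v \<otimes>\<^bsub>E\<^esub> (N u \<ominus>\<^bsub>E\<^esub> \<one>\<^bsub>E\<^esub>) = \<one>\<^bsub>E\<^esub>"
    by (auto simp: Units_def)
  have "(v \<otimes>\<^bsub>E\<^esub> (N u \<ominus>\<^bsub>E\<^esub> \<one>\<^bsub>E\<^esub>)) \<odot>\<^bsub>J\<^esub> u = \<zero>\<^bsub>J\<^esub>"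
    using u v(1) * by (subst smult_assoc1) auto
  then show False using v(2) u by simp
qed

text \<open>
  Euler's identity for the cubic form \<open>N\<close>: compare \<open>N(a + a) = 8 N(a)\<close> with the expansion
  \<open>2 N(a) + 2 T(a, a\<^sup>#)\<close>.
\<close>

lemma T_sharp_self:
  assumes two: "\<one>\<^bsub>E\<^esub> \<oplus>\<^bsub>E\<^esub> \<one>\<^bsub>E\<^esub> \<noteq> \<zero>\<^bsub>E\<^esub>" and a: "a \<in> carrier J"
  shows "T a (sharp a) = (\<one>\<^bsub>E\<^esub> \<oplus>\<^bsub>E\<^esub> \<one>\<^bsub>E\<^esub> \<oplus>\<^bsub>E\<^esub> \<one>\<^bsub>E\<^esub>) \<otimes>\<^bsub>E\<^esub> N a"
proof -
  note [simp] = a sharp_closed N_closed T_closed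
  define n where "n = N a"
  define t where "t = T a (sharp a)"
  have [simp]: "n \<in> carrier E" "t \<in> carrier E" by (auto simp: n_def t_def)
  have "a \<oplus>\<^bsub>J\<^esub> a = (\<one>\<^bsub>E\<^esub> \<oplus>\<^bsub>E\<^esub> \<one>\<^bsub>E\<^esub>) \<odot>\<^bsub>J\<^esub> a" by (simp add: smult_l_distr)
  then have "N (a \<oplus>\<^bsub>J\<^esub> a) = (\<one>\<^bsub>E\<^esub> \<oplus>\<^bsub>E\<^esub> \<one>\<^bsub>E\<^esub>) [^]\<^bsub>E\<^esub> (3::nat) \<otimes>\<^bsub>E\<^esub> n"
    using N_smult[of "\<one>\<^bsub>E\<^esub> \<oplus>\<^bsub>E\<^esub> \<one>\<^bsub>E\<^esub>" a] by (simp add: n_def)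
  also have "N (a \<oplus>\<^bsub>J\<^esub> a) = (n \<oplus>\<^bsub>E\<^esub> n) \<oplus>\<^bsub>E\<^esub> (t \<oplus>\<^bsub>E\<^esub> t)"
    by (simp add: N_add n_def t_def cring_simprules)
  also have "(\<one>\<^bsub>E\<^esub> \<oplus>\<^bsub>E\<^esub> \<one>\<^bsub>E\<^esub>) [^]\<^bsub>E\<^esub> (3::nat) \<otimes>\<^bsub>E\<^esub> n =
      (n \<oplus>\<^bsub>E\<^esub> n) \<oplus>\<^bsub>E\<^esub> (\<one>\<^bsub>E\<^esub> \<oplus>\<^bsub>E\<^esub> \<one>\<^bsub>E\<^esub>) \<otimes>\<^bsub>E\<^esub> (n \<oplus>\<^bsub>E\<^esub> n \<oplus>\<^bsub>E\<^esub> n)"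
    by (simp add: numeral_3_eq_3 l_distr r_distr cring_simprules)
  finally have "t \<oplus>\<^bsub>E\<^esub> t = (\<one>\<^bsub>E\<^esub> \<oplus>\<^bsub>E\<^esub> \<one>\<^bsub>E\<^esub>) \<otimes>\<^bsub>E\<^esub> (n \<oplus>\<^bsub>E\<^esub> n \<oplus>\<^bsub>E\<^esub> n)" by simp
  then have "(\<one>\<^bsub>E\<^esub> \<oplus>\<^bsub>E\<^esub> \<one>\<^bsub>E\<^esub>) \<otimes>\<^bsub>E\<^esub> t = (\<one>\<^bsub>E\<^esub> \<oplus>\<^bsub>E\<^esub> \<one>\<^bsub>E\<^esub>) \<otimes>\<^bsub>E\<^esub> (n \<oplus>\<^bsub>E\<^esub> n \<oplus>\<^bsub>E\<^esub> n)"
    by (simp add: l_distr)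
  then have "t = n \<oplus>\<^bsub>E\<^esub> n \<oplus>\<^bsub>E\<^esub> n" using two by (subst (asm) m_lcancel) auto
  then show ?thesis by (simp add: t_def n_def l_distr)
qed

end

section \<open>Scalar extension of an algebra with involution\<close>

locale structurable_algebra_extension = structurable_algebra F A + E: algebra F E
  for F :: "('f, 'r) ring_scheme" and A :: "('f, 'a, 'm) inv_algebra_scheme"
    and E :: "('f, 'e, 'n) module_scheme"
begin

abbreviation "\<G> \<equiv> tensor_free A E"
abbreviation "\<I> \<equiv> tensor_subgroup F A E"
abbreviation "cls \<equiv> tensor_class F A E"
abbreviation "A\<^sub>E \<equiv> scalar_extension F A E"
abbreviation "pairs \<equiv> carrier A \<times> carrier E"

lemma group_free [simp]: "group \<G>"
  and carrier_free [simp]: "x \<in> carrier \<G> \<longleftrightarrow> Poly_Mapping.keys x \<subseteq> pairs"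
  and mult_free [simp]: "x \<otimes>\<^bsub>\<G>\<^esub> y = x + y"
  and one_free [simp]: "\<one>\<^bsub>\<G>\<^esub> = 0"
  by (simp_all add: tensor_free_def)

lemma keys_add_subset: "Poly_Mapping.keys x \<subseteq> S \<Longrightarrow> Poly_Mapping.keys y \<subseteq> S \<Longrightarrow> Poly_Mapping.keys (x + y) \<subseteq> S"
  by (meson Poly_Mapping.keys_add Un_least order_trans)

lemma keys_diff_subset: "Poly_Mapping.keys x \<subseteq> S \<Longrightarrow> Poly_Mapping.keys y \<subseteq> S \<Longrightarrow> Poly_Mapping.keys (x - y) \<subseteq> S"
  by (meson keys_diff Un_least order_trans)

lemma relators_carrier: "tensor_relators F A E \<subseteq> carrier \<G>"
proof
  fix x assume "x \<in> tensor_relators F A E"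
  then have "Poly_Mapping.keys x \<subseteq> pairs"
    unfolding tensor_relators_def by (elim UnE CollectE exE conjE; simp add: keys_diff_subset)
  then show "x \<in> carrier \<G>" by simp
qed

lemma subgroup_relations: "subgroup \<I> \<G>"
  unfolding tensor_subgroup_def using group_free relators_carrier by (rule group.generate_is_subgroup)

lemma relations_zero: "0 \<in> \<I>"
  and relations_add: "x \<in> \<I> \<Longrightarrow> y \<in> \<I> \<Longrightarrow> x + y \<in> \<I>"
  and relations_uminus: "x \<in> \<I> \<Longrightarrow> - x \<in> \<I>"
  and relations_keys: "x \<in> \<I> \<Longrightarrow> Poly_Mapping.keys x \<subseteq> pairs"
proof -
  show "0 \<in> \<I>" using subgroup.one_closed[OF subgroup_relations] by simp
  show "x \<in> \<I> \<Longrightarrow> y \<in> \<I> \<Longrightarrow> x + y \<in> \<I>"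
    using subgroup.m_closed[OF subgroup_relations, of x y] by simp
  show keys: "x \<in> \<I> \<Longrightarrow> Poly_Mapping.keys x \<subseteq> pairs" for x
    using subgroup.mem_carrier[OF subgroup_relations, of x] by simp
  show "x \<in> \<I> \<Longrightarrow> - x \<in> \<I>"
    using subgroup.m_inv_closed[OF subgroup_relations, of x] keys[of x]
    by (simp add: tensor_free_def)
qed

lemma relations_diff: "x \<in> \<I> \<Longrightarrow> y \<in> \<I> \<Longrightarrow> x - y \<in> \<I>"
  using relations_add[of x "- y"] relations_uminus[of y] by simp

lemma relatorI: "x \<in> tensor_relators F A E \<Longrightarrow> x \<in> \<I>"
  unfolding tensor_subgroup_def by (rule generate.incl)

lemma relator_add_left:
  "\<lbrakk>a \<in> carrier A; b \<in> carrier A; e \<in> carrier E\<rbrakk> \<Longrightarrow>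
    frag_of (a \<oplus>\<^bsub>A\<^esub> b, e) - frag_of (a, e) - frag_of (b, e) \<in> \<I>"
  by (rule relatorI) (force simp: tensor_relators_def)

lemma relator_add_right:
  "\<lbrakk>a \<in> carrier A; d \<in> carrier E; e \<in> carrier E\<rbrakk> \<Longrightarrow>
    frag_of (a, d \<oplus>\<^bsub>E\<^esub> e) - frag_of (a, d) - frag_of (a, e) \<in> \<I>"
  by (rule relatorI) (force simp: tensor_relators_def)

lemma relator_balanced:
  "\<lbrakk>c \<in> carrier F; a \<in> carrier A; e \<in> carrier E\<rbrakk> \<Longrightarrow>
    frag_of (c \<odot>\<^bsub>A\<^esub> a, e) - frag_of (a, c \<odot>\<^bsub>E\<^esub> e) \<in> \<I>"
  by (rule relatorI) (force simp: tensor_relators_def)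

text \<open>
  The subgroup of relations is closed under differences, so a property that holds for the three
  kinds of relators and is preserved by differences holds throughout.
\<close>

lemma relations_induct [consumes 1, case_names zero add_left add_right balanced diff]:
  assumes "x \<in> \<I>" and zero: "P 0"
    and "\<And>a b e. \<lbrakk>a \<in> carrier A; b \<in> carrier A; e \<in> carrier E\<rbrakk> \<Longrightarrow>
      P (frag_of (a \<oplus>\<^bsub>A\<^esub> b, e) - frag_of (a, e) - frag_of (b, e))"
    and "\<And>a d e. \<lbrakk>a \<in> carrier A; d \<in> carrier E; e \<in> carrier E\<rbrakk> \<Longrightarrow>
      P (frag_of (a, d \<oplus>\<^bsub>E\<^esub> e) - frag_of (a, d) - frag_of (a, e))"
    and "\<And>c a e. \<lbrakk>c \<in> carrier F; a \<in> carrier A; e \<in> carrier E\<rbrakk> \<Longrightarrow>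
      P (frag_of (c \<odot>\<^bsub>A\<^esub> a, e) - frag_of (a, c \<odot>\<^bsub>E\<^esub> e))"
    and diff: "\<And>x y. \<lbrakk>x \<in> \<I>; y \<in> \<I>; P x; P y\<rbrakk> \<Longrightarrow> P (x - y)"
  shows "P x"
proof -
  have rel: "P r" if "r \<in> tensor_relators F A E" for r
    using that assms(3-5) unfolding tensor_relators_def by auto
  have "x \<in> generate \<G> (tensor_relators F A E)" using assms(1) by (simp add: tensor_subgroup_def)
  then have "P x \<and> x \<in> \<I>"
  proof induction
    case (inv h)
    then have "h \<in> \<I>" "inv\<^bsub>\<G>\<^esub> h = 0 - h"
      using relatorI relations_keys by (auto simp: tensor_free_def)
    then show ?case using inv diff[of 0 h] zero rel relations_zero relations_uminus by auto
  next
    case (eng h k)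
    then show ?case
      using diff[of h "0 - k"] diff[of 0 k] zero relations_zero relations_add relations_uminus by auto
  qed (auto simp: zero relations_zero rel relatorI)
  then show ?thesis by simp
qed

lemma class_eq_image: "cls v = (\<lambda>i. i + v) ` \<I>"
  unfolding tensor_class_def r_coset_def by auto

lemma class_eqI:
  assumes "v - w \<in> \<I>"
  shows "cls v = cls w"
proof -
  have "i + v \<in> cls w" if "i \<in> \<I>" for i
    unfolding class_eq_image by (rule image_eqI[of _ _ "i + (v - w)"]) (use that assms relations_add in auto)
  moreover have "i + w \<in> cls v" if "i \<in> \<I>" for i
    unfolding class_eq_image by (rule image_eqI[of _ _ "i - (v - w)"]) (use that assms relations_diff in auto)
  ultimately show ?thesis by (auto simp: class_eq_image)
qed

text \<open>
  The operations of the scalar extension are unions of cosets over all representatives. Such a union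
  is a single coset as soon as the class of the value does not depend on the representative.
\<close>

lemma class_Union:
  assumes "\<And>i. i \<in> \<I> \<Longrightarrow> h (i + v) - w \<in> \<I>"
  shows "(\<Union>x\<in>cls v. cls (h x)) = cls w"
proof -
  have "cls (h x) = cls w" if "x \<in> cls v" for x
    using that assms class_eqI unfolding class_eq_image by blast
  moreover have "cls v \<noteq> {}" using relations_zero by (auto simp: class_eq_image)
  ultimately show ?thesis by blast
qed

definition tmult where
  "tmult x y = frag_extend (\<lambda>(a, d). frag_extend (\<lambda>(b, e). frag_of (a \<otimes>\<^bsub>A\<^esub> b, d \<otimes>\<^bsub>E\<^esub> e)) y) x"

lemma tmult_frag: "tmult (frag_of (a, d)) (frag_of (b, e)) = frag_of (a \<otimes>\<^bsub>A\<^esub> b, d \<otimes>\<^bsub>E\<^esub> e)"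
  by (simp add: tmult_def)

lemma tmult_diff_left: "tmult (x - y) z = tmult x z - tmult y z"
  and tmult_add_left: "tmult (x + y) z = tmult x z + tmult y z"
  and tmult_zero_left: "tmult 0 z = 0"
  by (simp_all add: tmult_def frag_extend_diff frag_extend_add)

lemma tmult_add_right: "tmult x (y + z) = tmult x y + tmult x z"
  by (simp add: tmult_def frag_extend_def[of _ x] frag_extend_add frag_cmul_distrib2
      sum.distrib split_beta)

lemma tmult_zero_right: "tmult x 0 = 0"
  by (simp add: tmult_def frag_extend_def[of _ x] split_beta)

lemma tmult_diff_right: "tmult x (y - z) = tmult x y - tmult x z"
  using tmult_add_right[of x "y - z" z] by (simp add: algebra_simps)

text \<open>
  The relations absorb products from both sides, which makes the product of cosets well defined. By
  additivity, it suffices to multiply relators by pure tensors, and this yields relators again.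
\<close>

lemma tmult_relations_left:
  assumes "i \<in> \<I>" "Poly_Mapping.keys y \<subseteq> pairs"
  shows "tmult i y \<in> \<I>"
  using assms(2)
proof (induction y rule: frag_induction)
  case zero
  then show ?case by (simp add: tmult_zero_right relations_zero)
next
  case (diff x y)
  then show ?case by (simp add: tmult_diff_right relations_diff)
next
  case (one q)
  then obtain b f where q: "q = (b, f)" "b \<in> carrier A" "f \<in> carrier E" by auto
  show ?case
    using assms(1)
  proof (induction i rule: relations_induct)
    case (add_left a a' e)
    then show ?case
      using q relator_add_left[of "a \<otimes>\<^bsub>A\<^esub> b" "a' \<otimes>\<^bsub>A\<^esub> b" "e \<otimes>\<^bsub>E\<^esub> f"]
      by (simp add: tmult_diff_left tmult_frag mult_closed mult_add_left)
  next
    case (add_right a d e)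
    then show ?case
      using q relator_add_right[of "a \<otimes>\<^bsub>A\<^esub> b" "d \<otimes>\<^bsub>E\<^esub> f" "e \<otimes>\<^bsub>E\<^esub> f"]
      by (simp add: tmult_diff_left tmult_frag mult_closed E.l_distr)
  next
    case (balanced c a e)
    then show ?case
      using q relator_balanced[of c "a \<otimes>\<^bsub>A\<^esub> b" "e \<otimes>\<^bsub>E\<^esub> f"]
      by (simp add: tmult_diff_left tmult_frag mult_closed mult_smult_left E.smult_assoc2)
  qed (auto simp: tmult_zero_left tmult_diff_left relations_zero relations_diff)
qed

lemma tmult_relations_right:
  assumes "i \<in> \<I>" "Poly_Mapping.keys x \<subseteq> pairs"
  shows "tmult x i \<in> \<I>"
  using assms(2)
proof (induction x rule: frag_induction)
  case zero
  then show ?case by (simp add: tmult_zero_left relations_zero)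
next
  case (diff x y)
  then show ?case by (simp add: tmult_diff_left relations_diff)
next
  case (one q)
  then obtain b f where q: "q = (b, f)" "b \<in> carrier A" "f \<in> carrier E" by auto
  show ?case
    using assms(1)
  proof (induction i rule: relations_induct)
    case (add_left a a' e)
    then show ?case
      using q relator_add_left[of "b \<otimes>\<^bsub>A\<^esub> a" "b \<otimes>\<^bsub>A\<^esub> a'" "f \<otimes>\<^bsub>E\<^esub> e"]
      by (simp add: tmult_diff_right tmult_frag mult_closed mult_add_right)
  next
    case (add_right a d e)
    then show ?case
      using q relator_add_right[of "b \<otimes>\<^bsub>A\<^esub> a" "f \<otimes>\<^bsub>E\<^esub> d" "f \<otimes>\<^bsub>E\<^esub> e"]
      by (simp add: tmult_diff_right tmult_frag mult_closed E.r_distr)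
  next
    case (balanced c a e)
    then have "f \<otimes>\<^bsub>E\<^esub> (c \<odot>\<^bsub>E\<^esub> e) = c \<odot>\<^bsub>E\<^esub> (f \<otimes>\<^bsub>E\<^esub> e)"
      using q by (simp add: E.m_comm[of f] E.smult_assoc2)
    with balanced show ?case
      using q relator_balanced[of c "b \<otimes>\<^bsub>A\<^esub> a" "f \<otimes>\<^bsub>E\<^esub> e"]
      by (simp add: tmult_diff_right tmult_frag mult_closed mult_smult_right)
  qed (auto simp: tmult_zero_right tmult_diff_right relations_zero relations_diff)
qed

lemma carrier_extension: "carrier A\<^sub>E = cls ` carrier \<G>"
  by (auto simp: scalar_extension_def Let_def FactGroup_def RCOSETS_def tensor_class_def)

lemma one_extension: "\<one>\<^bsub>A\<^sub>E\<^esub> = cls (frag_of (\<one>\<^bsub>A\<^esub>, \<one>\<^bsub>E\<^esub>))"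
  by (simp add: scalar_extension_def Let_def)

lemma add_extension:
  assumes "v \<in> carrier \<G>" "w \<in> carrier \<G>"
  shows "cls v \<oplus>\<^bsub>A\<^sub>E\<^esub> cls w = cls (v + w)"
proof -
  have "comm_group \<G>" by (simp add: tensor_free_def abelian_free_Abelian_group)
  then have "\<I> \<lhd> \<G>" by (simp add: comm_group.normal_iff_subgroup subgroup_relations)
  then have "cls v <#>\<^bsub>\<G>\<^esub> cls w = cls (v \<otimes>\<^bsub>\<G>\<^esub> w)"
    unfolding tensor_class_def using assms by (rule normal.rcos_sum)
  then show ?thesis by (simp add: scalar_extension_def Let_def FactGroup_def)
qed

lemma mult_extension:
  assumes "v \<in> carrier \<G>" "w \<in> carrier \<G>"
  shows "cls v \<otimes>\<^bsub>A\<^sub>E\<^esub> cls w = cls (tmult v w)"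
proof -
  have "cls v \<otimes>\<^bsub>A\<^sub>E\<^esub> cls w = (\<Union>x\<in>cls v. \<Union>y\<in>cls w. cls (tmult x y))"
    by (simp add: scalar_extension_def Let_def tmult_def)
  also have "(\<Union>y\<in>cls w. cls (tmult x y)) = cls (tmult x w)" if "x \<in> cls v" for x
  proof (rule class_Union)
    fix i assume "i \<in> \<I>"
    moreover have "Poly_Mapping.keys x \<subseteq> pairs"
      using that assms(1) relations_keys keys_add_subset[of _ pairs v]
      unfolding class_eq_image carrier_free by blast
    ultimately show "tmult x (i + w) - tmult x w \<in> \<I>"
      by (simp add: tmult_add_right tmult_relations_right)
  qed
  then have "(\<Union>x\<in>cls v. \<Union>y\<in>cls w. cls (tmult x y)) = (\<Union>x\<in>cls v. cls (tmult x w))"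
    by simp
  also have "\<dots> = cls (tmult v w)"
    by (rule class_Union) (use assms in \<open>simp add: tmult_add_left tmult_relations_left\<close>)
  finally show ?thesis .
qed

text \<open>
  A map given on pure tensors induces an operation on cosets if it respects the three kinds of
  relators.
\<close>

lemma class_Union_frag_extend:
  assumes add_left: "\<And>a b e. \<lbrakk>a \<in> carrier A; b \<in> carrier A; e \<in> carrier E\<rbrakk> \<Longrightarrow>
      f (a \<oplus>\<^bsub>A\<^esub> b, e) - f (a, e) - f (b, e) \<in> \<I>"
    and add_right: "\<And>a d e. \<lbrakk>a \<in> carrier A; d \<in> carrier E; e \<in> carrier E\<rbrakk> \<Longrightarrow>
      f (a, d \<oplus>\<^bsub>E\<^esub> e) - f (a, d) - f (a, e) \<in> \<I>"
    and balanced: "\<And>c a e. \<lbrakk>c \<in> carrier F; a \<in> carrier A; e \<in> carrier E\<rbrakk> \<Longrightarrow>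
      f (c \<odot>\<^bsub>A\<^esub> a, e) - f (a, c \<odot>\<^bsub>E\<^esub> e) \<in> \<I>"
  shows "(\<Union>x\<in>cls v. cls (frag_extend f x)) = cls (frag_extend f v)"
proof (rule class_Union)
  fix i assume "i \<in> \<I>"
  then have "frag_extend f i \<in> \<I>"
    by (induction i rule: relations_induct)
      (auto simp: frag_extend_diff relations_zero relations_diff assms)
  then show "frag_extend f (i + v) - frag_extend f v \<in> \<I>" by (simp add: frag_extend_add)
qed

lemma smult_extension:
  assumes "c \<in> carrier E"
  shows "c \<odot>\<^bsub>A\<^sub>E\<^esub> cls v = cls (frag_extend (\<lambda>(a, e). frag_of (a, c \<otimes>\<^bsub>E\<^esub> e)) v)"
proof -
  have "c \<odot>\<^bsub>A\<^sub>E\<^esub> cls v = (\<Union>x\<in>cls v. cls (frag_extend (\<lambda>(a, e). frag_of (a, c \<otimes>\<^bsub>E\<^esub> e)) x))"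
    by (simp add: scalar_extension_def Let_def)
  also have "\<dots> = cls (frag_extend (\<lambda>(a, e). frag_of (a, c \<otimes>\<^bsub>E\<^esub> e)) v)"
  proof (rule class_Union_frag_extend, unfold split_conv)
    fix a d e assume "a \<in> carrier A" "d \<in> carrier E" "e \<in> carrier E"
    then show "frag_of (a, c \<otimes>\<^bsub>E\<^esub> (d \<oplus>\<^bsub>E\<^esub> e)) - frag_of (a, c \<otimes>\<^bsub>E\<^esub> d) - frag_of (a, c \<otimes>\<^bsub>E\<^esub> e) \<in> \<I>"
      using assms by (simp add: relator_add_right E.r_distr)
  next
    fix k a e assume *: "k \<in> carrier F" "a \<in> carrier A" "e \<in> carrier E"
    then have "c \<otimes>\<^bsub>E\<^esub> (k \<odot>\<^bsub>E\<^esub> e) = k \<odot>\<^bsub>E\<^esub> (c \<otimes>\<^bsub>E\<^esub> e)"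
      using assms by (simp add: E.m_comm[of c] E.smult_assoc2)
    then show "frag_of (k \<odot>\<^bsub>A\<^esub> a, c \<otimes>\<^bsub>E\<^esub> e) - frag_of (a, c \<otimes>\<^bsub>E\<^esub> (k \<odot>\<^bsub>E\<^esub> e)) \<in> \<I>"
      using * assms by (simp add: relator_balanced)
  qed (use assms in \<open>simp add: relator_add_left\<close>)
  finally show ?thesis .
qed

lemma invol_extension:
  "invol A\<^sub>E (cls v) = cls (frag_extend (\<lambda>(a, e). frag_of (invol A a, e)) v)"
proof -
  have "invol A\<^sub>E (cls v) = (\<Union>x\<in>cls v. cls (frag_extend (\<lambda>(a, e). frag_of (invol A a, e)) x))"
    by (simp add: scalar_extension_def Let_def)
  also have "\<dots> = cls (frag_extend (\<lambda>(a, e). frag_of (invol A a, e)) v)"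
    by (rule class_Union_frag_extend)
      (simp_all add: relator_add_left relator_add_right relator_balanced invol_closed invol_add invol_smult)
  finally show ?thesis .
qed

text \<open>
  The canonical map \<open>a \<mapsto> a \<otimes> 1\<close>.
\<close>

definition "\<iota> a = cls (frag_of (a, \<one>\<^bsub>E\<^esub>))"

lemma class_frag_of_closed: "\<lbrakk>a \<in> carrier A; e \<in> carrier E\<rbrakk> \<Longrightarrow> cls (frag_of (a, e)) \<in> carrier A\<^sub>E"
  by (simp add: carrier_extension)

lemma \<iota>_closed: "a \<in> carrier A \<Longrightarrow> \<iota> a \<in> carrier A\<^sub>E"
  by (simp add: \<iota>_def class_frag_of_closed)

lemma class_frag_of_add:
  assumes "a \<in> carrier A" "b \<in> carrier A" "e \<in> carrier E"
  shows "cls (frag_of (a \<oplus>\<^bsub>A\<^esub> b, e)) = cls (frag_of (a, e)) \<oplus>\<^bsub>A\<^sub>E\<^esub> cls (frag_of (b, e))"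
  using relator_add_left[OF assms] assms
  by (subst add_extension) (auto intro!: class_eqI simp: diff_diff_eq)

lemma \<iota>_add: "\<lbrakk>a \<in> carrier A; b \<in> carrier A\<rbrakk> \<Longrightarrow> \<iota> (a \<oplus>\<^bsub>A\<^esub> b) = \<iota> a \<oplus>\<^bsub>A\<^sub>E\<^esub> \<iota> b"
  by (simp add: \<iota>_def class_frag_of_add)

lemma \<iota>_mult: "\<lbrakk>a \<in> carrier A; b \<in> carrier A\<rbrakk> \<Longrightarrow> \<iota> (a \<otimes>\<^bsub>A\<^esub> b) = \<iota> a \<otimes>\<^bsub>A\<^sub>E\<^esub> \<iota> b"
  by (simp add: \<iota>_def mult_extension tmult_frag)

lemma \<iota>_one: "\<iota> \<one>\<^bsub>A\<^esub> = \<one>\<^bsub>A\<^sub>E\<^esub>"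
  by (simp add: \<iota>_def one_extension)

lemma \<iota>_invol: "a \<in> carrier A \<Longrightarrow> \<iota> (invol A a) = invol A\<^sub>E (\<iota> a)"
  by (simp add: \<iota>_def invol_extension)

lemma smult_\<iota>:
  "\<lbrakk>a \<in> carrier A; e \<in> carrier E\<rbrakk> \<Longrightarrow> e \<odot>\<^bsub>A\<^sub>E\<^esub> \<iota> a = cls (frag_of (a, e))"
  by (simp add: \<iota>_def smult_extension)

lemma \<iota>_smult:
  "\<lbrakk>c \<in> carrier F; a \<in> carrier A\<rbrakk> \<Longrightarrow> \<iota> (c \<odot>\<^bsub>A\<^esub> a) = (c \<odot>\<^bsub>E\<^esub> \<one>\<^bsub>E\<^esub>) \<odot>\<^bsub>A\<^sub>E\<^esub> \<iota> a"
  using relator_balanced[of c a "\<one>\<^bsub>E\<^esub>"] by (subst smult_\<iota>) (auto simp: \<iota>_def intro!: class_eqI)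

text \<open>
  The tensor product is spanned over \<open>E\<close> by the image of \<open>A\<close>. Negatives do not require a separate
  case, because \<open>-(a \<otimes> e) = (-a) \<otimes> e\<close>.
\<close>

lemma extension_induct [consumes 1, case_names add pure]:
  assumes "x \<in> carrier A\<^sub>E"
    and add: "\<And>x y. \<lbrakk>x \<in> carrier A\<^sub>E; y \<in> carrier A\<^sub>E; P x; P y\<rbrakk> \<Longrightarrow> P (x \<oplus>\<^bsub>A\<^sub>E\<^esub> y)"
    and pure: "\<And>e a. \<lbrakk>e \<in> carrier E; a \<in> carrier A\<rbrakk> \<Longrightarrow> P (e \<odot>\<^bsub>A\<^sub>E\<^esub> \<iota> a)"
  shows "P x"
proof -
  obtain v where v: "x = cls v" "Poly_Mapping.keys v \<subseteq> pairs"
    using assms(1) by (auto simp: carrier_extension)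
  \<comment> \<open>the relator of \<open>0 + 0\<close> is \<open>-(0 \<otimes> e)\<close>\<close>
  have zero: "frag_of (\<zero>\<^bsub>A\<^esub>, e) \<in> \<I>" if "e \<in> carrier E" for e
    using relations_uminus[OF relator_add_left[of "\<zero>\<^bsub>A\<^esub>" "\<zero>\<^bsub>A\<^esub>" e]] that by simp
  have minus: "cls (- frag_of (a, e)) = cls (frag_of (\<ominus>\<^bsub>A\<^esub> a, e))"
    if "a \<in> carrier A" "e \<in> carrier E" for a e
  proof (rule class_eqI)
    have "(frag_of (a \<oplus>\<^bsub>A\<^esub> \<ominus>\<^bsub>A\<^esub> a, e) - frag_of (a, e) - frag_of (\<ominus>\<^bsub>A\<^esub> a, e)) - frag_of (\<zero>\<^bsub>A\<^esub>, e) \<in> \<I>"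
      using that by (intro relations_diff relator_add_left zero) auto
    then show "- frag_of (a, e) - frag_of (\<ominus>\<^bsub>A\<^esub> a, e) \<in> \<I>" using that by (simp add: M.r_neg)
  qed
  have "P (cls v) \<and> P (cls (- v))"
  proof (rule free_Abelian_group_induct[OF v(2)])
    have "\<zero>\<^bsub>E\<^esub> \<odot>\<^bsub>A\<^sub>E\<^esub> \<iota> \<zero>\<^bsub>A\<^esub> = cls (frag_of (\<zero>\<^bsub>A\<^esub>, \<zero>\<^bsub>E\<^esub>))" by (simp add: smult_\<iota>)
    also have "\<dots> = cls 0" using zero by (intro class_eqI) simp
    finally show "P (cls 0) \<and> P (cls (- 0))" using pure[of "\<zero>\<^bsub>E\<^esub>" "\<zero>\<^bsub>A\<^esub>"] by simp
  next
    fix x y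
    assume *: "Poly_Mapping.keys x \<subseteq> pairs" "Poly_Mapping.keys y \<subseteq> pairs"
      "P (cls x) \<and> P (cls (- x))" "P (cls y) \<and> P (cls (- y))"
    then have "cls x \<oplus>\<^bsub>A\<^sub>E\<^esub> cls (- y) = cls (x - y)" "cls (- x) \<oplus>\<^bsub>A\<^sub>E\<^esub> cls y = cls (- (x - y))"
      by (simp_all add: add_extension)
    then show "P (cls (x - y)) \<and> P (cls (- (x - y)))"
      using add[of "cls x" "cls (- y)"] add[of "cls (- x)" "cls y"] * by (simp add: carrier_extension)
  next
    fix p assume "p \<in> pairs"
    then show "P (cls (frag_of p)) \<and> P (cls (- frag_of p))"
      using pure[of "snd p" "fst p"] pure[of "snd p" "\<ominus>\<^bsub>A\<^esub> fst p"] by (auto simp: minus smult_\<iota>)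
  qed
  then show ?thesis using v(1) by simp
qed

text \<open>
  An \<open>F\<close>-linear functional \<open>l\<close> on \<open>E\<close> induces \<open>id \<otimes> l\<close> from the scalar extension to \<open>A\<close>. This is how
  information is carried back from \<open>A\<^sub>E\<close> to \<open>A\<close>.
\<close>

lemma extension_retraction:
  assumes l_closed: "\<And>e. e \<in> carrier E \<Longrightarrow> l e \<in> carrier F"
    and l_add: "\<And>d e. \<lbrakk>d \<in> carrier E; e \<in> carrier E\<rbrakk> \<Longrightarrow> l (d \<oplus>\<^bsub>E\<^esub> e) = l d \<oplus>\<^bsub>F\<^esub> l e"
    and l_smult: "\<And>c e. \<lbrakk>c \<in> carrier F; e \<in> carrier E\<rbrakk> \<Longrightarrow> l (c \<odot>\<^bsub>E\<^esub> e) = c \<otimes>\<^bsub>F\<^esub> l e"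
  obtains \<pi> where "\<And>a e. \<lbrakk>a \<in> carrier A; e \<in> carrier E\<rbrakk> \<Longrightarrow> \<pi> (e \<odot>\<^bsub>A\<^sub>E\<^esub> \<iota> a) = l e \<odot>\<^bsub>A\<^esub> a"
proof -
  interpret add: comm_group "add_monoid A" by (rule M.a_comm_group)
  obtain h where h: "h \<in> hom (free_Abelian_group pairs) (add_monoid A)"
    and h_frag: "\<And>x. x \<in> pairs \<Longrightarrow> h (frag_of x) = l (snd x) \<odot>\<^bsub>A\<^esub> fst x"
    by (rule add.free_Abelian_group_universal[of "\<lambda>x. l (snd x) \<odot>\<^bsub>A\<^esub> fst x" pairs])
      (auto simp: l_closed)
  interpret h: group_hom \<G> "add_monoid A" h
    using h by (simp add: group_hom_def group_hom_axioms_def tensor_free_def M.a_group)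
  have h_closed: "h x \<in> carrier A" if "Poly_Mapping.keys x \<subseteq> pairs" for x
    using h.hom_closed[of x] that by simp
  have h_add: "h (x + y) = h x \<oplus>\<^bsub>A\<^esub> h y" if "Poly_Mapping.keys x \<subseteq> pairs" "Poly_Mapping.keys y \<subseteq> pairs" for x y
    using h.hom_mult[of x y] that by simp
  have h_diff: "h (x - y) = h x \<ominus>\<^bsub>A\<^esub> h y" if "Poly_Mapping.keys x \<subseteq> pairs" "Poly_Mapping.keys y \<subseteq> pairs" for x y
    using h.hom_mult[of "x - y" y] that h_closed[of "x - y"] h_closed[of y] keys_diff_subset[OF that]
    by (simp add: a_minus_def M.a_assoc M.r_neg)
  have h_zero: "h 0 = \<zero>\<^bsub>A\<^esub>" using h.hom_one by simp
  have cancel: "x \<oplus>\<^bsub>A\<^esub> y \<ominus>\<^bsub>A\<^esub> x \<ominus>\<^bsub>A\<^esub> y = \<zero>\<^bsub>A\<^esub>" if "x \<in> carrier A" "y \<in> carrier A" for x y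
    using that by (simp add: a_minus_def M.a_assoc M.a_comm[of x] M.r_neg1 M.r_neg2 M.r_neg)
  have kernel: "h i = \<zero>\<^bsub>A\<^esub>" if "i \<in> \<I>" for i
    using that
  proof (induction i rule: relations_induct)
    case (add_left a b e)
    then show ?case by (simp add: h_diff h_frag keys_diff_subset smult_r_distr l_closed cancel)
  next
    case (add_right a d e)
    then show ?case by (simp add: h_diff h_frag keys_diff_subset smult_l_distr l_add l_closed cancel)
  next
    case (balanced c a e)
    then show ?case
      by (simp add: h_diff h_frag smult_assoc1[symmetric] l_smult l_closed a_minus_def M.r_neg m_comm)
  qed (auto simp: h_zero h_diff relations_keys a_minus_def)
  have h_class: "h x = h v" if "x \<in> cls v" "Poly_Mapping.keys v \<subseteq> pairs" for x v
    using that kernel h_add relations_keys h_closed by (auto simp: class_eq_image)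
  show ?thesis
  proof (rule that[of "\<lambda>P. h (SOME x. x \<in> P)"])
    fix a e assume *: "a \<in> carrier A" "e \<in> carrier E"
    have "frag_of (a, e) \<in> cls (frag_of (a, e))"
      using relations_zero by (force simp: class_eq_image)
    then have "(SOME x. x \<in> cls (frag_of (a, e))) \<in> cls (frag_of (a, e))" by (rule someI)
    then show "h (SOME x. x \<in> e \<odot>\<^bsub>A\<^sub>E\<^esub> \<iota> a) = l e \<odot>\<^bsub>A\<^esub> a"
      using h_class * h_frag by (simp add: smult_\<iota>)
  qed
qed

end

section \<open>Matrix entries of the elements of a form\<close>

lemma (in cring) add_diff_cancel_double:
  assumes "x \<in> carrier R" "y \<in> carrier R"
  shows "x \<oplus> y \<oplus> \<ominus> (x \<oplus> \<ominus> y) = y \<oplus> y"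
  using assms by algebra

text \<open>
  \<open>A\<close> is an \<open>E/F\<close>-form of the matrix algebra: \<open>\<phi>\<close> identifies the two after scalar extension.
\<close>

locale form_of_matrix_algebra =
  structurable_algebra_extension F A E + J: cubic_norm_structure E J N sharp T u
  for F :: "('f, 'r) ring_scheme" and A :: "('f, 'a, 'm) inv_algebra_scheme"
    and E :: "('f, 'e, 'n) module_scheme" and J :: "('e, 'j, 'l) module_scheme"
    and N sharp T u +
  fixes \<eta> :: 'e and \<phi> :: "('a \<times> 'e \<Rightarrow>\<^sub>0 int) set \<Rightarrow> 'e \<times> 'j \<times> 'j \<times> 'e" and n :: nat
  assumes \<eta>: "\<eta> \<in> carrier E" "\<eta> \<noteq> \<zero>\<^bsub>E\<^esub>"
    and \<phi>: "\<phi> \<in> inv_algebra_iso E (scalar_extension F A E) (matrix_algebra E J sharp T \<eta>)"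
    and degree: "extension_degree F E n"
begin

lemmas \<eta>_closed [simp] = \<eta>(1)

notation J.cross (infixl "\<times>\<^sub>#" 72)

abbreviation "\<M> \<equiv> matrix_algebra E J sharp T \<eta>"

lemma field_ext: "field_extension F E"
  using field_axioms J.field_axioms E.algebra_axioms by (simp add: field_extension_def)

abbreviation emb :: "'f \<Rightarrow> 'e" where "emb c \<equiv> c \<odot>\<^bsub>E\<^esub> \<one>\<^bsub>E\<^esub>"

lemma emb_add: "\<lbrakk>c \<in> carrier F; d \<in> carrier F\<rbrakk> \<Longrightarrow> emb (c \<oplus>\<^bsub>F\<^esub> d) = emb c \<oplus>\<^bsub>E\<^esub> emb d"
  and emb_mult: "\<lbrakk>c \<in> carrier F; d \<in> carrier F\<rbrakk> \<Longrightarrow> emb (c \<otimes>\<^bsub>F\<^esub> d) = emb c \<otimes>\<^bsub>E\<^esub> emb d"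
  and emb_uminus: "c \<in> carrier F \<Longrightarrow> emb (\<ominus>\<^bsub>F\<^esub> c) = \<ominus>\<^bsub>E\<^esub> emb c"
  by (simp_all add: E.smult_l_distr E.smult_assoc1 E.smult_assoc2 E.smult_l_minus)

lemma emb_inj: "\<lbrakk>emb c = emb d; c \<in> carrier F; d \<in> carrier F\<rbrakk> \<Longrightarrow> c = d"
  using inj_onD[OF base_image_subfield(2)[OF field_ext]] by simp

lemma two_nonzero: "\<one>\<^bsub>F\<^esub> \<oplus>\<^bsub>F\<^esub> \<one>\<^bsub>F\<^esub> \<noteq> \<zero>\<^bsub>F\<^esub>"
  using char_not_2 by (simp add: numeral_2_eq_2)

lemma three_nonzero: "\<one>\<^bsub>F\<^esub> \<oplus>\<^bsub>F\<^esub> \<one>\<^bsub>F\<^esub> \<oplus>\<^bsub>F\<^esub> \<one>\<^bsub>F\<^esub> \<noteq> \<zero>\<^bsub>F\<^esub>"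
  using char_not_3 by (simp add: numeral_3_eq_3)

lemma two_nonzero_E: "\<one>\<^bsub>E\<^esub> \<oplus>\<^bsub>E\<^esub> \<one>\<^bsub>E\<^esub> \<noteq> \<zero>\<^bsub>E\<^esub>"
  using emb_inj[of "\<one>\<^bsub>F\<^esub> \<oplus>\<^bsub>F\<^esub> \<one>\<^bsub>F\<^esub>" "\<zero>\<^bsub>F\<^esub>"] two_nonzero by (auto simp: emb_add)

definition "half = inv\<^bsub>F\<^esub> (\<one>\<^bsub>F\<^esub> \<oplus>\<^bsub>F\<^esub> \<one>\<^bsub>F\<^esub>)"
definition "third = inv\<^bsub>F\<^esub> (\<one>\<^bsub>F\<^esub> \<oplus>\<^bsub>F\<^esub> \<one>\<^bsub>F\<^esub> \<oplus>\<^bsub>F\<^esub> \<one>\<^bsub>F\<^esub>)"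

lemma half_closed [simp]: "half \<in> carrier F" and third_closed [simp]: "third \<in> carrier F"
  using two_nonzero three_nonzero by (simp_all add: half_def third_def field_Units)

lemma emb_half: "(\<one>\<^bsub>E\<^esub> \<oplus>\<^bsub>E\<^esub> \<one>\<^bsub>E\<^esub>) \<otimes>\<^bsub>E\<^esub> emb half = \<one>\<^bsub>E\<^esub>"
proof -
  have "(\<one>\<^bsub>F\<^esub> \<oplus>\<^bsub>F\<^esub> \<one>\<^bsub>F\<^esub>) \<otimes>\<^bsub>F\<^esub> half = \<one>\<^bsub>F\<^esub>" using two_nonzero by (simp add: half_def field_Units)
  then have "emb ((\<one>\<^bsub>F\<^esub> \<oplus>\<^bsub>F\<^esub> \<one>\<^bsub>F\<^esub>) \<otimes>\<^bsub>F\<^esub> half) = \<one>\<^bsub>E\<^esub>" by simp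
  then show ?thesis by (simp add: emb_mult emb_add)
qed

lemma emb_third: "(\<one>\<^bsub>E\<^esub> \<oplus>\<^bsub>E\<^esub> \<one>\<^bsub>E\<^esub> \<oplus>\<^bsub>E\<^esub> \<one>\<^bsub>E\<^esub>) \<otimes>\<^bsub>E\<^esub> emb third = \<one>\<^bsub>E\<^esub>"
proof -
  have "(\<one>\<^bsub>F\<^esub> \<oplus>\<^bsub>F\<^esub> \<one>\<^bsub>F\<^esub> \<oplus>\<^bsub>F\<^esub> \<one>\<^bsub>F\<^esub>) \<otimes>\<^bsub>F\<^esub> third = \<one>\<^bsub>F\<^esub>"
    using three_nonzero by (simp add: third_def field_Units)
  then have "emb ((\<one>\<^bsub>F\<^esub> \<oplus>\<^bsub>F\<^esub> \<one>\<^bsub>F\<^esub> \<oplus>\<^bsub>F\<^esub> \<one>\<^bsub>F\<^esub>) \<otimes>\<^bsub>F\<^esub> third) = \<one>\<^bsub>E\<^esub>" by simp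
  then show ?thesis by (simp add: emb_mult emb_add)
qed

text \<open>
  \<open>\<psi>\<close> embeds \<open>A\<close> into the matrix algebra; from here on, elements of \<open>A\<close> are handled through the four
  entries \<open>s\<^sub>1\<close>, \<open>j\<^sub>1\<close>, \<open>j\<^sub>2\<close>, \<open>s\<^sub>2\<close> of their images.
\<close>

definition "\<psi> a = \<phi> (\<iota> a)"

lemma \<phi>_hom: "\<phi> \<in> ring_hom A\<^sub>E \<M>" and \<phi>_bij: "bij_betw \<phi> (carrier A\<^sub>E) (carrier \<M>)"
  and \<phi>_smult: "\<lbrakk>e \<in> carrier E; x \<in> carrier A\<^sub>E\<rbrakk> \<Longrightarrow> \<phi> (e \<odot>\<^bsub>A\<^sub>E\<^esub> x) = e \<odot>\<^bsub>\<M>\<^esub> \<phi> x"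
  and \<phi>_invol: "x \<in> carrier A\<^sub>E \<Longrightarrow> \<phi> (invol A\<^sub>E x) = invol \<M> (\<phi> x)"
  using \<phi> by (auto simp: inv_algebra_iso_def ring_iso_def)

lemma matrix_sel [simp]:
  "carrier \<M> = carrier E \<times> carrier J \<times> carrier J \<times> carrier E"
  "\<one>\<^bsub>\<M>\<^esub> = (\<one>\<^bsub>E\<^esub>, \<zero>\<^bsub>J\<^esub>, \<zero>\<^bsub>J\<^esub>, \<one>\<^bsub>E\<^esub>)"
  "(a, b, c, d) \<oplus>\<^bsub>\<M>\<^esub> (a', b', c', d') =
     (a \<oplus>\<^bsub>E\<^esub> a', b \<oplus>\<^bsub>J\<^esub> b', c \<oplus>\<^bsub>J\<^esub> c', d \<oplus>\<^bsub>E\<^esub> d')"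
  "(a, b, c, d) \<otimes>\<^bsub>\<M>\<^esub> (a', b', c', d') =
     (a \<otimes>\<^bsub>E\<^esub> a' \<oplus>\<^bsub>E\<^esub> \<eta> \<otimes>\<^bsub>E\<^esub> T b c',
      a \<odot>\<^bsub>J\<^esub> b' \<oplus>\<^bsub>J\<^esub> d' \<odot>\<^bsub>J\<^esub> b \<oplus>\<^bsub>J\<^esub> \<eta> \<odot>\<^bsub>J\<^esub> (c \<times>\<^sub># c'),
      d \<odot>\<^bsub>J\<^esub> c' \<oplus>\<^bsub>J\<^esub> a' \<odot>\<^bsub>J\<^esub> c \<oplus>\<^bsub>J\<^esub> b \<times>\<^sub># b',
      d \<otimes>\<^bsub>E\<^esub> d' \<oplus>\<^bsub>E\<^esub> \<eta> \<otimes>\<^bsub>E\<^esub> T c b')"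
  "e \<odot>\<^bsub>\<M>\<^esub> (a, b, c, d) = (e \<otimes>\<^bsub>E\<^esub> a, e \<odot>\<^bsub>J\<^esub> b, e \<odot>\<^bsub>J\<^esub> c, e \<otimes>\<^bsub>E\<^esub> d)"
  "invol \<M> (a, b, c, d) = (d, b, c, a)"
  by (simp_all add: matrix_algebra_def)

text \<open>
  Let \<open>b \<otimes> 1 = a \<otimes> e\<close>, and let \<open>l\<close> be a retraction of \<open>E\<close> onto \<open>F\<close>. Applying \<open>id \<otimes> l\<close> gives
  \<open>b = l(e) a\<close>.
\<close>

lemma \<psi>_descends:
  assumes "a \<in> carrier A" "b \<in> carrier A" "e \<in> carrier E" "\<psi> b = e \<odot>\<^bsub>\<M>\<^esub> \<psi> a"
  shows "\<exists>c\<in>carrier F. b = c \<odot>\<^bsub>A\<^esub> a"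
proof -
  obtain l where l: "\<And>e. e \<in> carrier E \<Longrightarrow> l e \<in> carrier F"
    "\<And>d e. \<lbrakk>d \<in> carrier E; e \<in> carrier E\<rbrakk> \<Longrightarrow> l (d \<oplus>\<^bsub>E\<^esub> e) = l d \<oplus>\<^bsub>F\<^esub> l e"
    "\<And>c e. \<lbrakk>c \<in> carrier F; e \<in> carrier E\<rbrakk> \<Longrightarrow> l (c \<odot>\<^bsub>E\<^esub> e) = c \<otimes>\<^bsub>F\<^esub> l e"
    "l \<one>\<^bsub>E\<^esub> = \<one>\<^bsub>F\<^esub>"
    using retraction_exists[OF field_ext degree] by blast
  obtain \<pi> where \<pi>: "\<And>a e. \<lbrakk>a \<in> carrier A; e \<in> carrier E\<rbrakk> \<Longrightarrow> \<pi> (e \<odot>\<^bsub>A\<^sub>E\<^esub> \<iota> a) = l e \<odot>\<^bsub>A\<^esub> a"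
    using extension_retraction[of l] l by blast
  have "\<phi> (\<one>\<^bsub>E\<^esub> \<odot>\<^bsub>A\<^sub>E\<^esub> \<iota> b) = \<phi> (e \<odot>\<^bsub>A\<^sub>E\<^esub> \<iota> a)"
    using assms \<phi>_smult[of e "\<iota> a"] smult_\<iota>[of b "\<one>\<^bsub>E\<^esub>"] by (simp add: \<psi>_def \<iota>_closed flip: \<iota>_def)
  then have "\<one>\<^bsub>E\<^esub> \<odot>\<^bsub>A\<^sub>E\<^esub> \<iota> b = e \<odot>\<^bsub>A\<^sub>E\<^esub> \<iota> a"
    using bij_betw_imp_inj_on[OF \<phi>_bij] assms by (auto simp: inj_on_def smult_\<iota> class_frag_of_closed)
  from arg_cong[OF this, of \<pi>] have "b = l e \<odot>\<^bsub>A\<^esub> a"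
    using assms by (simp add: \<pi> l(4))
  then show ?thesis using l(1) assms(3) by blast
qed

lemma \<psi>_spans:
  assumes "x \<in> carrier \<M>"
    and add: "\<And>x y. \<lbrakk>x \<in> carrier \<M>; y \<in> carrier \<M>; P x; P y\<rbrakk> \<Longrightarrow> P (x \<oplus>\<^bsub>\<M>\<^esub> y)"
    and pure: "\<And>e a. \<lbrakk>e \<in> carrier E; a \<in> carrier A\<rbrakk> \<Longrightarrow> P (e \<odot>\<^bsub>\<M>\<^esub> \<psi> a)"
  shows "P x"
proof -
  obtain z where z: "z \<in> carrier A\<^sub>E" "x = \<phi> z"
    using assms(1) bij_betw_imp_surj_on[OF \<phi>_bij] by blast
  have closed: "\<phi> y \<in> carrier \<M>" if "y \<in> carrier A\<^sub>E" for y
    using ring_hom_closed[OF \<phi>_hom that] .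
  have "P (\<phi> z)" using z(1)
  proof (induction z rule: extension_induct)
    case (add x y)
    then show ?case
      using closed assms(2) by (simp only: ring_hom_add[OF \<phi>_hom])
  next
    case (pure e a)
    then show ?case using assms(3) by (simp only: \<phi>_smult \<iota>_closed flip: \<psi>_def)
  qed
  then show ?thesis by (simp add: z)
qed

definition "s\<^sub>1 a = fst (\<psi> a)"
definition "j\<^sub>1 a = fst (snd (\<psi> a))"
definition "j\<^sub>2 a = fst (snd (snd (\<psi> a)))"
definition "s\<^sub>2 a = snd (snd (snd (\<psi> a)))"

lemma \<psi>_eq: "\<psi> a = (s\<^sub>1 a, j\<^sub>1 a, j\<^sub>2 a, s\<^sub>2 a)"
  by (simp add: s\<^sub>1_def j\<^sub>1_def j\<^sub>2_def s\<^sub>2_def)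

lemma entries_closed [simp]:
  assumes "a \<in> carrier A"
  shows "s\<^sub>1 a \<in> carrier E" "j\<^sub>1 a \<in> carrier J" "j\<^sub>2 a \<in> carrier J" "s\<^sub>2 a \<in> carrier E"
  using ring_hom_closed[OF \<phi>_hom \<iota>_closed[OF assms]] \<psi>_eq[of a] by (simp_all add: \<psi>_def)

lemma entries_eqI:
  assumes "a \<in> carrier A" "b \<in> carrier A" "s\<^sub>1 a = s\<^sub>1 b" "j\<^sub>1 a = j\<^sub>1 b" "j\<^sub>2 a = j\<^sub>2 b" "s\<^sub>2 a = s\<^sub>2 b"
  shows "a = b"
proof -
  have zero: "x = \<zero>\<^bsub>A\<^esub>" if "x \<in> carrier A" "\<psi> x = (\<zero>\<^bsub>E\<^esub>, \<zero>\<^bsub>J\<^esub>, \<zero>\<^bsub>J\<^esub>, \<zero>\<^bsub>E\<^esub>)" for x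
    using \<psi>_descends[of "\<zero>\<^bsub>A\<^esub>" x "\<zero>\<^bsub>E\<^esub>"] that by (auto simp: \<psi>_eq[of "\<zero>\<^bsub>A\<^esub>"])
  have add: "\<psi> (x \<oplus>\<^bsub>A\<^esub> y) = \<psi> x \<oplus>\<^bsub>\<M>\<^esub> \<psi> y" if "x \<in> carrier A" "y \<in> carrier A" for x y
    using that by (simp add: \<psi>_def \<iota>_add \<iota>_closed ring_hom_add[OF \<phi>_hom])
  have eq: "\<psi> a = \<psi> b" using assms by (simp add: \<psi>_eq)
  have "\<psi> (\<zero>\<^bsub>A\<^esub> \<oplus>\<^bsub>A\<^esub> \<zero>\<^bsub>A\<^esub>) = \<psi> \<zero>\<^bsub>A\<^esub> \<oplus>\<^bsub>\<M>\<^esub> \<psi> \<zero>\<^bsub>A\<^esub>" by (intro add) auto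
  then have "\<psi> \<zero>\<^bsub>A\<^esub> = (\<zero>\<^bsub>E\<^esub>, \<zero>\<^bsub>J\<^esub>, \<zero>\<^bsub>J\<^esub>, \<zero>\<^bsub>E\<^esub>)"
    by (simp add: \<psi>_eq)
  moreover have "\<psi> (a \<oplus>\<^bsub>A\<^esub> \<ominus>\<^bsub>A\<^esub> b) = \<psi> (b \<oplus>\<^bsub>A\<^esub> \<ominus>\<^bsub>A\<^esub> b)" using assms(1,2) by (simp only: add eq M.a_inv_closed)
  ultimately have "a \<oplus>\<^bsub>A\<^esub> \<ominus>\<^bsub>A\<^esub> b = \<zero>\<^bsub>A\<^esub>" using assms(1,2) by (intro zero) (auto simp: M.r_neg)
  then show ?thesis using assms(1,2) by (metis M.minus_equality M.minus_minus M.a_inv_closed)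
qed

lemma entries_add [simp]:
  assumes "a \<in> carrier A" "b \<in> carrier A"
  shows "s\<^sub>1 (a \<oplus>\<^bsub>A\<^esub> b) = s\<^sub>1 a \<oplus>\<^bsub>E\<^esub> s\<^sub>1 b" "j\<^sub>1 (a \<oplus>\<^bsub>A\<^esub> b) = j\<^sub>1 a \<oplus>\<^bsub>J\<^esub> j\<^sub>1 b"
    "j\<^sub>2 (a \<oplus>\<^bsub>A\<^esub> b) = j\<^sub>2 a \<oplus>\<^bsub>J\<^esub> j\<^sub>2 b" "s\<^sub>2 (a \<oplus>\<^bsub>A\<^esub> b) = s\<^sub>2 a \<oplus>\<^bsub>E\<^esub> s\<^sub>2 b"
proof -
  have "\<psi> (a \<oplus>\<^bsub>A\<^esub> b) = \<psi> a \<oplus>\<^bsub>\<M>\<^esub> \<psi> b"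
    using assms by (simp add: \<psi>_def \<iota>_add \<iota>_closed ring_hom_add[OF \<phi>_hom])
  then show "s\<^sub>1 (a \<oplus>\<^bsub>A\<^esub> b) = s\<^sub>1 a \<oplus>\<^bsub>E\<^esub> s\<^sub>1 b" "j\<^sub>1 (a \<oplus>\<^bsub>A\<^esub> b) = j\<^sub>1 a \<oplus>\<^bsub>J\<^esub> j\<^sub>1 b"
    "j\<^sub>2 (a \<oplus>\<^bsub>A\<^esub> b) = j\<^sub>2 a \<oplus>\<^bsub>J\<^esub> j\<^sub>2 b" "s\<^sub>2 (a \<oplus>\<^bsub>A\<^esub> b) = s\<^sub>2 a \<oplus>\<^bsub>E\<^esub> s\<^sub>2 b"
    by (simp_all add: \<psi>_eq)
qed

lemma entries_mult [simp]:
  assumes "a \<in> carrier A" "b \<in> carrier A"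
  shows "s\<^sub>1 (a \<otimes>\<^bsub>A\<^esub> b) = s\<^sub>1 a \<otimes>\<^bsub>E\<^esub> s\<^sub>1 b \<oplus>\<^bsub>E\<^esub> \<eta> \<otimes>\<^bsub>E\<^esub> T (j\<^sub>1 a) (j\<^sub>2 b)"
    "j\<^sub>1 (a \<otimes>\<^bsub>A\<^esub> b) = s\<^sub>1 a \<odot>\<^bsub>J\<^esub> j\<^sub>1 b \<oplus>\<^bsub>J\<^esub> s\<^sub>2 b \<odot>\<^bsub>J\<^esub> j\<^sub>1 a \<oplus>\<^bsub>J\<^esub> \<eta> \<odot>\<^bsub>J\<^esub> (j\<^sub>2 a \<times>\<^sub># j\<^sub>2 b)"
    "j\<^sub>2 (a \<otimes>\<^bsub>A\<^esub> b) = s\<^sub>2 a \<odot>\<^bsub>J\<^esub> j\<^sub>2 b \<oplus>\<^bsub>J\<^esub> s\<^sub>1 b \<odot>\<^bsub>J\<^esub> j\<^sub>2 a \<oplus>\<^bsub>J\<^esub> j\<^sub>1 a \<times>\<^sub># j\<^sub>1 b"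
    "s\<^sub>2 (a \<otimes>\<^bsub>A\<^esub> b) = s\<^sub>2 a \<otimes>\<^bsub>E\<^esub> s\<^sub>2 b \<oplus>\<^bsub>E\<^esub> \<eta> \<otimes>\<^bsub>E\<^esub> T (j\<^sub>2 a) (j\<^sub>1 b)"
proof -
  have "\<psi> (a \<otimes>\<^bsub>A\<^esub> b) = \<psi> a \<otimes>\<^bsub>\<M>\<^esub> \<psi> b"
    using assms by (simp add: \<psi>_def \<iota>_mult \<iota>_closed ring_hom_mult[OF \<phi>_hom])
  then show "s\<^sub>1 (a \<otimes>\<^bsub>A\<^esub> b) = s\<^sub>1 a \<otimes>\<^bsub>E\<^esub> s\<^sub>1 b \<oplus>\<^bsub>E\<^esub> \<eta> \<otimes>\<^bsub>E\<^esub> T (j\<^sub>1 a) (j\<^sub>2 b)"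
    "j\<^sub>1 (a \<otimes>\<^bsub>A\<^esub> b) = s\<^sub>1 a \<odot>\<^bsub>J\<^esub> j\<^sub>1 b \<oplus>\<^bsub>J\<^esub> s\<^sub>2 b \<odot>\<^bsub>J\<^esub> j\<^sub>1 a \<oplus>\<^bsub>J\<^esub> \<eta> \<odot>\<^bsub>J\<^esub> (j\<^sub>2 a \<times>\<^sub># j\<^sub>2 b)"
    "j\<^sub>2 (a \<otimes>\<^bsub>A\<^esub> b) = s\<^sub>2 a \<odot>\<^bsub>J\<^esub> j\<^sub>2 b \<oplus>\<^bsub>J\<^esub> s\<^sub>1 b \<odot>\<^bsub>J\<^esub> j\<^sub>2 a \<oplus>\<^bsub>J\<^esub> j\<^sub>1 a \<times>\<^sub># j\<^sub>1 b"
    "s\<^sub>2 (a \<otimes>\<^bsub>A\<^esub> b) = s\<^sub>2 a \<otimes>\<^bsub>E\<^esub> s\<^sub>2 b \<oplus>\<^bsub>E\<^esub> \<eta> \<otimes>\<^bsub>E\<^esub> T (j\<^sub>2 a) (j\<^sub>1 b)"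
    by (simp_all add: \<psi>_eq)
qed

lemma entries_invol [simp]:
  assumes "a \<in> carrier A"
  shows "s\<^sub>1 (invol A a) = s\<^sub>2 a" "j\<^sub>1 (invol A a) = j\<^sub>1 a" "j\<^sub>2 (invol A a) = j\<^sub>2 a" "s\<^sub>2 (invol A a) = s\<^sub>1 a"
proof -
  have "\<psi> (invol A a) = invol \<M> (\<psi> a)"
    using assms by (simp add: \<psi>_def \<iota>_invol \<iota>_closed \<phi>_invol)
  then show "s\<^sub>1 (invol A a) = s\<^sub>2 a" "j\<^sub>1 (invol A a) = j\<^sub>1 a" "j\<^sub>2 (invol A a) = j\<^sub>2 a" "s\<^sub>2 (invol A a) = s\<^sub>1 a"
    by (simp_all add: \<psi>_eq)
qed

lemma entries_smult [simp]:
  assumes "c \<in> carrier F" "a \<in> carrier A"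
  shows "s\<^sub>1 (c \<odot>\<^bsub>A\<^esub> a) = emb c \<otimes>\<^bsub>E\<^esub> s\<^sub>1 a" "j\<^sub>1 (c \<odot>\<^bsub>A\<^esub> a) = emb c \<odot>\<^bsub>J\<^esub> j\<^sub>1 a"
    "j\<^sub>2 (c \<odot>\<^bsub>A\<^esub> a) = emb c \<odot>\<^bsub>J\<^esub> j\<^sub>2 a" "s\<^sub>2 (c \<odot>\<^bsub>A\<^esub> a) = emb c \<otimes>\<^bsub>E\<^esub> s\<^sub>2 a"
proof -
  have "\<psi> (c \<odot>\<^bsub>A\<^esub> a) = emb c \<odot>\<^bsub>\<M>\<^esub> \<psi> a"
    using assms by (simp add: \<psi>_def \<iota>_smult \<iota>_closed \<phi>_smult)
  then show "s\<^sub>1 (c \<odot>\<^bsub>A\<^esub> a) = emb c \<otimes>\<^bsub>E\<^esub> s\<^sub>1 a" "j\<^sub>1 (c \<odot>\<^bsub>A\<^esub> a) = emb c \<odot>\<^bsub>J\<^esub> j\<^sub>1 a"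
    "j\<^sub>2 (c \<odot>\<^bsub>A\<^esub> a) = emb c \<odot>\<^bsub>J\<^esub> j\<^sub>2 a" "s\<^sub>2 (c \<odot>\<^bsub>A\<^esub> a) = emb c \<otimes>\<^bsub>E\<^esub> s\<^sub>2 a"
    by (simp_all add: \<psi>_eq)
qed

lemma entries_one [simp]:
  "s\<^sub>1 \<one>\<^bsub>A\<^esub> = \<one>\<^bsub>E\<^esub>" "j\<^sub>1 \<one>\<^bsub>A\<^esub> = \<zero>\<^bsub>J\<^esub>" "j\<^sub>2 \<one>\<^bsub>A\<^esub> = \<zero>\<^bsub>J\<^esub>" "s\<^sub>2 \<one>\<^bsub>A\<^esub> = \<one>\<^bsub>E\<^esub>"
proof -
  have "\<psi> \<one>\<^bsub>A\<^esub> = \<one>\<^bsub>\<M>\<^esub>" by (simp only: \<psi>_def \<iota>_one ring_hom_one[OF \<phi>_hom])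
  then show "s\<^sub>1 \<one>\<^bsub>A\<^esub> = \<one>\<^bsub>E\<^esub>" "j\<^sub>1 \<one>\<^bsub>A\<^esub> = \<zero>\<^bsub>J\<^esub>" "j\<^sub>2 \<one>\<^bsub>A\<^esub> = \<zero>\<^bsub>J\<^esub>" "s\<^sub>2 \<one>\<^bsub>A\<^esub> = \<one>\<^bsub>E\<^esub>"
    by (simp_all add: \<psi>_eq)
qed

lemma entries_zero [simp]:
  "s\<^sub>1 \<zero>\<^bsub>A\<^esub> = \<zero>\<^bsub>E\<^esub>" "j\<^sub>1 \<zero>\<^bsub>A\<^esub> = \<zero>\<^bsub>J\<^esub>" "j\<^sub>2 \<zero>\<^bsub>A\<^esub> = \<zero>\<^bsub>J\<^esub>" "s\<^sub>2 \<zero>\<^bsub>A\<^esub> = \<zero>\<^bsub>E\<^esub>"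
  using entries_smult[of "\<zero>\<^bsub>F\<^esub>" "\<zero>\<^bsub>A\<^esub>"] by simp_all

lemma entries_uminus [simp]:
  assumes "a \<in> carrier A"
  shows "s\<^sub>1 (\<ominus>\<^bsub>A\<^esub> a) = \<ominus>\<^bsub>E\<^esub> s\<^sub>1 a" "j\<^sub>1 (\<ominus>\<^bsub>A\<^esub> a) = \<ominus>\<^bsub>J\<^esub> j\<^sub>1 a"
    "j\<^sub>2 (\<ominus>\<^bsub>A\<^esub> a) = \<ominus>\<^bsub>J\<^esub> j\<^sub>2 a" "s\<^sub>2 (\<ominus>\<^bsub>A\<^esub> a) = \<ominus>\<^bsub>E\<^esub> s\<^sub>2 a"
proof -
  have "\<ominus>\<^bsub>A\<^esub> a \<oplus>\<^bsub>A\<^esub> a = \<zero>\<^bsub>A\<^esub>" using assms by (rule M.l_neg)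
  from arg_cong[OF this, of s\<^sub>1] arg_cong[OF this, of j\<^sub>1] arg_cong[OF this, of j\<^sub>2] arg_cong[OF this, of s\<^sub>2]
  show "s\<^sub>1 (\<ominus>\<^bsub>A\<^esub> a) = \<ominus>\<^bsub>E\<^esub> s\<^sub>1 a" "j\<^sub>1 (\<ominus>\<^bsub>A\<^esub> a) = \<ominus>\<^bsub>J\<^esub> j\<^sub>1 a"
    "j\<^sub>2 (\<ominus>\<^bsub>A\<^esub> a) = \<ominus>\<^bsub>J\<^esub> j\<^sub>2 a" "s\<^sub>2 (\<ominus>\<^bsub>A\<^esub> a) = \<ominus>\<^bsub>E\<^esub> s\<^sub>2 a"
    using assms by (simp_all add: E.minus_equality J.M.minus_equality)
qed

section \<open>The quadratic subalgebra generated by the skew elements\<close>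

text \<open>
  If \<open>s\<^sub>1\<close> and \<open>s\<^sub>2\<close> agreed on \<open>A\<close>, then by linearity they would agree on the \<open>E\<close>-span of \<open>A\<close>, which
  is the whole matrix algebra. So the difference of some element and its conjugate is not zero.
\<close>

lemma skew_exists:
  obtains s where "s \<in> carrier A" "j\<^sub>1 s = \<zero>\<^bsub>J\<^esub>" "j\<^sub>2 s = \<zero>\<^bsub>J\<^esub>" "s\<^sub>1 s \<noteq> \<zero>\<^bsub>E\<^esub>" "s\<^sub>2 s = \<ominus>\<^bsub>E\<^esub> s\<^sub>1 s"
proof -
  have "\<exists>a\<in>carrier A. s\<^sub>1 a \<noteq> s\<^sub>2 a"
  proof (rule ccontr)
    assume "\<not> ?thesis"
    then have eq: "s\<^sub>1 a = s\<^sub>2 a" if "a \<in> carrier A" for a using that by auto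
    have "fst x = snd (snd (snd x))" if "x \<in> carrier \<M>" for x
      using that by (rule \<psi>_spans) (auto simp: \<psi>_eq eq)
    from this[of "(\<one>\<^bsub>E\<^esub>, \<zero>\<^bsub>J\<^esub>, \<zero>\<^bsub>J\<^esub>, \<zero>\<^bsub>E\<^esub>)"] show False by simp
  qed
  then obtain a where a: "a \<in> carrier A" "s\<^sub>1 a \<noteq> s\<^sub>2 a" by blast
  then have "s\<^sub>1 a \<oplus>\<^bsub>E\<^esub> \<ominus>\<^bsub>E\<^esub> s\<^sub>2 a \<noteq> \<zero>\<^bsub>E\<^esub>"
    using E.r_right_minus_eq[of "s\<^sub>1 a" "s\<^sub>2 a"] by (simp add: a_minus_def)
  then show ?thesis
    by (intro that[of "a \<oplus>\<^bsub>A\<^esub> \<ominus>\<^bsub>A\<^esub> invol A a"])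
      (use a in \<open>auto simp: invol_closed E.cring_simprules J.M.r_neg\<close>)
qed

definition skew where
  "skew = (SOME s. s \<in> carrier A \<and> j\<^sub>1 s = \<zero>\<^bsub>J\<^esub> \<and> j\<^sub>2 s = \<zero>\<^bsub>J\<^esub> \<and> s\<^sub>1 s \<noteq> \<zero>\<^bsub>E\<^esub> \<and> s\<^sub>2 s = \<ominus>\<^bsub>E\<^esub> s\<^sub>1 s)"

abbreviation "\<epsilon> \<equiv> s\<^sub>1 skew"

lemma skew_closed [simp]: "skew \<in> carrier A"
  and skew_entries [simp]: "j\<^sub>1 skew = \<zero>\<^bsub>J\<^esub>" "j\<^sub>2 skew = \<zero>\<^bsub>J\<^esub>" "s\<^sub>2 skew = \<ominus>\<^bsub>E\<^esub> \<epsilon>"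
  and \<epsilon>_nonzero: "\<epsilon> \<noteq> \<zero>\<^bsub>E\<^esub>"
proof -
  have "\<exists>s. s \<in> carrier A \<and> j\<^sub>1 s = \<zero>\<^bsub>J\<^esub> \<and> j\<^sub>2 s = \<zero>\<^bsub>J\<^esub> \<and> s\<^sub>1 s \<noteq> \<zero>\<^bsub>E\<^esub> \<and> s\<^sub>2 s = \<ominus>\<^bsub>E\<^esub> s\<^sub>1 s"
    using skew_exists by metis
  from someI_ex[OF this, folded skew_def]
  show "skew \<in> carrier A" "j\<^sub>1 skew = \<zero>\<^bsub>J\<^esub>" "j\<^sub>2 skew = \<zero>\<^bsub>J\<^esub>" "s\<^sub>2 skew = \<ominus>\<^bsub>E\<^esub> \<epsilon>" "\<epsilon> \<noteq> \<zero>\<^bsub>E\<^esub>"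
    by blast+
qed

text \<open>
  Up to a factor in \<open>E\<close>, any two skew elements are equal in the matrix algebra; hence in \<open>A\<close> they are
  equal up to a factor in \<open>F\<close>.
\<close>

lemma skew_line:
  assumes "x \<in> carrier A" "j\<^sub>1 x = \<zero>\<^bsub>J\<^esub>" "j\<^sub>2 x = \<zero>\<^bsub>J\<^esub>" "s\<^sub>2 x = \<ominus>\<^bsub>E\<^esub> s\<^sub>1 x"
  shows "\<exists>c\<in>carrier F. s\<^sub>1 x = emb c \<otimes>\<^bsub>E\<^esub> \<epsilon>"
proof -
  have [simp]: "inv\<^bsub>E\<^esub> \<epsilon> \<in> carrier E" and inv: "inv\<^bsub>E\<^esub> \<epsilon> \<otimes>\<^bsub>E\<^esub> \<epsilon> = \<one>\<^bsub>E\<^esub>"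
    using \<epsilon>_nonzero by (auto simp: J.field_Units)
  define r where "r = s\<^sub>1 x \<otimes>\<^bsub>E\<^esub> inv\<^bsub>E\<^esub> \<epsilon>"
  have r: "r \<in> carrier E" "r \<otimes>\<^bsub>E\<^esub> \<epsilon> = s\<^sub>1 x"
    using assms by (simp_all add: r_def E.m_assoc inv)
  then have "\<psi> x = r \<odot>\<^bsub>\<M>\<^esub> \<psi> skew"
    using assms by (simp add: \<psi>_eq E.r_minus)
  then obtain c where "c \<in> carrier F" "x = c \<odot>\<^bsub>A\<^esub> skew"
    using \<psi>_descends[of skew x r] assms r by auto
  then show ?thesis by auto
qed

text \<open>
  The square of the skew element has image \<open>\<epsilon>\<^sup>2 1\<close>, so it is a multiple of \<open>1\<close> in \<open>A\<close> too.
\<close>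

definition "\<mu> = (SOME m. m \<in> carrier F \<and> skew \<otimes>\<^bsub>A\<^esub> skew = m \<odot>\<^bsub>A\<^esub> \<one>\<^bsub>A\<^esub>)"

lemma \<mu>_closed [simp]: "\<mu> \<in> carrier F" and emb_\<mu>: "emb \<mu> = \<epsilon> \<otimes>\<^bsub>E\<^esub> \<epsilon>"
proof -
  have "\<psi> (skew \<otimes>\<^bsub>A\<^esub> skew) = (\<epsilon> \<otimes>\<^bsub>E\<^esub> \<epsilon>) \<odot>\<^bsub>\<M>\<^esub> \<psi> \<one>\<^bsub>A\<^esub>"
    by (simp add: \<psi>_eq E.cring_simprules)
  then have "\<exists>m. m \<in> carrier F \<and> skew \<otimes>\<^bsub>A\<^esub> skew = m \<odot>\<^bsub>A\<^esub> \<one>\<^bsub>A\<^esub>"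
    using \<psi>_descends[of "\<one>\<^bsub>A\<^esub>" "skew \<otimes>\<^bsub>A\<^esub> skew" "\<epsilon> \<otimes>\<^bsub>E\<^esub> \<epsilon>"]
    by (auto simp: unit_closed mult_closed)
  from someI_ex[OF this, folded \<mu>_def]
  have *: "\<mu> \<in> carrier F" "skew \<otimes>\<^bsub>A\<^esub> skew = \<mu> \<odot>\<^bsub>A\<^esub> \<one>\<^bsub>A\<^esub>" by auto
  show "\<mu> \<in> carrier F" by fact
  show "emb \<mu> = \<epsilon> \<otimes>\<^bsub>E\<^esub> \<epsilon>" using arg_cong[OF *(2), of s\<^sub>1] *(1) by (simp add: unit_closed)
qed

lemma \<mu>_nonzero: "\<mu> \<noteq> \<zero>\<^bsub>F\<^esub>"
  using emb_\<mu> \<epsilon>_nonzero J.integral[of \<epsilon> \<epsilon>] by auto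

abbreviation "K \<equiv> quadratic_algebra F \<mu>"
abbreviation "\<tau> \<equiv> conjugation F"

text \<open>
  The two homomorphisms of \<open>K\<close> to \<open>E\<close>, sending \<open>X\<close> to \<open>\<epsilon>\<close> and to \<open>-\<epsilon>\<close>: the coordinates of the
  embedding of \<open>K\<close> into \<open>E \<oplus> E\<close>. Conjugation exchanges them.
\<close>

definition "\<alpha> k = emb (fst k) \<oplus>\<^bsub>E\<^esub> emb (snd k) \<otimes>\<^bsub>E\<^esub> \<epsilon>"
definition "\<beta> k = emb (fst k) \<oplus>\<^bsub>E\<^esub> emb (snd k) \<otimes>\<^bsub>E\<^esub> (\<ominus>\<^bsub>E\<^esub> \<epsilon>)"

lemma \<alpha>\<beta>_closed [simp]: "k \<in> carrier K \<Longrightarrow> \<alpha> k \<in> carrier E" "k \<in> carrier K \<Longrightarrow> \<beta> k \<in> carrier E"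
  by (auto simp: \<alpha>_def \<beta>_def)

lemma K_cring: "cring K" and K_algebra: "algebra F K"
  by (simp_all add: quadratic_algebra_cring quadratic_algebra_algebra)

lemma \<alpha>\<beta>_hom [simp]:
  "\<alpha> \<one>\<^bsub>K\<^esub> = \<one>\<^bsub>E\<^esub>" "\<beta> \<one>\<^bsub>K\<^esub> = \<one>\<^bsub>E\<^esub>"
  "\<lbrakk>k \<in> carrier K; l \<in> carrier K\<rbrakk> \<Longrightarrow> \<alpha> (k \<oplus>\<^bsub>K\<^esub> l) = \<alpha> k \<oplus>\<^bsub>E\<^esub> \<alpha> l"
  "\<lbrakk>k \<in> carrier K; l \<in> carrier K\<rbrakk> \<Longrightarrow> \<beta> (k \<oplus>\<^bsub>K\<^esub> l) = \<beta> k \<oplus>\<^bsub>E\<^esub> \<beta> l"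
  "\<lbrakk>k \<in> carrier K; l \<in> carrier K\<rbrakk> \<Longrightarrow> \<alpha> (k \<otimes>\<^bsub>K\<^esub> l) = \<alpha> k \<otimes>\<^bsub>E\<^esub> \<alpha> l"
  "\<lbrakk>k \<in> carrier K; l \<in> carrier K\<rbrakk> \<Longrightarrow> \<beta> (k \<otimes>\<^bsub>K\<^esub> l) = \<beta> k \<otimes>\<^bsub>E\<^esub> \<beta> l"
  "k \<in> carrier K \<Longrightarrow> \<alpha> (\<tau> k) = \<beta> k" "k \<in> carrier K \<Longrightarrow> \<beta> (\<tau> k) = \<alpha> k"
  "\<lbrakk>c \<in> carrier F; k \<in> carrier K\<rbrakk> \<Longrightarrow> \<alpha> (c \<odot>\<^bsub>K\<^esub> k) = emb c \<otimes>\<^bsub>E\<^esub> \<alpha> k"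
  "\<lbrakk>c \<in> carrier F; k \<in> carrier K\<rbrakk> \<Longrightarrow> \<beta> (c \<odot>\<^bsub>K\<^esub> k) = emb c \<otimes>\<^bsub>E\<^esub> \<beta> k"
  by (auto simp: \<alpha>_def \<beta>_def emb_add emb_mult emb_uminus emb_\<mu> E.cring_simprules)

lemma \<alpha>\<beta>_half:
  assumes "k \<in> carrier K"
  shows "emb (fst k) = emb half \<otimes>\<^bsub>E\<^esub> (\<alpha> k \<oplus>\<^bsub>E\<^esub> \<beta> k)"
    "emb (snd k) \<otimes>\<^bsub>E\<^esub> \<epsilon> = emb half \<otimes>\<^bsub>E\<^esub> (\<alpha> k \<oplus>\<^bsub>E\<^esub> \<ominus>\<^bsub>E\<^esub> \<beta> k)"
proof -
  define a b h where "a = emb (fst k)" and "b = emb (snd k) \<otimes>\<^bsub>E\<^esub> \<epsilon>" and "h = emb half"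
  have [simp]: "a \<in> carrier E" "b \<in> carrier E" "h \<in> carrier E"
    using assms by (auto simp: a_def b_def h_def)
  have \<alpha>: "\<alpha> k = a \<oplus>\<^bsub>E\<^esub> b" and \<beta>: "\<beta> k = a \<oplus>\<^bsub>E\<^esub> \<ominus>\<^bsub>E\<^esub> b"
    using assms by (auto simp: \<alpha>_def \<beta>_def a_def b_def E.r_minus)
  have half: "(\<one>\<^bsub>E\<^esub> \<oplus>\<^bsub>E\<^esub> \<one>\<^bsub>E\<^esub>) \<otimes>\<^bsub>E\<^esub> h \<otimes>\<^bsub>E\<^esub> x = x" if "x \<in> carrier E" for x
    using emb_half that by (simp add: h_def)
  have "h \<otimes>\<^bsub>E\<^esub> (\<alpha> k \<oplus>\<^bsub>E\<^esub> \<beta> k) = (\<one>\<^bsub>E\<^esub> \<oplus>\<^bsub>E\<^esub> \<one>\<^bsub>E\<^esub>) \<otimes>\<^bsub>E\<^esub> h \<otimes>\<^bsub>E\<^esub> a"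
    by (simp add: \<alpha> \<beta> E.cring_simprules)
  then show "emb (fst k) = emb half \<otimes>\<^bsub>E\<^esub> (\<alpha> k \<oplus>\<^bsub>E\<^esub> \<beta> k)"
    by (simp add: half flip: a_def h_def)
  have "h \<otimes>\<^bsub>E\<^esub> (\<alpha> k \<oplus>\<^bsub>E\<^esub> \<ominus>\<^bsub>E\<^esub> \<beta> k) = (\<one>\<^bsub>E\<^esub> \<oplus>\<^bsub>E\<^esub> \<one>\<^bsub>E\<^esub>) \<otimes>\<^bsub>E\<^esub> h \<otimes>\<^bsub>E\<^esub> b"
    by (simp add: \<alpha> \<beta> E.add_diff_cancel_double E.cring_simprules(11,12,13,14,24,25))
  then show "emb (snd k) \<otimes>\<^bsub>E\<^esub> \<epsilon> = emb half \<otimes>\<^bsub>E\<^esub> (\<alpha> k \<oplus>\<^bsub>E\<^esub> \<ominus>\<^bsub>E\<^esub> \<beta> k)"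
    by (simp add: half flip: b_def h_def)
qed

lemma \<alpha>\<beta>_eqI:
  assumes "k \<in> carrier K" "l \<in> carrier K" "\<alpha> k = \<alpha> l" "\<beta> k = \<beta> l"
  shows "k = l"
proof -
  have mem: "fst k \<in> carrier F" "snd k \<in> carrier F" "fst l \<in> carrier F" "snd l \<in> carrier F"
    using assms by auto
  have "emb (fst k) = emb (fst l)" using \<alpha>\<beta>_half[OF assms(1)] \<alpha>\<beta>_half[OF assms(2)] assms by simp
  moreover have "emb (snd k) \<otimes>\<^bsub>E\<^esub> \<epsilon> = emb (snd l) \<otimes>\<^bsub>E\<^esub> \<epsilon>"
    using \<alpha>\<beta>_half[OF assms(1)] \<alpha>\<beta>_half[OF assms(2)] assms by simp
  then have "emb (snd k) = emb (snd l)"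
    using \<epsilon>_nonzero mem by (simp add: J.m_rcancel)
  ultimately show ?thesis using emb_inj mem by (auto simp: prod_eq_iff)
qed

text \<open>
  With \<open>p = s\<^sub>1 x\<close> and \<open>q = s\<^sub>2 x\<close>, the elements \<open>d\<close> and \<open>w\<close> below are skew with upper left entries
  \<open>p - q\<close> and \<open>2 (p + q) \<epsilon>\<close>. Since the skew elements are the \<open>F\<close>-multiples of one of them, this gives
  \<open>p - q \<in> F \<epsilon>\<close> and \<open>2 (p + q) \<in> F\<close>, that is, \<open>(p, q)\<close> comes from \<open>K\<close>.
\<close>

lemma diagonal_descends:
  assumes x: "x \<in> carrier A"
  shows "\<exists>k\<in>carrier K. \<alpha> k = s\<^sub>1 x \<and> \<beta> k = s\<^sub>2 x"
proof -
  define p q h where "p = s\<^sub>1 x" and "q = s\<^sub>2 x" and "h = emb half"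
  have [simp]: "p \<in> carrier E" "q \<in> carrier E" "h \<in> carrier E" using x by (auto simp: p_def q_def h_def)
  have half: "h \<otimes>\<^bsub>E\<^esub> y \<oplus>\<^bsub>E\<^esub> h \<otimes>\<^bsub>E\<^esub> y = y" if "y \<in> carrier E" for y
  proof -
    have "h \<otimes>\<^bsub>E\<^esub> y \<oplus>\<^bsub>E\<^esub> h \<otimes>\<^bsub>E\<^esub> y = (\<one>\<^bsub>E\<^esub> \<oplus>\<^bsub>E\<^esub> \<one>\<^bsub>E\<^esub>) \<otimes>\<^bsub>E\<^esub> h \<otimes>\<^bsub>E\<^esub> y"
      using that by (simp add: E.cring_simprules)
    then show ?thesis using that emb_half by (simp add: h_def)
  qed
  \<comment> \<open>\<open>d\<close> is the skew part of \<open>x\<close>, doubled\<close>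
  define d where "d = x \<oplus>\<^bsub>A\<^esub> \<ominus>\<^bsub>A\<^esub> invol A x"
  have "\<exists>c\<in>carrier F. s\<^sub>1 d = emb c \<otimes>\<^bsub>E\<^esub> \<epsilon>"
    using x by (intro skew_line) (auto simp: d_def invol_closed J.M.r_neg E.cring_simprules)
  then obtain c where c: "c \<in> carrier F" "p \<oplus>\<^bsub>E\<^esub> \<ominus>\<^bsub>E\<^esub> q = emb c \<otimes>\<^bsub>E\<^esub> \<epsilon>"
    using x by (auto simp: d_def invol_closed p_def q_def)
  \<comment> \<open>the off-diagonal part of \<open>y\<close> anticommutes with the skew element and cancels in \<open>w\<close>\<close>
  define y where "y = x \<oplus>\<^bsub>A\<^esub> invol A x"
  define w where "w = y \<otimes>\<^bsub>A\<^esub> skew \<oplus>\<^bsub>A\<^esub> skew \<otimes>\<^bsub>A\<^esub> y"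
  have y: "y \<in> carrier A" "s\<^sub>1 y = p \<oplus>\<^bsub>E\<^esub> q" "s\<^sub>2 y = p \<oplus>\<^bsub>E\<^esub> q"
    using x by (auto simp: y_def invol_closed p_def q_def E.cring_simprules)
  have w: "w \<in> carrier A" "s\<^sub>1 w = (p \<oplus>\<^bsub>E\<^esub> q \<oplus>\<^bsub>E\<^esub> (p \<oplus>\<^bsub>E\<^esub> q)) \<otimes>\<^bsub>E\<^esub> \<epsilon>"
    using y by (auto simp: w_def mult_closed E.cring_simprules)
  have "\<exists>c\<in>carrier F. s\<^sub>1 w = emb c \<otimes>\<^bsub>E\<^esub> \<epsilon>"
    using y by (intro skew_line)
      (auto simp: w_def mult_closed E.cring_simprules J.M.r_neg J.M.l_neg J.smult_l_minus)
  then obtain c' where c': "c' \<in> carrier F" "(p \<oplus>\<^bsub>E\<^esub> q \<oplus>\<^bsub>E\<^esub> (p \<oplus>\<^bsub>E\<^esub> q)) \<otimes>\<^bsub>E\<^esub> \<epsilon> = emb c' \<otimes>\<^bsub>E\<^esub> \<epsilon>"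
    using w by auto
  then have c'_eq: "emb c' = p \<oplus>\<^bsub>E\<^esub> q \<oplus>\<^bsub>E\<^esub> (p \<oplus>\<^bsub>E\<^esub> q)"
    using \<epsilon>_nonzero by (simp add: J.m_rcancel)
  define k where "k = (half \<otimes>\<^bsub>F\<^esub> (half \<otimes>\<^bsub>F\<^esub> c'), half \<otimes>\<^bsub>F\<^esub> c)"
  have k: "k \<in> carrier K" using c c' by (simp add: k_def)
  have fst: "emb (fst k) = h \<otimes>\<^bsub>E\<^esub> p \<oplus>\<^bsub>E\<^esub> h \<otimes>\<^bsub>E\<^esub> q"
  proof -
    have "emb (fst k) = h \<otimes>\<^bsub>E\<^esub> (h \<otimes>\<^bsub>E\<^esub> (p \<oplus>\<^bsub>E\<^esub> q) \<oplus>\<^bsub>E\<^esub> h \<otimes>\<^bsub>E\<^esub> (p \<oplus>\<^bsub>E\<^esub> q))"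
      using c' by (simp add: k_def emb_mult c'_eq E.r_distr flip: h_def)
    also have "\<dots> = h \<otimes>\<^bsub>E\<^esub> (p \<oplus>\<^bsub>E\<^esub> q)" using half[of "p \<oplus>\<^bsub>E\<^esub> q"] by simp
    finally show ?thesis by (simp add: E.r_distr)
  qed
  have snd: "emb (snd k) \<otimes>\<^bsub>E\<^esub> \<epsilon> = h \<otimes>\<^bsub>E\<^esub> p \<oplus>\<^bsub>E\<^esub> \<ominus>\<^bsub>E\<^esub> (h \<otimes>\<^bsub>E\<^esub> q)"
    using c by (simp add: k_def emb_mult E.m_assoc E.r_distr E.r_minus flip: h_def c(2))
  have "\<alpha> k = h \<otimes>\<^bsub>E\<^esub> p \<oplus>\<^bsub>E\<^esub> h \<otimes>\<^bsub>E\<^esub> q \<oplus>\<^bsub>E\<^esub> (h \<otimes>\<^bsub>E\<^esub> p \<oplus>\<^bsub>E\<^esub> \<ominus>\<^bsub>E\<^esub> (h \<otimes>\<^bsub>E\<^esub> q))"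
    unfolding \<alpha>_def fst snd ..
  also have "\<dots> = h \<otimes>\<^bsub>E\<^esub> p \<oplus>\<^bsub>E\<^esub> h \<otimes>\<^bsub>E\<^esub> p" by (simp add: E.cring_simprules)
  finally have 1: "\<alpha> k = p" by (simp add: half)
  have "\<beta> k = h \<otimes>\<^bsub>E\<^esub> p \<oplus>\<^bsub>E\<^esub> h \<otimes>\<^bsub>E\<^esub> q \<oplus>\<^bsub>E\<^esub> \<ominus>\<^bsub>E\<^esub> (h \<otimes>\<^bsub>E\<^esub> p \<oplus>\<^bsub>E\<^esub> \<ominus>\<^bsub>E\<^esub> (h \<otimes>\<^bsub>E\<^esub> q))"
    using mem_Times_iff[THEN iffD1, OF k[simplified]] unfolding \<beta>_def fst
    by (simp add: E.r_minus flip: snd)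
  also have "\<dots> = h \<otimes>\<^bsub>E\<^esub> q \<oplus>\<^bsub>E\<^esub> h \<otimes>\<^bsub>E\<^esub> q" by (simp add: E.add_diff_cancel_double)
  finally have 2: "\<beta> k = q" by (simp add: half)
  show ?thesis using 1 2 k by (auto simp: p_def q_def)
qed

definition "\<kappa> k = fst k \<odot>\<^bsub>A\<^esub> \<one>\<^bsub>A\<^esub> \<oplus>\<^bsub>A\<^esub> snd k \<odot>\<^bsub>A\<^esub> skew"

lemma \<kappa>_closed [simp]: "k \<in> carrier K \<Longrightarrow> \<kappa> k \<in> carrier A"
  by (auto simp: \<kappa>_def unit_closed)

lemma \<kappa>_entries [simp]:
  assumes "k \<in> carrier K"
  shows "s\<^sub>1 (\<kappa> k) = \<alpha> k" "j\<^sub>1 (\<kappa> k) = \<zero>\<^bsub>J\<^esub>" "j\<^sub>2 (\<kappa> k) = \<zero>\<^bsub>J\<^esub>" "s\<^sub>2 (\<kappa> k) = \<beta> k"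
  using assms by (auto simp: \<kappa>_def unit_closed \<alpha>_def \<beta>_def)

definition "diag x = (SOME k. k \<in> carrier K \<and> \<alpha> k = s\<^sub>1 x \<and> \<beta> k = s\<^sub>2 x)"

lemma diag_closed [simp]: "x \<in> carrier A \<Longrightarrow> diag x \<in> carrier K"
  and \<alpha>_diag [simp]: "x \<in> carrier A \<Longrightarrow> \<alpha> (diag x) = s\<^sub>1 x"
  and \<beta>_diag [simp]: "x \<in> carrier A \<Longrightarrow> \<beta> (diag x) = s\<^sub>2 x"
proof -
  assume "x \<in> carrier A"
  then have "\<exists>k. k \<in> carrier K \<and> \<alpha> k = s\<^sub>1 x \<and> \<beta> k = s\<^sub>2 x" using diagonal_descends by blast
  from someI_ex[OF this, folded diag_def]
  show "diag x \<in> carrier K" "\<alpha> (diag x) = s\<^sub>1 x" "\<beta> (diag x) = s\<^sub>2 x" by blast+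
qed

definition "offdiag x = x \<oplus>\<^bsub>A\<^esub> \<ominus>\<^bsub>A\<^esub> \<kappa> (diag x)"

text \<open>
  The second summand of \<open>A = K \<oplus> \<J>\<close>; \<open>diag\<close> and \<open>offdiag\<close> are the projections.
\<close>

definition "\<J> = {x \<in> carrier A. s\<^sub>1 x = \<zero>\<^bsub>E\<^esub> \<and> s\<^sub>2 x = \<zero>\<^bsub>E\<^esub>}"

lemma \<J>_carrier: "x \<in> \<J> \<Longrightarrow> x \<in> carrier A"
  and \<J>_diagonal: "x \<in> \<J> \<Longrightarrow> s\<^sub>1 x = \<zero>\<^bsub>E\<^esub>" "x \<in> \<J> \<Longrightarrow> s\<^sub>2 x = \<zero>\<^bsub>E\<^esub>"
  by (simp_all add: \<J>_def)

lemma \<J>_eqI: "\<lbrakk>x \<in> \<J>; y \<in> \<J>; j\<^sub>1 x = j\<^sub>1 y; j\<^sub>2 x = j\<^sub>2 y\<rbrakk> \<Longrightarrow> x = y"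
  by (rule entries_eqI) (auto simp: \<J>_def)

lemma offdiag_closed: "x \<in> carrier A \<Longrightarrow> offdiag x \<in> \<J>"
  by (simp add: offdiag_def \<J>_def E.cring_simprules del: quadratic_algebra_sel)

lemma offdiag_entries [simp]:
  "x \<in> carrier A \<Longrightarrow> j\<^sub>1 (offdiag x) = j\<^sub>1 x" "x \<in> carrier A \<Longrightarrow> j\<^sub>2 (offdiag x) = j\<^sub>2 x"
  by (simp_all add: offdiag_def del: quadratic_algebra_sel)

section \<open>The hermitian cubic norm structure on the off-diagonal part\<close>

text \<open>
  From here on, elements of \<open>K\<close> are compared through \<open>\<alpha>\<close> and \<open>\<beta>\<close> and not as pairs.
\<close>

declare quadratic_algebra_sel [simp del] conjugation_sel [simp del]

lemma \<tau>_closed [simp]: "k \<in> carrier K \<Longrightarrow> \<tau> k \<in> carrier K"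
  by (auto simp: quadratic_algebra_sel conjugation_sel)

lemma K_ops_closed [simp]:
  "\<lbrakk>k \<in> carrier K; l \<in> carrier K\<rbrakk> \<Longrightarrow> k \<oplus>\<^bsub>K\<^esub> l \<in> carrier K"
  "\<lbrakk>k \<in> carrier K; l \<in> carrier K\<rbrakk> \<Longrightarrow> k \<otimes>\<^bsub>K\<^esub> l \<in> carrier K"
  "\<one>\<^bsub>K\<^esub> \<in> carrier K" "\<zero>\<^bsub>K\<^esub> \<in> carrier K"
  by (auto simp: quadratic_algebra_sel)

text \<open>
  \<open>\<J>\<close> as a module over \<open>K\<close>, which acts by left multiplication in \<open>A\<close>: on the pair of off-diagonal
  entries, \<open>k\<close> acts as \<open>(\<alpha> k, \<beta> k)\<close>.
\<close>

definition JK :: "('f \<times> 'f, 'a) module" where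
  "JK = \<lparr>carrier = \<J>, monoid.mult = undefined, one = undefined, ring.zero = \<zero>\<^bsub>A\<^esub>, add = add A,
     smult = (\<lambda>k x. \<kappa> k \<otimes>\<^bsub>A\<^esub> x)\<rparr>"

lemma JK_sel [simp]:
  "carrier JK = \<J>" "\<zero>\<^bsub>JK\<^esub> = \<zero>\<^bsub>A\<^esub>" "x \<oplus>\<^bsub>JK\<^esub> y = x \<oplus>\<^bsub>A\<^esub> y" "k \<odot>\<^bsub>JK\<^esub> x = \<kappa> k \<otimes>\<^bsub>A\<^esub> x"
  by (simp_all add: JK_def)

lemma \<J>_entries_closed [simp]:
  "x \<in> \<J> \<Longrightarrow> j\<^sub>1 x \<in> carrier J" "x \<in> \<J> \<Longrightarrow> j\<^sub>2 x \<in> carrier J"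
  by (simp_all add: \<J>_carrier)

lemma \<J>_zero [simp]: "\<zero>\<^bsub>A\<^esub> \<in> \<J>"
  and \<J>_add [simp]: "\<lbrakk>x \<in> \<J>; y \<in> \<J>\<rbrakk> \<Longrightarrow> x \<oplus>\<^bsub>A\<^esub> y \<in> \<J>"
  and \<J>_uminus [simp]: "x \<in> \<J> \<Longrightarrow> \<ominus>\<^bsub>A\<^esub> x \<in> \<J>"
  and \<J>_scale [simp]: "\<lbrakk>c \<in> carrier F; x \<in> \<J>\<rbrakk> \<Longrightarrow> c \<odot>\<^bsub>A\<^esub> x \<in> \<J>"
  and \<J>_smult [simp]: "\<lbrakk>k \<in> carrier K; x \<in> \<J>\<rbrakk> \<Longrightarrow> \<kappa> k \<otimes>\<^bsub>A\<^esub> x \<in> \<J>"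
  by (simp_all add: \<J>_def mult_closed)

lemma \<J>_entries_add [simp]:
  "\<lbrakk>x \<in> \<J>; y \<in> \<J>\<rbrakk> \<Longrightarrow> j\<^sub>1 (x \<oplus>\<^bsub>A\<^esub> y) = j\<^sub>1 x \<oplus>\<^bsub>J\<^esub> j\<^sub>1 y"
  "\<lbrakk>x \<in> \<J>; y \<in> \<J>\<rbrakk> \<Longrightarrow> j\<^sub>2 (x \<oplus>\<^bsub>A\<^esub> y) = j\<^sub>2 x \<oplus>\<^bsub>J\<^esub> j\<^sub>2 y"
  by (simp_all add: \<J>_carrier)

lemma \<J>_entries_smult [simp]:
  "\<lbrakk>k \<in> carrier K; x \<in> \<J>\<rbrakk> \<Longrightarrow> j\<^sub>1 (\<kappa> k \<otimes>\<^bsub>A\<^esub> x) = \<alpha> k \<odot>\<^bsub>J\<^esub> j\<^sub>1 x"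
  "\<lbrakk>k \<in> carrier K; x \<in> \<J>\<rbrakk> \<Longrightarrow> j\<^sub>2 (\<kappa> k \<otimes>\<^bsub>A\<^esub> x) = \<beta> k \<odot>\<^bsub>J\<^esub> j\<^sub>2 x"
  by (simp_all add: \<J>_carrier \<J>_diagonal)

lemma JK_abelian_group: "abelian_group JK"
proof (rule abelian_groupI)
  fix x assume "x \<in> carrier JK"
  then show "\<exists>y\<in>carrier JK. y \<oplus>\<^bsub>JK\<^esub> x = \<zero>\<^bsub>JK\<^esub>"
    by (intro bexI[of _ "\<ominus>\<^bsub>A\<^esub> x"]) (auto simp: M.l_neg \<J>_carrier)
qed (auto simp: M.a_ac \<J>_carrier)

lemma JK_module: "module K JK"
proof (rule moduleI[OF K_cring JK_abelian_group])
  show "(k \<oplus>\<^bsub>K\<^esub> l) \<odot>\<^bsub>JK\<^esub> x = k \<odot>\<^bsub>JK\<^esub> x \<oplus>\<^bsub>JK\<^esub> l \<odot>\<^bsub>JK\<^esub> x"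
    if "k \<in> carrier K" "l \<in> carrier K" "x \<in> carrier JK" for k l x
    using that by (auto intro!: \<J>_eqI simp: J.smult_l_distr)
  show "k \<odot>\<^bsub>JK\<^esub> (x \<oplus>\<^bsub>JK\<^esub> y) = k \<odot>\<^bsub>JK\<^esub> x \<oplus>\<^bsub>JK\<^esub> k \<odot>\<^bsub>JK\<^esub> y"
    if "k \<in> carrier K" "x \<in> carrier JK" "y \<in> carrier JK" for k x y
    using that by (auto intro!: \<J>_eqI simp: J.smult_r_distr)
  show "(k \<otimes>\<^bsub>K\<^esub> l) \<odot>\<^bsub>JK\<^esub> x = k \<odot>\<^bsub>JK\<^esub> (l \<odot>\<^bsub>JK\<^esub> x)"
    if "k \<in> carrier K" "l \<in> carrier K" "x \<in> carrier JK" for k l x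
    using that by (auto intro!: \<J>_eqI simp: J.smult_assoc1)
qed (auto intro!: \<J>_eqI)

lemma JK_minus_entries:
  assumes "x \<in> \<J>" "y \<in> \<J>"
  shows "x \<ominus>\<^bsub>JK\<^esub> y \<in> \<J>" "j\<^sub>1 (x \<ominus>\<^bsub>JK\<^esub> y) = j\<^sub>1 x \<ominus>\<^bsub>J\<^esub> j\<^sub>1 y" "j\<^sub>2 (x \<ominus>\<^bsub>JK\<^esub> y) = j\<^sub>2 x \<ominus>\<^bsub>J\<^esub> j\<^sub>2 y"
proof -
  interpret JK: abelian_group JK by (rule JK_abelian_group)
  have "\<ominus>\<^bsub>JK\<^esub> y = \<ominus>\<^bsub>A\<^esub> y" using assms by (intro JK.minus_equality) (auto simp: M.l_neg \<J>_carrier)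
  then show "x \<ominus>\<^bsub>JK\<^esub> y \<in> \<J>" "j\<^sub>1 (x \<ominus>\<^bsub>JK\<^esub> y) = j\<^sub>1 x \<ominus>\<^bsub>J\<^esub> j\<^sub>1 y" "j\<^sub>2 (x \<ominus>\<^bsub>JK\<^esub> y) = j\<^sub>2 x \<ominus>\<^bsub>J\<^esub> j\<^sub>2 y"
    using assms by (simp_all add: a_minus_def \<J>_carrier)
qed

text \<open>
  The factors are forced by \<open>b \<times> b = 2 b\<^sup>#\<close> and \<open>T(b, b\<^sup>#) = 3 N(b)\<close>.
\<close>

definition "sharp\<^sub>K b = half \<odot>\<^bsub>A\<^esub> offdiag (b \<otimes>\<^bsub>A\<^esub> b)"
definition "T\<^sub>K b c = diag (b \<otimes>\<^bsub>A\<^esub> c)"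
definition "N\<^sub>K b = diag (third \<odot>\<^bsub>A\<^esub> (b \<otimes>\<^bsub>A\<^esub> sharp\<^sub>K b))"

lemma sharp\<^sub>K_closed [simp]: "b \<in> \<J> \<Longrightarrow> sharp\<^sub>K b \<in> \<J>"
  by (simp add: sharp\<^sub>K_def offdiag_closed mult_closed \<J>_carrier)

lemma half_smult_double:
  assumes "a \<in> carrier J"
  shows "emb half \<odot>\<^bsub>J\<^esub> ((\<one>\<^bsub>E\<^esub> \<oplus>\<^bsub>E\<^esub> \<one>\<^bsub>E\<^esub>) \<odot>\<^bsub>J\<^esub> a) = a"
proof -
  have "(emb half \<otimes>\<^bsub>E\<^esub> (\<one>\<^bsub>E\<^esub> \<oplus>\<^bsub>E\<^esub> \<one>\<^bsub>E\<^esub>)) \<odot>\<^bsub>J\<^esub> a = a"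
    using emb_half assms by (simp add: E.m_comm)
  then show ?thesis using assms by (subst (asm) J.smult_assoc1) auto
qed

lemma sharp\<^sub>K_entries [simp]:
  assumes "b \<in> \<J>"
  shows "j\<^sub>1 (sharp\<^sub>K b) = \<eta> \<odot>\<^bsub>J\<^esub> sharp (j\<^sub>2 b)" "j\<^sub>2 (sharp\<^sub>K b) = sharp (j\<^sub>1 b)"
proof -
  have off: "offdiag (b \<otimes>\<^bsub>A\<^esub> b) \<in> carrier A"
    using assms by (intro \<J>_carrier offdiag_closed mult_closed) (auto simp: \<J>_carrier)
  have "j\<^sub>1 (sharp\<^sub>K b) = emb half \<odot>\<^bsub>J\<^esub> (\<eta> \<odot>\<^bsub>J\<^esub> ((\<one>\<^bsub>E\<^esub> \<oplus>\<^bsub>E\<^esub> \<one>\<^bsub>E\<^esub>) \<odot>\<^bsub>J\<^esub> sharp (j\<^sub>2 b)))"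
    using assms off by (simp add: sharp\<^sub>K_def mult_closed \<J>_carrier \<J>_diagonal J.cross_self
        J.sharp_closed)
  also have "\<dots> = \<eta> \<odot>\<^bsub>J\<^esub> sharp (j\<^sub>2 b)"
    using assms half_smult_double[of "\<eta> \<odot>\<^bsub>J\<^esub> sharp (j\<^sub>2 b)"]
    by (simp add: J.sharp_closed E.m_comm[of \<eta> "\<one>\<^bsub>E\<^esub> \<oplus>\<^bsub>E\<^esub> \<one>\<^bsub>E\<^esub>"] flip: J.smult_assoc1)
  finally show "j\<^sub>1 (sharp\<^sub>K b) = \<eta> \<odot>\<^bsub>J\<^esub> sharp (j\<^sub>2 b)" .
  show "j\<^sub>2 (sharp\<^sub>K b) = sharp (j\<^sub>1 b)"
    using assms off by (simp add: sharp\<^sub>K_def mult_closed \<J>_carrier \<J>_diagonal J.cross_self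
        J.sharp_closed half_smult_double)
qed

lemma T\<^sub>K_closed [simp]: "\<lbrakk>b \<in> \<J>; c \<in> \<J>\<rbrakk> \<Longrightarrow> T\<^sub>K b c \<in> carrier K"
  and T\<^sub>K_entries [simp]:
    "\<lbrakk>b \<in> \<J>; c \<in> \<J>\<rbrakk> \<Longrightarrow> \<alpha> (T\<^sub>K b c) = \<eta> \<otimes>\<^bsub>E\<^esub> T (j\<^sub>1 b) (j\<^sub>2 c)"
    "\<lbrakk>b \<in> \<J>; c \<in> \<J>\<rbrakk> \<Longrightarrow> \<beta> (T\<^sub>K b c) = \<eta> \<otimes>\<^bsub>E\<^esub> T (j\<^sub>2 b) (j\<^sub>1 c)"
  by (simp_all add: T\<^sub>K_def mult_closed \<J>_carrier \<J>_diagonal J.T_closed)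

lemma emb_third_cancel:
  assumes "x \<in> carrier E"
  shows "emb third \<otimes>\<^bsub>E\<^esub> ((\<one>\<^bsub>E\<^esub> \<oplus>\<^bsub>E\<^esub> \<one>\<^bsub>E\<^esub> \<oplus>\<^bsub>E\<^esub> \<one>\<^bsub>E\<^esub>) \<otimes>\<^bsub>E\<^esub> x) = x"
  using emb_third assms by (simp add: E.m_comm[of "emb third"] flip: E.m_assoc)

lemma N\<^sub>K_closed [simp]: "b \<in> \<J> \<Longrightarrow> N\<^sub>K b \<in> carrier K"
  and N\<^sub>K_entries [simp]:
    "b \<in> \<J> \<Longrightarrow> \<alpha> (N\<^sub>K b) = \<eta> \<otimes>\<^bsub>E\<^esub> N (j\<^sub>1 b)"
    "b \<in> \<J> \<Longrightarrow> \<beta> (N\<^sub>K b) = \<eta> \<otimes>\<^bsub>E\<^esub> (\<eta> \<otimes>\<^bsub>E\<^esub> N (j\<^sub>2 b))"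
proof -
  assume b: "b \<in> \<J>"
  note [simp] = \<J>_carrier[OF b] \<J>_carrier[OF sharp\<^sub>K_closed[OF b]] mult_closed J.T_closed J.N_closed J.sharp_closed
  show "N\<^sub>K b \<in> carrier K" by (simp add: N\<^sub>K_def)
  have "\<alpha> (N\<^sub>K b) = emb third \<otimes>\<^bsub>E\<^esub> (\<eta> \<otimes>\<^bsub>E\<^esub> ((\<one>\<^bsub>E\<^esub> \<oplus>\<^bsub>E\<^esub> \<one>\<^bsub>E\<^esub> \<oplus>\<^bsub>E\<^esub> \<one>\<^bsub>E\<^esub>) \<otimes>\<^bsub>E\<^esub> N (j\<^sub>1 b)))"
    using b by (simp add: N\<^sub>K_def \<J>_diagonal J.T_sharp_self[OF two_nonzero_E])
  also have "\<dots> = emb third \<otimes>\<^bsub>E\<^esub> ((\<one>\<^bsub>E\<^esub> \<oplus>\<^bsub>E\<^esub> \<one>\<^bsub>E\<^esub> \<oplus>\<^bsub>E\<^esub> \<one>\<^bsub>E\<^esub>) \<otimes>\<^bsub>E\<^esub> (\<eta> \<otimes>\<^bsub>E\<^esub> N (j\<^sub>1 b)))"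
    using b by (simp add: E.m_lcomm[of \<eta> "\<one>\<^bsub>E\<^esub> \<oplus>\<^bsub>E\<^esub> \<one>\<^bsub>E\<^esub> \<oplus>\<^bsub>E\<^esub> \<one>\<^bsub>E\<^esub>"])
  finally show "\<alpha> (N\<^sub>K b) = \<eta> \<otimes>\<^bsub>E\<^esub> N (j\<^sub>1 b)"
    using b by (simp only: emb_third_cancel J.N_closed E.m_closed \<eta>_closed \<J>_entries_closed)
  have "\<beta> (N\<^sub>K b) = emb third \<otimes>\<^bsub>E\<^esub> (\<eta> \<otimes>\<^bsub>E\<^esub> (\<eta> \<otimes>\<^bsub>E\<^esub> ((\<one>\<^bsub>E\<^esub> \<oplus>\<^bsub>E\<^esub> \<one>\<^bsub>E\<^esub> \<oplus>\<^bsub>E\<^esub> \<one>\<^bsub>E\<^esub>) \<otimes>\<^bsub>E\<^esub> N (j\<^sub>2 b))))"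
    using b by (simp add: N\<^sub>K_def \<J>_diagonal J.T_smult_right J.T_sharp_self[OF two_nonzero_E])
  also have "\<dots> = emb third \<otimes>\<^bsub>E\<^esub> ((\<one>\<^bsub>E\<^esub> \<oplus>\<^bsub>E\<^esub> \<one>\<^bsub>E\<^esub> \<oplus>\<^bsub>E\<^esub> \<one>\<^bsub>E\<^esub>) \<otimes>\<^bsub>E\<^esub> (\<eta> \<otimes>\<^bsub>E\<^esub> (\<eta> \<otimes>\<^bsub>E\<^esub> N (j\<^sub>2 b))))"
    using b by (simp add: E.m_lcomm[of \<eta> "\<one>\<^bsub>E\<^esub> \<oplus>\<^bsub>E\<^esub> \<one>\<^bsub>E\<^esub> \<oplus>\<^bsub>E\<^esub> \<one>\<^bsub>E\<^esub>"])
  finally show "\<beta> (N\<^sub>K b) = \<eta> \<otimes>\<^bsub>E\<^esub> (\<eta> \<otimes>\<^bsub>E\<^esub> N (j\<^sub>2 b))"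
    using b by (simp only: emb_third_cancel J.N_closed E.m_closed \<eta>_closed \<J>_entries_closed)
qed

lemma cross\<^sub>K_entries [simp]:
  assumes "b \<in> \<J>" "c \<in> \<J>"
  shows "sharp_cross JK sharp\<^sub>K b c \<in> \<J>"
    "j\<^sub>1 (sharp_cross JK sharp\<^sub>K b c) = \<eta> \<odot>\<^bsub>J\<^esub> (j\<^sub>2 b \<times>\<^sub># j\<^sub>2 c)"
    "j\<^sub>2 (sharp_cross JK sharp\<^sub>K b c) = j\<^sub>1 b \<times>\<^sub># j\<^sub>1 c"
  using assms
  by (simp_all add: sharp_cross_def JK_minus_entries J.sharp_closed J.smult_r_distr J.smult_r_minus J.M.minus_eq)

text \<open>
  Suppose that \<open>N\<close> vanishes on the upper right entries of \<open>\<J>\<close>. Comparing the expansions of \<open>N(a + b)\<close> and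
  \<open>N(-a + b)\<close> yields \<open>T(b, a\<^sup>#) = 0\<close>, and linearising in \<open>a\<close> yields \<open>T(a, b \<times> c) = 0\<close> for all such
  entries. These entries span \<open>J\<close> over \<open>E\<close>, so the trilinear form vanishes on \<open>J\<close>. At the base point,
  however, its value is \<open>6 N(1) = 6\<close>.
\<close>

lemma N_nonzero_on_\<J>: "\<exists>a\<in>\<J>. N (j\<^sub>1 a) \<noteq> \<zero>\<^bsub>E\<^esub>"
proof (rule ccontr)
  assume "\<not> ?thesis"
  then have N0: "N (j\<^sub>1 a) = \<zero>\<^bsub>E\<^esub>" if "a \<in> \<J>" for a using that by auto
  note [simp] = J.T_closed J.N_closed J.sharp_closed
  have polar: "T (j\<^sub>1 b) (sharp (j\<^sub>1 a)) = \<zero>\<^bsub>E\<^esub>" if "a \<in> \<J>" "b \<in> \<J>" for a b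
  proof -
    define x y where "x = T (j\<^sub>1 b) (sharp (j\<^sub>1 a))" and "y = T (j\<^sub>1 a) (sharp (j\<^sub>1 b))"
    have [simp]: "x \<in> carrier E" "y \<in> carrier E" using that by (auto simp: x_def y_def)
    \<comment> \<open>the two signs give \<open>x + y = 0\<close> and \<open>x - y = 0\<close>\<close>
    have "N (j\<^sub>1 (a \<oplus>\<^bsub>A\<^esub> b)) = \<zero>\<^bsub>E\<^esub>" using that by (intro N0) auto
    then have "x \<oplus>\<^bsub>E\<^esub> y = \<zero>\<^bsub>E\<^esub>" using that by (simp add: J.N_add N0 x_def y_def)
    moreover have "N (j\<^sub>1 (\<ominus>\<^bsub>A\<^esub> a \<oplus>\<^bsub>A\<^esub> b)) = \<zero>\<^bsub>E\<^esub>" using that by (intro N0) auto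
    moreover have "sharp (\<ominus>\<^bsub>J\<^esub> j\<^sub>1 a) = sharp (j\<^sub>1 a)"
      using J.sharp_smult[of "\<ominus>\<^bsub>E\<^esub> \<one>\<^bsub>E\<^esub>" "j\<^sub>1 a"] that
      by (simp add: J.smult_l_minus numeral_2_eq_2 E.l_minus E.r_minus)
    moreover have "T (\<ominus>\<^bsub>J\<^esub> j\<^sub>1 a) (sharp (j\<^sub>1 b)) = \<ominus>\<^bsub>E\<^esub> y"
      using J.T_smult[of "\<ominus>\<^bsub>E\<^esub> \<one>\<^bsub>E\<^esub>" "j\<^sub>1 a" "sharp (j\<^sub>1 b)"] that
      by (simp add: J.smult_l_minus E.l_minus y_def)
    moreover have "N (\<ominus>\<^bsub>J\<^esub> j\<^sub>1 a) = \<zero>\<^bsub>E\<^esub>" using N0[of "\<ominus>\<^bsub>A\<^esub> a"] that by (simp add: \<J>_carrier)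
    ultimately have "x \<oplus>\<^bsub>E\<^esub> y = \<zero>\<^bsub>E\<^esub>" "x \<oplus>\<^bsub>E\<^esub> \<ominus>\<^bsub>E\<^esub> y = \<zero>\<^bsub>E\<^esub>"
      using that by (simp_all add: J.N_add N0 \<J>_carrier flip: x_def)
    then have "x = y" "y = \<ominus>\<^bsub>E\<^esub> x"
      using E.r_right_minus_eq[of x y] E.minus_equality[of y x] by (simp_all add: a_minus_def E.a_comm)
    then have "(\<one>\<^bsub>E\<^esub> \<oplus>\<^bsub>E\<^esub> \<one>\<^bsub>E\<^esub>) \<otimes>\<^bsub>E\<^esub> x = \<zero>\<^bsub>E\<^esub>" by (simp add: E.l_distr) (metis E.r_neg \<open>x \<in> carrier E\<close>)
    then show ?thesis using J.integral two_nonzero_E unfolding x_def[symmetric] by fastforce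
  qed
  have span: "P x"
    if "x \<in> carrier J" and add: "\<And>x y. \<lbrakk>x \<in> carrier J; y \<in> carrier J; P x; P y\<rbrakk> \<Longrightarrow> P (x \<oplus>\<^bsub>J\<^esub> y)"
      and smult: "\<And>e x. \<lbrakk>e \<in> carrier E; x \<in> carrier J; P x\<rbrakk> \<Longrightarrow> P (e \<odot>\<^bsub>J\<^esub> x)"
      and base: "\<And>a. a \<in> \<J> \<Longrightarrow> P (j\<^sub>1 a)" for P x
  proof -
    have "P (fst (snd y))" if "y \<in> carrier \<M>" for y
      using that
    proof (rule \<psi>_spans)
      fix e a assume *: "e \<in> carrier E" "a \<in> carrier A"
      then have "P (j\<^sub>1 a)" using base[OF offdiag_closed[of a]] by simp
      then show "P (fst (snd (e \<odot>\<^bsub>\<M>\<^esub> \<psi> a)))" using * smult by (simp add: \<psi>_eq)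
    qed (auto intro: add)
    from this[of "(\<zero>\<^bsub>E\<^esub>, x, \<zero>\<^bsub>J\<^esub>, \<zero>\<^bsub>E\<^esub>)"] show ?thesis using that(1) by simp
  qed
  have cross: "T (j\<^sub>1 a) (j\<^sub>1 b \<times>\<^sub># j\<^sub>1 c) = \<zero>\<^bsub>E\<^esub>" if "a \<in> \<J>" "b \<in> \<J>" "c \<in> \<J>" for a b c
    using polar[of "b \<oplus>\<^bsub>A\<^esub> c" a] polar[of b a] polar[of c a] that
    by (simp add: J.sharp_add J.T_add_right)
  \<comment> \<open>extend from entries of \<open>\<J>\<close> to all of \<open>J\<close>, one variable at a time, rotating the form to bring that variable to the front\<close>
  have 1: "T x (j\<^sub>1 b \<times>\<^sub># j\<^sub>1 c) = \<zero>\<^bsub>E\<^esub>" if "x \<in> carrier J" "b \<in> \<J>" "c \<in> \<J>" for x b c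
    using that(1) by (rule span) (use that cross in \<open>auto simp: J.T_add J.T_smult\<close>)
  have 2: "T x (y \<times>\<^sub># j\<^sub>1 c) = \<zero>\<^bsub>E\<^esub>" if "x \<in> carrier J" "y \<in> carrier J" "c \<in> \<J>" for x y c
  proof -
    have "T y (j\<^sub>1 c \<times>\<^sub># x) = \<zero>\<^bsub>E\<^esub>" using that(2)
    proof (rule span)
      show "T (j\<^sub>1 a) (j\<^sub>1 c \<times>\<^sub># x) = \<zero>\<^bsub>E\<^esub>" if "a \<in> \<J>" for a
        using J.T_cross_rotate[of "j\<^sub>1 c" x "j\<^sub>1 a"] J.T_cross_rotate[of x "j\<^sub>1 a" "j\<^sub>1 c"]
          1[of x a c] that \<open>x \<in> carrier J\<close> \<open>c \<in> \<J>\<close> by simp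
    qed (use that in \<open>auto simp: J.T_add J.T_smult\<close>)
    then show ?thesis using J.T_cross_rotate[of y "j\<^sub>1 c" x] that by simp
  qed
  have 3: "T x (y \<times>\<^sub># z) = \<zero>\<^bsub>E\<^esub>" if "x \<in> carrier J" "y \<in> carrier J" "z \<in> carrier J" for x y z
  proof -
    have "T z (x \<times>\<^sub># y) = \<zero>\<^bsub>E\<^esub>" using that(3)
    proof (rule span)
      show "T (j\<^sub>1 a) (x \<times>\<^sub># y) = \<zero>\<^bsub>E\<^esub>" if "a \<in> \<J>" for a
        using J.T_cross_rotate[of x y "j\<^sub>1 a"] 2[of x y a] that \<open>x \<in> carrier J\<close> \<open>y \<in> carrier J\<close> by simp
    qed (use that in \<open>auto simp: J.T_add J.T_smult\<close>)
    then show ?thesis using J.T_cross_rotate[of x y z] that by simp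
  qed
  have u: "u \<in> carrier J" using J.base_point by simp
  let ?two = "\<one>\<^bsub>E\<^esub> \<oplus>\<^bsub>E\<^esub> \<one>\<^bsub>E\<^esub>" and ?three = "\<one>\<^bsub>E\<^esub> \<oplus>\<^bsub>E\<^esub> \<one>\<^bsub>E\<^esub> \<oplus>\<^bsub>E\<^esub> \<one>\<^bsub>E\<^esub>"
  have "T u (u \<times>\<^sub># u) = ?two \<otimes>\<^bsub>E\<^esub> ?three"
    using u by (simp add: J.cross_self J.T_smult_right J.T_sharp_self[OF two_nonzero_E] J.N_base_point)
  then have "?two \<otimes>\<^bsub>E\<^esub> ?three = \<zero>\<^bsub>E\<^esub>" using 3[OF u u u] by metis
  then have "?three = \<zero>\<^bsub>E\<^esub>" using J.integral two_nonzero_E by blast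
  then show False using emb_third by simp
qed

text \<open>
  An element of \<open>K\<close> is determined by its images under \<open>\<alpha>\<close> and \<open>\<beta>\<close>, and an element of \<open>\<J>\<close> by its two
  entries. In these coordinates every axiom is the corresponding property of \<open>(J, N, \<sharp>, T)\<close>, with
  powers of \<open>\<eta>\<close> that match on both sides.
\<close>

lemma hermitian: "hermitian_cubic_norm_structure F K \<tau> JK N\<^sub>K sharp\<^sub>K T\<^sub>K"
proof -
  note [simp] = J.T_closed J.N_closed J.sharp_closed
  interpret K: cring K by (rule K_cring)
  interpret JK: module K JK by (rule JK_module)
  show ?thesis
  proof
    show "quadratic_etale F K \<tau>"
      using quadratic_algebra_etale two_nonzero \<mu>_closed \<mu>_nonzero by blast
    obtain a where a: "a \<in> \<J>" "N (j\<^sub>1 a) \<noteq> \<zero>\<^bsub>E\<^esub>" using N_nonzero_on_\<J> by blast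
    have "\<alpha> \<zero>\<^bsub>K\<^esub> = \<zero>\<^bsub>E\<^esub>" by (simp add: \<alpha>_def quadratic_algebra_sel)
    then have "\<eta> \<otimes>\<^bsub>E\<^esub> N (j\<^sub>1 a) = \<zero>\<^bsub>E\<^esub>" if "N\<^sub>K a = \<zero>\<^bsub>K\<^esub>"
      using N\<^sub>K_entries(1)[OF a(1)] that by metis
    then have "N\<^sub>K a \<noteq> \<zero>\<^bsub>K\<^esub>"
      using a \<eta>(2) J.integral[of \<eta> "N (j\<^sub>1 a)"] by auto
    then show "\<exists>a\<in>carrier JK. N\<^sub>K a \<noteq> \<zero>\<^bsub>K\<^esub>" using a by auto
  next
    fix a b c assume "a \<in> carrier JK" "b \<in> carrier JK" "c \<in> carrier JK"
    then show "T\<^sub>K (a \<oplus>\<^bsub>JK\<^esub> b) c = T\<^sub>K a c \<oplus>\<^bsub>K\<^esub> T\<^sub>K b c" "T\<^sub>K a (b \<oplus>\<^bsub>JK\<^esub> c) = T\<^sub>K a b \<oplus>\<^bsub>K\<^esub> T\<^sub>K a c"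
      by (auto intro!: \<alpha>\<beta>_eqI simp: J.T_add J.T_add_right E.r_distr)
  next
    fix s t a b assume "s \<in> carrier K" "t \<in> carrier K" "a \<in> carrier JK" "b \<in> carrier JK"
    then show "T\<^sub>K (s \<odot>\<^bsub>JK\<^esub> a) (t \<odot>\<^bsub>JK\<^esub> b) = s \<otimes>\<^bsub>K\<^esub> \<tau> t \<otimes>\<^bsub>K\<^esub> T\<^sub>K a b"
      by (auto intro!: \<alpha>\<beta>_eqI simp: J.T_smult J.T_smult_right E.cring_simprules)
  next
    fix a b assume "a \<in> carrier JK" "b \<in> carrier JK"
    then show "\<tau> (T\<^sub>K a b) = T\<^sub>K b a"
      by (auto intro!: \<alpha>\<beta>_eqI simp: J.T_sym)
  next
    fix t a assume "t \<in> carrier K" "a \<in> carrier JK"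
    then show "sharp\<^sub>K (t \<odot>\<^bsub>JK\<^esub> a) = (\<tau> t [^]\<^bsub>K\<^esub> (2::nat)) \<odot>\<^bsub>JK\<^esub> sharp\<^sub>K a"
      "N\<^sub>K (t \<odot>\<^bsub>JK\<^esub> a) = t [^]\<^bsub>K\<^esub> (3::nat) \<otimes>\<^bsub>K\<^esub> N\<^sub>K a"
      by (auto intro!: \<J>_eqI \<alpha>\<beta>_eqI simp: J.sharp_smult J.N_smult numeral_2_eq_2 numeral_3_eq_3
          J.smult_assoc1[symmetric] E.cring_simprules)
  next
    fix a b assume "a \<in> carrier JK" "b \<in> carrier JK"
    then show "N\<^sub>K (a \<oplus>\<^bsub>JK\<^esub> b) = N\<^sub>K a \<oplus>\<^bsub>K\<^esub> T\<^sub>K b (sharp\<^sub>K a) \<oplus>\<^bsub>K\<^esub> T\<^sub>K a (sharp\<^sub>K b) \<oplus>\<^bsub>K\<^esub> N\<^sub>K b"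
      by (auto intro!: \<alpha>\<beta>_eqI simp: J.N_add J.T_smult_right E.r_distr)
  next
    fix a assume "a \<in> carrier JK"
    then show "sharp\<^sub>K (sharp\<^sub>K a) = N\<^sub>K a \<odot>\<^bsub>JK\<^esub> a"
      by (auto intro!: \<J>_eqI simp: J.sharp_smult J.sharp_sharp numeral_2_eq_2
          J.smult_assoc1[symmetric] E.cring_simprules)
  qed auto
qed

text \<open>
  For \<open>b, c \<in> \<J>\<close> the product in \<open>A\<close> has \<open>K\<close>-part \<open>T\<^sub>K b c\<close> and \<open>\<J>\<close>-part \<open>b \<times> c\<close> by construction, and right
  multiplication of \<open>\<J>\<close> by an element of \<open>K\<close> is the action of its conjugate; these are the terms of the
  product in the hermitian algebra.
\<close>

lemma hermitian_algebra_iso: "(\<lambda>x. (diag x, offdiag x)) \<in> inv_algebra_iso F A (hermitian_algebra K \<tau> JK sharp\<^sub>K T\<^sub>K)"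
proof -
  let ?H = "hermitian_algebra K \<tau> JK sharp\<^sub>K T\<^sub>K"
  let ?h = "\<lambda>x. (diag x, offdiag x)"
  note [simp] = J.T_closed offdiag_closed mult_closed unit_closed invol_closed
  note [simp] = \<J>_carrier[OF offdiag_closed]
  have split: "s\<^sub>1 x = s\<^sub>1 y \<and> s\<^sub>2 x = s\<^sub>2 y \<and> j\<^sub>1 x = j\<^sub>1 y \<and> j\<^sub>2 x = j\<^sub>2 y"
    if "x \<in> carrier A" "y \<in> carrier A" "?h x = ?h y" for x y
    using that by (metis \<alpha>_diag \<beta>_diag offdiag_entries prod.inject)
  have "?h \<in> ring_iso A ?H"
  proof (rule ring_iso_memI)
    fix x assume "x \<in> carrier A"
    then show "?h x \<in> carrier ?H" by (simp add: hermitian_algebra_def)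
  next
    fix x y assume "x \<in> carrier A" "y \<in> carrier A"
    then show "?h (x \<otimes>\<^bsub>A\<^esub> y) = ?h x \<otimes>\<^bsub>?H\<^esub> ?h y" "?h (x \<oplus>\<^bsub>A\<^esub> y) = ?h x \<oplus>\<^bsub>?H\<^esub> ?h y"
      by (auto intro!: \<J>_eqI \<alpha>\<beta>_eqI simp: hermitian_algebra_def)
  next
    show "?h \<one>\<^bsub>A\<^esub> = \<one>\<^bsub>?H\<^esub>"
      by (auto intro!: \<J>_eqI \<alpha>\<beta>_eqI simp: hermitian_algebra_def)
  next
    show "bij_betw ?h (carrier A) (carrier ?H)"
      unfolding bij_betw_def
    proof
      show "inj_on ?h (carrier A)" by (rule inj_onI) (use split entries_eqI in blast)
      have "z \<in> ?h ` carrier A" if "z \<in> carrier K \<times> \<J>" for z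
      proof
        show "z = ?h (\<kappa> (fst z) \<oplus>\<^bsub>A\<^esub> snd z)"
          using that by (auto intro!: \<J>_eqI \<alpha>\<beta>_eqI simp: \<J>_carrier \<J>_diagonal)
        show "\<kappa> (fst z) \<oplus>\<^bsub>A\<^esub> snd z \<in> carrier A" using that by (auto simp: \<J>_carrier)
      qed
      then show "?h ` carrier A = carrier ?H" by (auto simp: hermitian_algebra_def)
    qed
  qed
  moreover have "?h (c \<odot>\<^bsub>A\<^esub> x) = c \<odot>\<^bsub>?H\<^esub> ?h x" if "c \<in> carrier F" "x \<in> carrier A" for c x
  proof -
    interpret KA: algebra F K by (rule K_algebra)
    show ?thesis using that
      by (auto intro!: \<J>_eqI \<alpha>\<beta>_eqI simp: hermitian_algebra_def)
  qed
  moreover have "?h (invol A x) = invol ?H (?h x)" if "x \<in> carrier A" for x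
    using that by (auto intro!: \<J>_eqI \<alpha>\<beta>_eqI simp: hermitian_algebra_def)
  ultimately show ?thesis by (auto simp: inv_algebra_iso_def)
qed

end

theorem theorem5p14:
  fixes F :: "'f ring" and E :: "('f, 'e) module" and A :: "('f, 'a) inv_algebra"
  assumes "field F"
    and "[(2::nat)] \<cdot>\<^bsub>F\<^esub> \<one>\<^bsub>F\<^esub> \<noteq> \<zero>\<^bsub>F\<^esub>" and "[(3::nat)] \<cdot>\<^bsub>F\<^esub> \<one>\<^bsub>F\<^esub> \<noteq> \<zero>\<^bsub>F\<^esub>"
    and "field_extension F E" and "\<exists>n\<le>2. extension_degree F E n"
    and "structurable_algebra F A"
    and "\<exists>(J :: ('e, 'j) module) N sharp T u. \<exists>\<eta> \<in> carrier E - {\<zero>\<^bsub>E\<^esub>}.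
           cubic_norm_structure E J N sharp T u \<and>
           inv_algebra_iso E (scalar_extension F A E) (matrix_algebra E J sharp T \<eta>) \<noteq> {}"
  shows "\<exists>(K :: ('f, 'f \<times> 'f) module) \<sigma> (J :: ('f \<times> 'f, 'a) module) N sharp T.
           hermitian_cubic_norm_structure F K \<sigma> J N sharp T \<and>
           inv_algebra_iso F A (hermitian_algebra K \<sigma> J sharp T) \<noteq> {}"
proof -
  from assms(7) obtain J :: "('e, 'j) module" and N sharp T u \<eta> \<phi>
    where \<eta>: "\<eta> \<in> carrier E" "\<eta> \<noteq> \<zero>\<^bsub>E\<^esub>" and J: "cubic_norm_structure E J N sharp T u"
      and \<phi>: "\<phi> \<in> inv_algebra_iso E (scalar_extension F A E) (matrix_algebra E J sharp T \<eta>)"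
    by blast
  from assms(5) obtain n where "extension_degree F E n" by blast
  moreover have "algebra F E" using assms(4) by (simp add: field_extension_def)
  ultimately interpret form_of_matrix_algebra F A E J N sharp T u \<eta> \<phi> n
    unfolding form_of_matrix_algebra_def structurable_algebra_extension_def
      form_of_matrix_algebra_axioms_def
    using assms(6) J \<eta> \<phi> by blast
  show ?thesis using hermitian hermitian_algebra_iso by blast
qed

end
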